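(* The random set of local extrema of $B$, $M(\omega):=\{t\in\mathbb{R}:\omega\text{ attains a local minimum or a local maximum at }t\}$, does not admit an honest indexation.
   Context: $\Omega_0:=\{\omega:\mathbb{R}\to\mathbb{R}\text{ continuous},\ \omega(0)=0\}$, with canonical process $B=(B_t)_{t\in\mathbb{R}}$. $\mathsf{W}$ is the completed two-sided Wiener measure on $\Omega_0$: $(B_t)_{t\ge0}$ and $(B_{-t})_{t\ge 0}$ are independent standard Brownian motions under $\mathsf{W}$. For extended-real $s<t$, $\mathcal{F}_{s,t}$ is the $\sigma$-field generated by the increments of $B$ between the times $s$ and $t$ and by all events of $\mathsf{W}$-probability $0$ or $1$. For $u\in\mathbb{R}$ the Lévy shift is $\Delta_u(\omega)(t):=\omega(u+t)-\omega(u)$. $\mathbb{R}^\dagger:=\mathbb{R}\cup\{\dagger\}$ with $\dagger\notin\mathbb{R}$ a coffin state, endowed with the $\sigma$-field generated by the Borel sets of $\mathbb{R}$ and $\{\dagger\}$; $u+\dagger:=\dagger$. A random set is a map $M:\Omega_0\to2^{\mathbb{R}}$. An honest indexation for a random set $M$ is a family $\tau=(\tau_{s,t})_{(s,t)\in\mathbb{R}^2,s<t}$ of $\mathcal{F}_{-\infty,\infty}$-measurable $\mathbb{R}^\dagger$-valued maps such that ($\mathsf{W}$-a.s. understood): (inclusion) $\tau_{s,t}\in M$ a.s. for all real $s<t$; (exhaustion) $M=\{\tau_{s,t}:(s,t)\in\mathbb{Q}^2,s<t\}$ a.s.; (locality) $\tau_{s,t}$ is a.s. valued in $(s,t)$ and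 is $\mathcal{F}_{s,t}$-measurable for all real $s<t$; (stationarity) $\tau_{s+h,t+h}=h+\tau_{s,t}(\Delta_h)$ a.s. for all real $h$ and $s<t$; (nestedness) $\tau_{s,t}=\tau_{u,v}$ a.s. on $\{\tau_{s,t}\in(u,v)\}$ for all real $s\le u<v\le t$. *)

theory Defs
  imports "HOL-Probability.Probability"
begin

definition Omega0 :: "(real \<Rightarrow> real) set" where
  "Omega0 = {\<omega>. continuous_on UNIV \<omega> \<and> \<omega> 0 = 0}"

definition path_space :: "(real \<Rightarrow> real) measure" where
  "path_space = restrict_space (\<Pi>\<^sub>M t\<in>(UNIV :: real set). (borel :: real measure)) Omega0"

definition standard_brownian_motion :: "'w measure \<Rightarrow> (real \<Rightarrow> 'w \<Rightarrow> real) \<Rightarrow> bool" where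
  "standard_brownian_motion P X \<longleftrightarrow>
     prob_space P \<and>
     (\<forall>t\<ge>0. X t \<in> borel_measurable P) \<and>
     (\<forall>\<omega>\<in>space P. X 0 \<omega> = 0 \<and> continuous_on {0..} (\<lambda>t. X t \<omega>)) \<and>
     (\<forall>s t. 0 \<le> s \<and> s < t \<longrightarrow>
        distributed P lborel (\<lambda>\<omega>. X t \<omega> - X s \<omega>) (\<lambda>x. ennreal (normal_density 0 (sqrt (t - s)) x))) \<and>
     (\<forall>(n::nat) r. 0 \<le> r 0 \<and> (\<forall>i<n. r i \<le> r (Suc i)) \<longrightarrow>
        prob_space.indep_vars P (\<lambda>_. borel) (\<lambda>i \<omega>. X (r (Suc i)) \<omega> - X (r i) \<omega>) {..<n})"

text \<open>
  The libraries contain no construction of Wiener measure, so it enters through its defining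
  property (which determines it uniquely): the completion of the probability on the
  sigma-field generated by the coordinates under which the two halves of the canonical process
  are independent standard Brownian motions.
\<close>

definition two_sided_wiener_measure :: "(real \<Rightarrow> real) measure \<Rightarrow> bool" where
  "two_sided_wiener_measure W \<longleftrightarrow>
     (\<exists>P. W = completion P \<and> sets P = sets path_space \<and> prob_space P \<and>
        standard_brownian_motion P (\<lambda>t \<omega>. \<omega> t) \<and>
        standard_brownian_motion P (\<lambda>t \<omega>. \<omega> (- t)) \<and>
        prob_space.indep_var P
          (\<Pi>\<^sub>M t\<in>{0::real..}. borel) (\<lambda>\<omega>. \<lambda>t\<in>{0..}. \<omega> t)
          (\<Pi>\<^sub>M t\<in>{0::real..}. borel) (\<lambda>\<omega>. \<lambda>t\<in>{0..}. \<omega> (- t)))"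

definition increment_field :: "(real \<Rightarrow> real) measure \<Rightarrow> ereal \<Rightarrow> ereal \<Rightarrow> (real \<Rightarrow> real) measure" where
  "increment_field W s t = sigma (space W)
     ({(\<lambda>\<omega>. \<omega> v - \<omega> u) -` A \<inter> space W | u v A.
          s \<le> ereal u \<and> u \<le> v \<and> ereal v \<le> t \<and> A \<in> sets (borel :: real measure)} \<union>
      {E \<in> sets W. measure W E = 0 \<or> measure W E = 1})"

definition levy_shift :: "real \<Rightarrow> (real \<Rightarrow> real) \<Rightarrow> (real \<Rightarrow> real)" where
  "levy_shift u \<omega> = (\<lambda>t. \<omega> (u + t) - \<omega> u)"

text \<open>
  The reals with a coffin state are rendered as \<^typ>\<open>real option\<close>, with \<^term>\<open>None\<close> as the coffin
  state; translation by \<open>u\<close>, which fixes the coffin state, is \<open>map_option ((+) u)\<close>.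
\<close>

definition real_coffin :: "real option measure" where
  "real_coffin = sigma UNIV ({Some ` A | A. A \<in> sets borel} \<union> {{None}})"

text \<open>
  After the global measurability, the conjuncts are the properties usually called inclusion,
  exhaustion, locality, stationarity and nestedness, in this order.
  Only the values \<open>\<tau> s t\<close> with \<open>s < t\<close> matter. Membership of \<open>\<tau> s t \<omega>\<close> in a set of reals is
  membership in its image under \<^term>\<open>Some\<close>; in particular it excludes the coffin state.
\<close>

definition honest_indexation ::
    "(real \<Rightarrow> real) measure \<Rightarrow> ((real \<Rightarrow> real) \<Rightarrow> real set) \<Rightarrow>
     (real \<Rightarrow> real \<Rightarrow> (real \<Rightarrow> real) \<Rightarrow> real option) \<Rightarrow> bool" where
  "honest_indexation W M \<tau> \<longleftrightarrow>
     (\<forall>s t. s < t \<longrightarrow> \<tau> s t \<in> measurable (increment_field W (-\<infinity>) \<infinity>) real_coffin) \<and>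
     (\<forall>s t. s < t \<longrightarrow> (AE \<omega> in W. \<tau> s t \<omega> \<in> Some ` M \<omega>)) \<and>
     (AE \<omega> in W. Some ` M \<omega> = {\<tau> s t \<omega> | s t. s \<in> \<rat> \<and> t \<in> \<rat> \<and> s < t}) \<and>
     (\<forall>s t. s < t \<longrightarrow> (AE \<omega> in W. \<tau> s t \<omega> \<in> Some ` {s<..<t}) \<and>
        \<tau> s t \<in> measurable (increment_field W (ereal s) (ereal t)) real_coffin) \<and>
     (\<forall>h s t. s < t \<longrightarrow>
        (AE \<omega> in W. \<tau> (s + h) (t + h) \<omega> = map_option ((+) h) (\<tau> s t (levy_shift h \<omega>)))) \<and>
     (\<forall>s u v t. s \<le> u \<and> u < v \<and> v \<le> t \<longrightarrow>
        (AE \<omega> in W. \<tau> s t \<omega> \<in> Some ` {u<..<v} \<longrightarrow> \<tau> s t \<omega> = \<tau> u v \<omega>))"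

definition local_extrema :: "(real \<Rightarrow> real) \<Rightarrow> real set" where
  "local_extrema \<omega> =
     {t. (\<forall>\<^sub>F s in nhds t. \<omega> t \<le> \<omega> s) \<or> (\<forall>\<^sub>F s in nhds t. \<omega> s \<le> \<omega> t)}"

end

theory Submission
  imports Defs
begin

text \<open>
  Suppose \<open>\<tau>\<close> is an honest indexation. By nestedness, \<open>y \<mapsto> \<tau> 0 y\<close> is a record process: its
  value either persists or is replaced by a point beyond the previous index. If a new record is set
  immediately after a time \<open>T\<close>, later records only depend on the path after \<open>T\<close>. For given
  \<open>t\<close>, the first such \<open>T \<ge> t\<close> is a stopping time, so the records after it form a fresh copy
  of the whole process. Fix \<open>\<delta>\<close> and call a record long if it persists for time more than
  \<open>\<delta>\<close> after its own position \<open>g\<close>. By regeneration the first long record is a maximum with a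
  probability that does not depend on the path before \<open>t\<close>, as long as \<open>t < g\<close>; letting
  \<open>t\<close> increase to \<open>g\<close> along finer and finer grids, its type is independent of the path
  before \<open>g\<close>. But that path already shows whether \<open>g\<close> is a maximum or a minimum, so the
  type is almost surely constant. On the other hand, exhaustion forces both types to occur with
  positive probability once \<open>\<delta>\<close> is small.
\<close>

section \<open>Increments of a two-sided Brownian motion\<close>

text \<open>Records accumulate at 0, since \<open>\<tau> 0 y\<close> lies in (0, y), so there is no
  first record. The threshold \<delta> thins them out: two long records lie more than \<delta>
  apart. That the record at g is long shows only later, so g is not a stopping time and no Markov
  property is available there. Regeneration is therefore applied at the restart time T after a
  deterministic t, on the event that no record at or before t is long. This event, too, can depend
  on the path after t, but it is decided once T has passed, because records at or before t do not
  return. A second obstacle is that T might itself be a record, which the process started just after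
  T would miss. This is excluded because a Brownian path oscillates immediately after a stopping
  time, so that T is not a local extremum. The path before g tells the two types apart by one test:
  arbitrarily close to the left of a maximum the path takes strictly smaller values, close to a
  minimum it cannot.\<close>

lemma (in prob_space) indep_vars_Un:
  assumes I: "indep_vars M' X I" and J: "indep_vars M' X J"
    and ind: "indep_set S T" and S: "sigma_algebra (space M) S" and T: "sigma_algebra (space M) T"
    and XS: "\<And>i A. i \<in> I \<Longrightarrow> A \<in> sets (M' i) \<Longrightarrow> X i -` A \<inter> space M \<in> S"
    and XT: "\<And>i A. i \<in> J \<Longrightarrow> A \<in> sets (M' i) \<Longrightarrow> X i -` A \<inter> space M \<in> T"
    and disj: "I \<inter> J = {}"
  shows "indep_vars M' X (I \<union> J)"
  unfolding indep_vars_def2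
proof (intro conjI indep_setsI)
  interpret S: sigma_algebra "space M" S by fact
  interpret T: sigma_algebra "space M" T by fact
  let ?F = "\<lambda>i. {X i -` A \<inter> space M |A. A \<in> sets (M' i)}"
  have II: "indep_sets ?F I" and JJ: "indep_sets ?F J"
    using I J unfolding indep_vars_def2 by auto
  show "\<forall>i\<in>I \<union> J. random_variable (M' i) (X i)"
    using I J unfolding indep_vars_def2 by auto
  show "?F i \<subseteq> events" if "i \<in> I \<union> J" for i
    using II JJ that unfolding indep_sets_def by blast
  fix A K assume K: "K \<noteq> {}" "K \<subseteq> I \<union> J" "finite K" and A: "\<forall>j\<in>K. A j \<in> ?F j"
  \<comment> \<open>The empty index set stands for the whole space, so a \<open>K\<close> inside one
    family needs no separate case. The lemma serves to splice the increments on the two half lines,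
    whose independence is given only separately.\<close>
  define B where "B = (\<lambda>L. if L = {} then space M else (\<Inter>j\<in>L. A j))"
  have Bp: "prob (B L) = (\<Prod>j\<in>L. prob (A j))" if "L \<subseteq> K" "L \<subseteq> I \<or> L \<subseteq> J" for L
  proof (cases "L = {}")
    case False
    have "finite L" using that K finite_subset by blast
    then show ?thesis
      using that A False indep_setsD[OF II, of L A] indep_setsD[OF JJ, of L A] 
      unfolding B_def by (auto simp: subset_iff)
  qed (simp add: B_def prob_space)
  have "finite (K \<inter> I)" "finite (K \<inter> J)" using K by auto
  have BS: "B (K \<inter> I) \<in> S"
    unfolding B_def using A XS K by (auto intro!: S.finite_INT)
  have BT: "B (K \<inter> J) \<in> T"
    unfolding B_def using A XT K by (auto intro!: T.finite_INT)
  have sub: "A j \<subseteq> space M" if "j \<in> K" for j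
    using A that by blast
  have "(\<Inter>j\<in>K. A j) = B (K \<inter> I) \<inter> B (K \<inter> J)"
    using K sub unfolding B_def by (auto split: if_splits) blast+
  then have "prob (\<Inter>j\<in>K. A j) = (\<Prod>j\<in>K \<inter> I. prob (A j)) * (\<Prod>j\<in>K \<inter> J. prob (A j))"
    using indep_setD[OF ind BS BT] Bp by simp
  also have "\<dots> = (\<Prod>j\<in>(K \<inter> I) \<union> (K \<inter> J). prob (A j))"
    using K disj by (intro prod.union_disjoint[symmetric]) auto
  also have "(K \<inter> I) \<union> (K \<inter> J) = K" using K by auto
  finally show "prob (\<Inter>j\<in>K. A j) = (\<Prod>j\<in>K. prob (A j))" .
qed

lemma (in prob_space) indep_vars_reindex:
  assumes "inj_on f I" "indep_vars M' X (f ` I)"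
  shows "indep_vars (\<lambda>i. M' (f i)) (\<lambda>i. X (f i)) I"
  unfolding indep_vars_def2
proof (intro conjI indep_setsI)
  let ?F = "\<lambda>i. {X i -` A \<inter> space M |A. A \<in> sets (M' i)}"
  have I: "indep_sets ?F (f ` I)" and "\<forall>i\<in>f ` I. random_variable (M' i) (X i)"
    using assms unfolding indep_vars_def2 by auto
  then show "\<forall>i\<in>I. random_variable (M' (f i)) (X (f i))" by auto
  show "?F (f i) \<subseteq> events" if "i \<in> I" for i
    using I that unfolding indep_sets_def by blast
  fix A K assume K: "K \<noteq> {}" "K \<subseteq> I" "finite K" and A: "\<forall>j\<in>K. A j \<in> ?F (f j)"
  have inj: "inj_on f K" using assms K inj_on_subset by blast
  have "prob (\<Inter>j\<in>f ` K. A (the_inv_into K f j)) = (\<Prod>j\<in>f ` K. prob (A (the_inv_into K f j)))"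
    using K A by (intro indep_setsD[OF I]) (auto simp: the_inv_into_f_f[OF inj])
  then show "prob (\<Inter>j\<in>K. A j) = (\<Prod>j\<in>K. prob (A j))"
    using inj by (simp add: prod.reindex the_inv_into_f_f[OF inj])
qed

text \<open>The probability is taken before completion: its events are generated by the coordinates,
  so laws can be compared on cylinders.\<close>

locale wiener_space = P: prob_space P for P :: "(real \<Rightarrow> real) measure" +
  assumes sets_P: "sets P = sets path_space"
    and bm_right: "standard_brownian_motion P (\<lambda>t \<omega>. \<omega> t)"
    and bm_left: "standard_brownian_motion P (\<lambda>t \<omega>. \<omega> (- t))"
    and indep_halves: "P.indep_var
          (\<Pi>\<^sub>M t\<in>{0::real..}. borel) (\<lambda>\<omega>. \<lambda>t\<in>{0..}. \<omega> t)
          (\<Pi>\<^sub>M t\<in>{0::real..}. borel) (\<lambda>\<omega>. \<lambda>t\<in>{0..}. \<omega> (- t))"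
begin

lemma space_P: "space P = Omega0"
  using sets_eq_imp_space_eq[OF sets_P] unfolding path_space_def
  by (simp add: space_restrict_space space_PiM)

lemma coord_meas [measurable]: "(\<lambda>\<omega>. \<omega> t) \<in> borel_measurable P"
proof -
  have "(\<lambda>\<omega>. \<omega> t) \<in> borel_measurable path_space"
    unfolding path_space_def by (intro measurable_restrict_space1 measurable_component_singleton) simp
  then show ?thesis using sets_P measurable_cong_sets by blast
qed

lemma path_meas: "(\<lambda>\<omega>. \<omega>) \<in> measurable P (\<Pi>\<^sub>M t\<in>UNIV. borel)"
  by (rule measurable_PiM_single') (auto simp: )

lemma increment_distributed:
  assumes "s < t" "0 \<le> s \<or> t \<le> 0"
  shows "distributed P lborel (\<lambda>\<omega>. \<omega> t - \<omega> s) (normal_density 0 (sqrt (t - s)))"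
proof (cases "0 \<le> s")
  case True
  then show ?thesis using bm_right assms unfolding standard_brownian_motion_def by auto
next
  case False
  then have "distributed P lborel (\<lambda>\<omega>. \<omega> s - \<omega> t) (normal_density 0 (sqrt (t - s)))"
    using bm_left assms spec[of "\<lambda>s'. \<forall>t'. 0 \<le> s' \<and> s' < t' \<longrightarrow> distributed P lborel (\<lambda>\<omega>. \<omega> (- t') - \<omega> (- s')) (normal_density 0 (sqrt (t' - s')))" "-t"]
    unfolding standard_brownian_motion_def by (auto dest!: spec[where x="-s"])
  \<comment> \<open>The motion run backwards yields the increment with the opposite sign; the
    centred normal law is symmetric.\<close>
  from P.normal_density_affine[OF this, of "-1" 0] show ?thesis
    using assms by simp
qed

lemma half_lines_indep_set:
  "P.indep_set
      (sigma_sets (space P) {(\<lambda>\<omega>. \<lambda>t\<in>{0..}. \<omega> t) -` A \<inter> space P | A. A \<in> sets (\<Pi>\<^sub>M t\<in>{0::real..}. (borel :: real measure))})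
      (sigma_sets (space P) {(\<lambda>\<omega>. \<lambda>t\<in>{0..}. \<omega> (- t)) -` A \<inter> space P | A. A \<in> sets (\<Pi>\<^sub>M t\<in>{0::real..}. (borel :: real measure))})"
  using indep_halves unfolding P.indep_var_eq by auto

text \<open>With 0 among the grid points every increment belongs to one half line. Within a half
  line independence is part of the definition, and across them it comes from the independence of the
  two halves.\<close>

lemma increments_indep:
  assumes r: "\<And>i. i < n \<Longrightarrow> r i < r (Suc i)" and k: "k \<le> n" "r k = 0"
  shows "P.indep_vars (\<lambda>_. borel) (\<lambda>i \<omega>. \<omega> (r (Suc i)) - \<omega> (r i)) {..<n}"
proof -
  let ?X = "\<lambda>i \<omega>. \<omega> (r (Suc i)) - \<omega> (r i)"
  have mono: "r i \<le> r j" if "i \<le> j" "j \<le> n" for i j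
    using that(1)
    using that(2)
  proof (induction rule: dec_induct)
    case (step m)
    then show ?case using r[of m] by auto
  qed simp
  have R: "P.indep_vars (\<lambda>_. borel) ?X {k..<n}"
  proof -
    have "P.indep_vars (\<lambda>_. borel) (\<lambda>i \<omega>. \<omega> (r (k + Suc i)) - \<omega> (r (k + i))) {..<n-k}"
      using bm_right unfolding standard_brownian_motion_def
      using k r by (auto dest!: spec[where x="n-k"] spec[where x="\<lambda>i. r (k+i)"] intro: less_imp_le)
    then have "P.indep_vars (\<lambda>_. borel) (\<lambda>i \<omega>. \<omega> (r (k + Suc (i - k))) - \<omega> (r (k + (i - k)))) {k..<n}"
      by (intro P.indep_vars_reindex[where M'="\<lambda>_. borel" and f="\<lambda>i. i - k" and X="\<lambda>i \<omega>. \<omega> (r (k + Suc i)) - \<omega> (r (k + i))"])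
         (auto simp: inj_on_def elim!: P.indep_vars_subset)
    then show ?thesis
      by (rule P.indep_vars_cong[THEN iffD1, rotated -1]) auto
  qed
  have L: "P.indep_vars (\<lambda>_. borel) ?X {..<k}"
  proof -
    have "P.indep_vars (\<lambda>_. borel) (\<lambda>i \<omega>. \<omega> (- (- r (k - Suc i))) - \<omega> (- (- r (k - i)))) {..<k}"
      using bm_left unfolding standard_brownian_motion_def
      using k mono by (auto dest!: spec[where x="k"] spec[where x="\<lambda>i. - r (k-i)"] intro: less_imp_le)
    then have "P.indep_vars (\<lambda>_. borel) (\<lambda>i \<omega>. - (\<omega> (r (k - Suc i)) - \<omega> (r (k - i)))) {..<k}"
      by (intro P.indep_vars_compose2[where Y="\<lambda>_. uminus" and M'="\<lambda>_. borel"]) auto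
    \<comment> \<open>The backward motion lists its increments from 0 outwards;
      \<open>k - Suc i\<close> restores the order of the grid.\<close>
    then have "P.indep_vars (\<lambda>_. borel) (\<lambda>i \<omega>. - (\<omega> (r (k - Suc (k - Suc i))) - \<omega> (r (k - (k - Suc i))))) {..<k}"
      by (intro P.indep_vars_reindex[where M'="\<lambda>_. borel" and f="\<lambda>i. k - Suc i" and X="\<lambda>i \<omega>. - (\<omega> (r (k - Suc i)) - \<omega> (r (k - i)))"])
         (auto simp: inj_on_def elim!: P.indep_vars_subset)
    then show ?thesis
      by (rule P.indep_vars_cong[THEN iffD1, rotated -1]) (auto simp: fun_eq_iff Suc_diff_Suc)
  qed
  have "P.indep_vars (\<lambda>_. borel) ?X ({k..<n} \<union> {..<k})"
  proof (rule P.indep_vars_Un[OF R L half_lines_indep_set])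
    fix i and A :: "real set" assume i: "i \<in> {k..<n}" and A: "A \<in> sets borel"
    have pos: "0 \<le> r i" "0 \<le> r (Suc i)" using mono[of k i] mono[of k "Suc i"] i k by auto
    have "(\<lambda>f. f (r (Suc i)) - f (r i)) \<in> borel_measurable (\<Pi>\<^sub>M t\<in>{0::real..}. (borel :: real measure))"
      using pos by (intro borel_measurable_diff measurable_component_singleton) auto
    from measurable_sets[OF this A]
    show "?X i -` A \<inter> space P \<in> sigma_sets (space P) {(\<lambda>\<omega>. \<lambda>t\<in>{0..}. \<omega> t) -` A \<inter> space P | A. A \<in> sets (\<Pi>\<^sub>M t\<in>{0::real..}. (borel :: real measure))}"
      using pos by (intro sigma_sets.Basic CollectI exI[of _ "(\<lambda>f. f (r (Suc i)) - f (r i)) -` A \<inter> space (\<Pi>\<^sub>M t\<in>{0::real..}. (borel :: real measure))"])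
        (auto simp: space_PiM)
  next
    fix i and A :: "real set" assume i: "i \<in> {..<k}" and A: "A \<in> sets borel"
    have pos: "0 \<le> - r i" "0 \<le> - r (Suc i)" using mono[of i k] mono[of "Suc i" k] i k by auto
    have "(\<lambda>f. f (- r (Suc i)) - f (- r i)) \<in> borel_measurable (\<Pi>\<^sub>M t\<in>{0::real..}. (borel :: real measure))"
      using pos by (intro borel_measurable_diff measurable_component_singleton) auto
    from measurable_sets[OF this A]
    show "?X i -` A \<inter> space P \<in> sigma_sets (space P) {(\<lambda>\<omega>. \<lambda>t\<in>{0..}. \<omega> (- t)) -` A \<inter> space P | A. A \<in> sets (\<Pi>\<^sub>M t\<in>{0::real..}. (borel :: real measure))}"
      using pos by (intro sigma_sets.Basic CollectI exI[of _ "(\<lambda>f. f (- r (Suc i)) - f (- r i)) -` A \<inter> space (\<Pi>\<^sub>M t\<in>{0::real..}. (borel :: real measure))"])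
        (auto simp: space_PiM)
  qed (auto intro!: sigma_algebra_sigma_sets)
  moreover have "{k..<n} \<union> {..<k} = {..<n}" using k by auto
  ultimately show ?thesis by simp
qed

text \<open>The law depends on the grid only through its spacings, which is the source of the
  invariance under shifts.\<close>

lemma increments_law:
  assumes r: "\<And>i. i < n \<Longrightarrow> r i < r (Suc i)" and k: "k \<le> n" "r k = 0" and n: "0 < n"
  shows "distr P (\<Pi>\<^sub>M i\<in>{..<n}. borel) (\<lambda>\<omega>. \<lambda>i\<in>{..<n}. \<omega> (r (Suc i)) - \<omega> (r i)) =
    (\<Pi>\<^sub>M i\<in>{..<n}. density lborel (normal_density 0 (sqrt (r (Suc i) - r i))))"
proof -
  have mono: "r i \<le> r j" if "i \<le> j" "j \<le> n" for i j
    using that(1)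
    using that(2)
  proof (induction rule: dec_induct)
    case (step m)
    then show ?case using r[of m] by auto
  qed simp
  have "distr P (\<Pi>\<^sub>M i\<in>{..<n}. borel) (\<lambda>\<omega>. \<lambda>i\<in>{..<n}. \<omega> (r (Suc i)) - \<omega> (r i)) =
    (\<Pi>\<^sub>M i\<in>{..<n}. distr P borel (\<lambda>\<omega>. \<omega> (r (Suc i)) - \<omega> (r i)))"
    using increments_indep[of n r k] r k n
    by (subst (asm) P.indep_vars_iff_distr_eq_PiM) auto
  also have "\<dots> = (\<Pi>\<^sub>M i\<in>{..<n}. density lborel (normal_density 0 (sqrt (r (Suc i) - r i))))"
  proof (rule PiM_cong[OF refl])
    fix i assume i: "i \<in> {..<n}"
    have "0 \<le> r i \<or> r (Suc i) \<le> 0"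
      using mono[of k i] mono[of "Suc i" k] i k by (cases "k \<le> i") auto
    then have "distributed P lborel (\<lambda>\<omega>. \<omega> (r (Suc i)) - \<omega> (r i)) (normal_density 0 (sqrt (r (Suc i) - r i)))"
      using r[of i] i by (intro increment_distributed) auto
    then have "distr P lborel (\<lambda>\<omega>. \<omega> (r (Suc i)) - \<omega> (r i)) = density lborel (normal_density 0 (sqrt (r (Suc i) - r i)))"
      by (rule distributed_distr_eq_density)
    then show "distr P borel (\<lambda>\<omega>. \<omega> (r (Suc i)) - \<omega> (r i)) = density lborel (normal_density 0 (sqrt (r (Suc i) - r i)))"
      by (subst (asm) distr_cong[OF refl sets_lborel refl]) auto
  qed
  finally show ?thesis .
qed

end

section \<open>Invariance of Wiener measure under shifts\<close>

context wiener_space begin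

lemma levy_shift_Omega0: "\<omega> \<in> Omega0 \<Longrightarrow> levy_shift u \<omega> \<in> Omega0"
  unfolding Omega0_def levy_shift_def
  by (auto intro!: continuous_intros continuous_on_compose2[of UNIV \<omega>])

lemma levy_shift_meas [measurable]: "levy_shift u \<in> measurable P P"
proof -
  have "levy_shift u \<in> measurable P path_space"
    unfolding path_space_def
  proof (rule measurable_restrict_space2)
    show "levy_shift u \<in> space P \<rightarrow> Omega0" using levy_shift_Omega0 space_P by auto
    show "levy_shift u \<in> measurable P (\<Pi>\<^sub>M t\<in>UNIV. borel)"
      unfolding levy_shift_def by (rule measurable_PiM_single') (auto simp: )
  qed
  then show ?thesis using sets_P measurable_cong_sets by blast
qed

lemma finite_dim_law_shift:
  assumes "finite J" "\<And>j. j \<in> J \<Longrightarrow> A j \<in> sets (borel :: real measure)"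
  shows "emeasure P {\<omega>\<in>space P. \<forall>j\<in>J. levy_shift u \<omega> j \<in> A j} = emeasure P {\<omega>\<in>space P. \<forall>j\<in>J. \<omega> j \<in> A j}"
proof -
  \<comment> \<open>The points 0 and \<open>-u\<close> make both the grid and its translate by
    \<open>u\<close> contain time 0. The point 1 guarantees a positive number of increments even if
    \<open>u\<close> is 0 and \<open>J\<close> is empty.\<close>
  define K where "K = insert 0 (insert (-u) (insert 1 J))"
  define r where "r = (\<lambda>i. sorted_list_of_set K ! i)"
  define n where "n = card K - 1"
  have fin: "finite K" using assms unfolding K_def by auto
  have "card {0::real, 1} \<le> card K" using fin unfolding K_def by (intro card_mono) auto
  then have n: "0 < n" "card K = Suc n" unfolding n_def by auto
  have r: "r i < r (Suc i)" if "i < n" for i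
    unfolding r_def using that n by (intro sorted_wrt_nth_less[OF strict_sorted_list_of_set]) auto
  have surj: "\<exists>i\<le>n. r i = x" if "x \<in> K" for x
  proof -
    have "x \<in> set (sorted_list_of_set K)" using that fin by simp
    then show ?thesis unfolding in_set_conv_nth r_def using n by (auto simp: less_Suc_eq_le)
  qed
  obtain k where k: "k \<le> n" "r k = 0" using surj[of 0] unfolding K_def by auto
  obtain l where l: "l \<le> n" "r l = - u" using surj[of "-u"] unfolding K_def by auto
  have "\<forall>j\<in>J. \<exists>i. i \<le> n \<and> r i = j" using surj unfolding K_def by auto
  then obtain idx where idx: "\<And>j. j \<in> J \<Longrightarrow> idx j \<le> n" "\<And>j. j \<in> J \<Longrightarrow> r (idx j) = j" by metis
  let ?N = "\<Pi>\<^sub>M i\<in>{..<n}. (borel :: real measure)"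
  let ?L = "\<Pi>\<^sub>M i\<in>{..<n}. density lborel (normal_density 0 (sqrt (r (Suc i) - r i)))"
  \<comment> \<open>Values at the times in \<open>J\<close> are recovered by telescoping from the
    index \<open>k\<close> of time 0; subtracting the partial sum up to \<open>k\<close> covers
    times on either side of 0.\<close>
  define E where "E = {f\<in>space ?N. \<forall>j\<in>J. (\<Sum>i<idx j. f i) - (\<Sum>i<k. f i) \<in> A j}"
  have E: "E \<in> sets ?N"
  proof -
    have "{f\<in>space ?N. (\<Sum>i<idx j. f i) - (\<Sum>i<k. f i) \<in> A j} \<in> sets ?N" if j: "j \<in> J" for j
    proof -
      have "(\<lambda>f. (\<Sum>i<idx j. f i) - (\<Sum>i<k. f i)) \<in> borel_measurable ?N"
        using idx(1)[OF j] k by (intro borel_measurable_diff borel_measurable_sum measurable_component_singleton) auto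
      from measurable_sets[OF this assms(2)[OF j]] show ?thesis
        by (simp add: vimage_def Int_def conj_commute)
    qed
    then show ?thesis unfolding E_def using assms(1) by (intro sets.sets_Collect_finite_All) (auto intro: assms)
  qed
  have tel: "(\<Sum>i<m. (\<lambda>i\<in>{..<n}. f (Suc i) - f i) i) - (\<Sum>i<k. (\<lambda>i\<in>{..<n}. f (Suc i) - f i) i) = f m - f k"
    if "m \<le> n" for m and f :: "nat \<Rightarrow> real"
  proof -
    have "(\<Sum>i<m'. (\<lambda>i\<in>{..<n}. f (Suc i) - f i) i) = f m' - f 0" if "m' \<le> n" for m'
      using that by (subst sum_lessThan_telescope[symmetric]) (intro sum.cong, auto)
    then show ?thesis using that k by simp
  qed
  have "distr P ?N (\<lambda>\<omega>. \<lambda>i\<in>{..<n}. \<omega> (r (Suc i)) - \<omega> (r i)) = ?L"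
    by (rule increments_law[of n r k]) (use r k n in auto)
  moreover have "distr P ?N (\<lambda>\<omega>. \<lambda>i\<in>{..<n}. \<omega> (u + r (Suc i)) - \<omega> (u + r i)) = ?L"
    using increments_law[of n "\<lambda>i. u + r i" l] r l n by simp
  ultimately have eq: "emeasure (distr P ?N (\<lambda>\<omega>. \<lambda>i\<in>{..<n}. \<omega> (u + r (Suc i)) - \<omega> (u + r i))) E =
    emeasure (distr P ?N (\<lambda>\<omega>. \<lambda>i\<in>{..<n}. \<omega> (r (Suc i)) - \<omega> (r i))) E" by simp
  have m: "(\<lambda>\<omega>. \<lambda>i\<in>{..<n}. \<omega> (s i) - \<omega> (t i)) \<in> measurable P ?N" for s t
    by (intro measurable_restrict) auto
  have z: "\<omega> 0 = 0" if "\<omega> \<in> space P" for \<omega> using that by (simp add: space_P Omega0_def)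
  have 1: "(\<lambda>\<omega>. \<lambda>i\<in>{..<n}. \<omega> (u + r (Suc i)) - \<omega> (u + r i)) -` E \<inter> space P = {\<omega>\<in>space P. \<forall>j\<in>J. levy_shift u \<omega> j \<in> A j}"
  proof -
    have "(\<Sum>i<idx j. (\<lambda>i\<in>{..<n}. \<omega> (u + r (Suc i)) - \<omega> (u + r i)) i) - (\<Sum>i<k. (\<lambda>i\<in>{..<n}. \<omega> (u + r (Suc i)) - \<omega> (u + r i)) i) = levy_shift u \<omega> j"
      if "j \<in> J" for \<omega> j
      using tel[of "idx j" "\<lambda>i. \<omega> (u + r i)"] idx[OF that] k unfolding levy_shift_def by simp
    then show ?thesis unfolding E_def by (auto simp del: restrict_apply simp: space_PiM)
  qed
  have 2: "(\<lambda>\<omega>. \<lambda>i\<in>{..<n}. \<omega> (r (Suc i)) - \<omega> (r i)) -` E \<inter> space P = {\<omega>\<in>space P. \<forall>j\<in>J. \<omega> j \<in> A j}"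
  proof -
    have "(\<Sum>i<idx j. (\<lambda>i\<in>{..<n}. \<omega> (r (Suc i)) - \<omega> (r i)) i) - (\<Sum>i<k. (\<lambda>i\<in>{..<n}. \<omega> (r (Suc i)) - \<omega> (r i)) i) = \<omega> j"
      if "j \<in> J" "\<omega> \<in> space P" for \<omega> j
      using tel[of "idx j" "\<lambda>i. \<omega> (r i)"] idx[OF that(1)] k z[OF that(2)] by simp
    then show ?thesis unfolding E_def by (auto simp del: restrict_apply simp: space_PiM)
  qed
  show ?thesis using eq E m by (simp add: emeasure_distr 1 2)
qed

text \<open>Cylinders determine a law on the full product space, and every event of \<open>P\<close>
  is the trace on \<open>Omega0\<close> of a product event.\<close>

lemma distr_levy_shift: "distr P P (levy_shift u) = P"
proof -
  let ?N = "\<Pi>\<^sub>M t\<in>(UNIV::real set). (borel :: real measure)"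
  have m: "levy_shift u \<in> measurable P ?N"
    using measurable_compose[OF levy_shift_meas path_meas] by simp
  have emb: "prod_emb UNIV (\<lambda>_. borel) J (Pi\<^sub>E J A) = {f. \<forall>j\<in>J. f j \<in> A j}" for J and A :: "real \<Rightarrow> real set"
    by (auto simp: prod_emb_def)
  have eq: "distr P ?N (levy_shift u) = distr P ?N (\<lambda>\<omega>. \<omega>)"
  proof (rule measure_eqI_PiM_infinite)
    fix A J assume J: "finite J" "J \<subseteq> (UNIV::real set)" "\<And>i. i \<in> J \<Longrightarrow> A i \<in> sets (borel :: real measure)"
    have "prod_emb UNIV (\<lambda>_. borel) J (Pi\<^sub>E J A) \<in> sets ?N"
      using J by (intro sets_PiM_I) auto
    then show "emeasure (distr P ?N (levy_shift u)) (prod_emb UNIV (\<lambda>_. borel) J (Pi\<^sub>E J A)) =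
      emeasure (distr P ?N (\<lambda>\<omega>. \<omega>)) (prod_emb UNIV (\<lambda>_. borel) J (Pi\<^sub>E J A))"
      using finite_dim_law_shift[OF J(1), of A u] J(3) m path_meas
      by (simp add: emeasure_distr emb vimage_def Int_def conj_commute)
  qed (auto intro!: P.finite_measure_distr m)
  show ?thesis
  proof (rule measure_eqI)
    fix B assume "B \<in> sets (distr P P (levy_shift u))"
    then have B: "B \<in> sets P" by simp
    then obtain B' where B': "B' \<in> sets ?N" "B = B' \<inter> Omega0"
      unfolding sets_P path_space_def sets_restrict_space by auto
    have "emeasure (distr P ?N (levy_shift u)) B' = emeasure (distr P ?N (\<lambda>\<omega>. \<omega>)) B'" using eq by simp
    moreover have "levy_shift u -` B' \<inter> space P = levy_shift u -` B \<inter> space P"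
      using levy_shift_Omega0 B' space_P by auto
    moreover have "(\<lambda>\<omega>. \<omega>) -` B' \<inter> space P = B" using B' space_P by auto
    ultimately show "emeasure (distr P P (levy_shift u)) B = emeasure P B"
      using m path_meas B B' by (simp add: emeasure_distr)
  qed simp
qed

end

section \<open>Past and future of the completed measure\<close>

lemma space_increment_field [simp]: "space (increment_field W s t) = space W"
  unfolding increment_field_def by (subst space_measure_of_conv) simp

lemma sets_increment_field:
  "sets (increment_field W s t) = sigma_sets (space W)
     ({(\<lambda>\<omega>. \<omega> v - \<omega> u) -` A \<inter> space W | u v A.
          s \<le> ereal u \<and> u \<le> v \<and> ereal v \<le> t \<and> A \<in> sets (borel :: real measure)} \<union>
      {E \<in> sets W. measure W E = 0 \<or> measure W E = 1})"
  unfolding increment_field_def by (rule sets_measure_of) (auto dest: sets.sets_into_space)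

lemma increment_field_mono:
  assumes "s' \<le> s" "t \<le> t'"
  shows "sets (increment_field W s t) \<subseteq> sets (increment_field W s' t')"
proof -
  have "s' \<le> ereal u" if "s \<le> ereal u" for u using that assms(1) by (rule order_trans[rotated])
  moreover have "ereal v \<le> t'" if "ereal v \<le> t" for v using that assms(2) by (rule order_trans)
  ultimately show ?thesis
    unfolding sets_increment_field by (intro sigma_sets_mono' Un_mono subset_refl) blast
qed

lemma measurable_mono_sets:
  "f \<in> measurable M N \<Longrightarrow> sets M \<subseteq> sets M' \<Longrightarrow> space M = space M' \<Longrightarrow> f \<in> measurable M' N"
  by (auto simp: measurable_def)

lemma measurable_increment_field_mono:
  assumes "f \<in> measurable (increment_field W s t) N" "s' \<le> s" "t \<le> t'"
  shows "f \<in> measurable (increment_field W s' t') N"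
  using assms by (intro measurable_mono_sets[OF assms(1)] increment_field_mono) auto

lemma trivial_in_increment_field:
  "E \<in> sets W \<Longrightarrow> measure W E = 0 \<or> measure W E = 1 \<Longrightarrow> E \<in> sets (increment_field W s t)"
  unfolding sets_increment_field by (intro sigma_sets.Basic) auto

lemma increment_meas_increment_field:
  assumes "s \<le> ereal u" "u \<le> v" "ereal v \<le> t"
  shows "(\<lambda>\<omega>. \<omega> v - \<omega> u) \<in> borel_measurable (increment_field W s t)"
proof (rule measurableI)
  fix A :: "real set" assume "A \<in> sets borel"
  then show "(\<lambda>\<omega>. \<omega> v - \<omega> u) -` A \<inter> space (increment_field W s t) \<in> sets (increment_field W s t)"
    unfolding sets_increment_field space_increment_field using assms
    by (intro sigma_sets.Basic UnI1) blast
qed simp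

text \<open>Increment fields contain all null events and hence absorb almost sure modifications.
  Events are later replaced by equivalent ones that visibly depend on the right increments
  only.\<close>

lemma increment_field_AE_cong:
  assumes E: "E \<in> sets (increment_field W s t)" and F: "F \<in> sets W" and "sets (increment_field W s t) \<subseteq> sets W"
    and ae: "AE \<omega> in W. \<omega> \<in> E \<longleftrightarrow> \<omega> \<in> F"
  shows "F \<in> sets (increment_field W s t)"
proof -
  have EW: "E \<in> sets W" using E assms by auto
  have "E - F \<in> null_sets W" "F - E \<in> null_sets W"
    using ae EW F by (auto simp: AE_iff_null_sets intro: AE_mp)
  then have "E - F \<in> sets (increment_field W s t)" "F - E \<in> sets (increment_field W s t)"
    by (auto intro!: trivial_in_increment_field simp: null_sets_def measure_def)
  then have "(E - (E - F)) \<union> (F - E) \<in> sets (increment_field W s t)" using E by blast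
  moreover have "(E - (E - F)) \<union> (F - E) = F" by auto
  ultimately show ?thesis by simp
qed

context wiener_space begin

abbreviation W :: "(real \<Rightarrow> real) measure" where "W \<equiv> completion P"

sublocale W: prob_space "completion P"
  by (rule P.prob_space_completion)

lemma coord_meas_W [measurable]: "(\<lambda>\<omega>. \<omega> t) \<in> borel_measurable W"
  by (rule measurable_completion) simp

lemma sets_increment_field_subset: "sets (increment_field W s t) \<subseteq> sets W"
proof -
  have "(\<lambda>\<omega>. \<omega> v - \<omega> u) -` A \<inter> space W \<in> sets W" if "A \<in> sets borel" for u v and A :: "real set"
    by (rule measurable_sets[OF _ that]) measurable
  then show ?thesis unfolding sets_increment_field by (intro sets.sigma_sets_subset) auto
qed

lemma measurable_increment_field_W:
  "f \<in> measurable (increment_field W s t) N \<Longrightarrow> f \<in> measurable W N"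
  by (rule measurable_mono_sets[OF _ sets_increment_field_subset]) simp_all

lemma levy_shift_meas_W [measurable]: "levy_shift u \<in> measurable W W"
proof (rule completion.measurable_completion2)
  show "levy_shift u \<in> measurable W P" by (rule measurable_completion) simp
  show "null_sets P \<subseteq> null_sets (distr W P (levy_shift u))"
    by (subst distr_completion) (simp_all add: distr_levy_shift)
qed

lemma distr_levy_shift_W: "distr W W (levy_shift u) = W"
proof -
  have "distr W P (levy_shift u) = P"
    by (subst distr_completion) (simp_all add: distr_levy_shift)
  then show ?thesis
    using completion.completion_distr_eq[of "levy_shift u" P P] measurable_completion[OF levy_shift_meas[of u]] by simp
qed

lemma AE_levy_shift: "(AE \<omega> in W. Q \<omega>) \<Longrightarrow> AE \<omega> in W. Q (levy_shift u \<omega>)"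
  by (rule AE_distrD[OF levy_shift_meas_W]) (simp only: distr_levy_shift_W)

lemma measure_levy_shift:
  assumes "{\<omega>\<in>space W. Q \<omega>} \<in> sets W"
  shows "measure W {\<omega>\<in>space W. Q (levy_shift u \<omega>)} = measure W {\<omega>\<in>space W. Q \<omega>}"
proof -
  have "measure (distr W W (levy_shift u)) {\<omega>\<in>space W. Q \<omega>} = measure W (levy_shift u -` {\<omega>\<in>space W. Q \<omega>} \<inter> space W)"
    using assms by (intro measure_distr) auto
  moreover have "levy_shift u -` {\<omega>\<in>space W. Q \<omega>} \<inter> space W = {\<omega>\<in>space W. Q (levy_shift u \<omega>)}"
    using levy_shift_Omega0 space_P by auto
  ultimately show ?thesis by (simp add: distr_levy_shift_W)
qed

text \<open>Up to a null event, an event of the field is a condition on one half of the path seen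
  from \<open>u\<close>: the half after \<open>u\<close> for \<open>e = 1\<close>, the half before
  it run backwards for \<open>e = -1\<close>. In the induction, null and almost sure generators
  become the empty and the full event.\<close>

lemma increment_field_representation:
  assumes E: "E \<in> sets (increment_field W s t)" and e: "e * e = 1"
    and sgn: "\<And>a. s \<le> ereal a \<Longrightarrow> ereal a \<le> t \<Longrightarrow> 0 \<le> e * (a - u)"
  shows "\<exists>A\<in>sets (\<Pi>\<^sub>M t\<in>{0::real..}. (borel :: real measure)).
    AE \<omega> in W. \<omega> \<in> E \<longleftrightarrow> (\<lambda>t\<in>{0..}. levy_shift u \<omega> (e * t)) \<in> A"
  using E unfolding sets_increment_field
proof (induction rule: sigma_sets.induct)
  case (Basic E)
  let ?N = "\<Pi>\<^sub>M t\<in>{0::real..}. (borel :: real measure)"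
  from Basic consider a b A where "E = (\<lambda>\<omega>. \<omega> b - \<omega> a) -` A \<inter> space W"
       "s \<le> ereal a" "a \<le> b" "ereal b \<le> t" "A \<in> sets (borel :: real measure)"
    | "E \<in> sets W" "measure W E = 0" | "E \<in> sets W" "measure W E = 1" by auto
  then show ?case
  proof cases
    case 1
    have ab: "0 \<le> e * (a - u)" "0 \<le> e * (b - u)"
      using 1 by (auto intro!: sgn intro: order_trans[of _ "ereal a"] order_trans[of _ "ereal b"])
    have "(\<lambda>f. f (e * (b - u)) - f (e * (a - u))) \<in> borel_measurable ?N"
      using ab by (intro borel_measurable_diff measurable_component_singleton) auto
    from measurable_sets[OF this 1(5)]
    have A: "(\<lambda>f. f (e * (b - u)) - f (e * (a - u))) -` A \<inter> space ?N \<in> sets ?N" .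
    have val: "(\<lambda>t\<in>{0..}. levy_shift u \<omega> (e * t)) (e * (x - u)) = \<omega> x - \<omega> u"
      if "0 \<le> e * (x - u)" for \<omega> x
    proof -
      have "e * (e * (x - u)) = x - u" by (simp only: mult.assoc[symmetric] e mult_1_left)
      then show ?thesis using that by (simp only: restrict_apply atLeast_iff if_True levy_shift_def) simp
    qed
    have "\<omega> \<in> E \<longleftrightarrow> (\<lambda>t\<in>{0..}. levy_shift u \<omega> (e * t)) \<in> (\<lambda>f. f (e * (b - u)) - f (e * (a - u))) -` A \<inter> space ?N"
      if "\<omega> \<in> space W" for \<omega>
      using that unfolding \<open>E = _\<close> vimage_def Int_iff mem_Collect_eq val[OF ab(1)] val[OF ab(2)]
      by (simp add: space_PiM)
    then show ?thesis
      by (intro bexI[OF _ A] AE_I2)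
  next
    case 2
    have "AE \<omega> in W. \<omega> \<notin> E" using 2
      by (intro AE_not_in) (auto simp: null_sets_def W.emeasure_eq_measure)
    then show ?thesis by (intro bexI[of _ "{}"]) auto
  next
    case 3
    have "AE \<omega> in W. \<omega> \<in> E" using 3 W.AE_in_set_eq_1[of E] by blast
    then have "AE \<omega> in W. \<omega> \<in> E \<longleftrightarrow> (\<lambda>t\<in>{0..}. levy_shift u \<omega> (e * t)) \<in> space ?N"
      by eventually_elim (simp add: space_PiM)
    then show ?thesis by (intro bexI[OF _ sets.top])
  qed
next
  case Empty
  show ?case by (intro bexI[of _ "{}"]) auto
next
  case (Compl E)
  let ?N = "\<Pi>\<^sub>M t\<in>{0::real..}. (borel :: real measure)"
  from Compl obtain A where A: "A \<in> sets ?N" and ae: "AE \<omega> in W. \<omega> \<in> E \<longleftrightarrow> (\<lambda>t\<in>{0..}. levy_shift u \<omega> (e * t)) \<in> A"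
    using Compl.IH by blast
  have "AE \<omega> in W. \<omega> \<in> space W - E \<longleftrightarrow> (\<lambda>t\<in>{0..}. levy_shift u \<omega> (e * t)) \<in> space ?N - A"
    using ae AE_space by eventually_elim (auto simp: space_PiM)
  then show ?case by (rule bexI) (use A in blast)
next
  case (Union E)
  let ?N = "\<Pi>\<^sub>M t\<in>{0::real..}. (borel :: real measure)"
  from Union.IH have "\<forall>i. \<exists>A. A \<in> sets ?N \<and> (AE \<omega> in W. \<omega> \<in> E i \<longleftrightarrow> (\<lambda>t\<in>{0..}. levy_shift u \<omega> (e * t)) \<in> A)"
    by (simp only: Bex_def) blast
  from choice[OF this] obtain A where A: "\<And>i. A i \<in> sets ?N"
    and ae: "\<And>i. AE \<omega> in W. \<omega> \<in> E i \<longleftrightarrow> (\<lambda>t\<in>{0..}. levy_shift u \<omega> (e * t)) \<in> A i" by blast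
  have "AE \<omega> in W. \<forall>i::nat. \<omega> \<in> E i \<longleftrightarrow> (\<lambda>t\<in>{0..}. levy_shift u \<omega> (e * t)) \<in> A i"
    unfolding AE_all_countable by (intro allI ae)
  then have "AE \<omega> in W. \<omega> \<in> \<Union>(range E) \<longleftrightarrow> (\<lambda>t\<in>{0..}. levy_shift u \<omega> (e * t)) \<in> \<Union>(range A)"
    by eventually_elim (simp only: UN_iff)
  then show ?case by (rule bexI) (intro sets.countable_UN image_subsetI A)
qed

text \<open>A shift by \<open>u\<close> moves the splitting time to 0, where the two halves are
  independent by the definition of the measure.\<close>

lemma past_future_indep:
  assumes E: "E \<in> sets (increment_field W (-\<infinity>) (ereal u))" and F: "F \<in> sets (increment_field W (ereal u) \<infinity>)"
  shows "measure W (E \<inter> F) = measure W E * measure W F"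
proof -
  let ?N = "\<Pi>\<^sub>M t\<in>{0::real..}. (borel :: real measure)"
  have EF: "E \<in> sets W" "F \<in> sets W" using E F sets_increment_field_subset by auto
  obtain A where A: "A \<in> sets ?N" and aeA: "AE \<omega> in W. \<omega> \<in> E \<longleftrightarrow> (\<lambda>t\<in>{0..}. levy_shift u \<omega> (-1 * t)) \<in> A"
    using increment_field_representation[OF E, of "-1" u] by auto
  obtain B where B: "B \<in> sets ?N" and aeB: "AE \<omega> in W. \<omega> \<in> F \<longleftrightarrow> (\<lambda>t\<in>{0..}. levy_shift u \<omega> (1 * t)) \<in> B"
    using increment_field_representation[OF F, of 1 u] by auto
  let ?L = "\<lambda>\<omega>. \<lambda>t\<in>{0..}. \<omega> (- t)" and ?R = "\<lambda>\<omega>. \<lambda>t\<in>{0..}. \<omega> t"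
  have Lm: "?L \<in> measurable P ?N" and Rm: "?R \<in> measurable P ?N"
    by (intro measurable_restrict; simp)+
  have LA: "{\<omega>\<in>space W. ?L \<omega> \<in> A} \<in> sets P" and RB: "{\<omega>\<in>space W. ?R \<omega> \<in> B} \<in> sets P"
    using measurable_sets[OF Lm A] measurable_sets[OF Rm B] by (auto simp: vimage_def Int_def conj_commute)
  \<comment> \<open>Events expressed through the path shifted by \<open>u\<close> have the
    probability of the same event for the path itself.\<close>
  have tr: "measure W G = measure W {\<omega>\<in>space W. Q \<omega>}"
    if "G \<in> sets W" "{\<omega>\<in>space W. Q \<omega>} \<in> sets W" "AE \<omega> in W. \<omega> \<in> G \<longleftrightarrow> Q (levy_shift u \<omega>)" for G Q
  proof -
    have "{\<omega>\<in>space W. Q (levy_shift u \<omega>)} = levy_shift u -` {\<omega>\<in>space W. Q \<omega>} \<inter> space W"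
      using levy_shift_Omega0 space_P by auto
    then have "{\<omega>\<in>space W. Q (levy_shift u \<omega>)} \<in> sets W"
      using measurable_sets[OF levy_shift_meas_W that(2)] by simp
    then have "measure W G = measure W {\<omega>\<in>space W. Q (levy_shift u \<omega>)}"
      using that by (intro W.finite_measure_eq_AE) auto
    then show ?thesis using measure_levy_shift[OF that(2)] by simp
  qed
  have "measure W (E \<inter> F) = measure W {\<omega>\<in>space W. ?L \<omega> \<in> A \<and> ?R \<omega> \<in> B}"
  proof (rule tr)
    show "AE \<omega> in W. \<omega> \<in> E \<inter> F \<longleftrightarrow> ?L (levy_shift u \<omega>) \<in> A \<and> ?R (levy_shift u \<omega>) \<in> B"
      using aeA aeB by eventually_elim auto
    show "{\<omega>\<in>space W. ?L \<omega> \<in> A \<and> ?R \<omega> \<in> B} \<in> sets W"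
      using sets.Int[OF LA RB] by (auto simp: Int_def intro!: sets_completionI_sets elim!: back_subst[where P="\<lambda>x. x \<in> sets P"])
  qed (use EF in auto)
  also have "\<dots> = measure P ({\<omega>\<in>space W. ?R \<omega> \<in> B} \<inter> {\<omega>\<in>space W. ?L \<omega> \<in> A})"
    using LA RB by (subst measure_completion[symmetric]) (auto intro!: arg_cong[where f="measure _"])
  also have "\<dots> = measure P {\<omega>\<in>space W. ?R \<omega> \<in> B} * measure P {\<omega>\<in>space W. ?L \<omega> \<in> A}"
    using A B by (intro P.indep_setD[OF half_lines_indep_set] sigma_sets.Basic) auto
  also have "measure P {\<omega>\<in>space W. ?L \<omega> \<in> A} = measure W E"
    using LA EF aeA tr[of E "\<lambda>\<omega>. ?L \<omega> \<in> A"] by simp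
  also have "measure P {\<omega>\<in>space W. ?R \<omega> \<in> B} = measure W F"
    using RB EF aeB tr[of F "\<lambda>\<omega>. ?R \<omega> \<in> B"] by simp
  finally show ?thesis by simp
qed

end

section \<open>Oscillation of Brownian paths\<close>

text \<open>Rational offsets make this a countable condition on the increments after
  \<open>u\<close>. The height \<theta> gives stability under small changes of the base point, which
  is needed because a restart time is only approached along a grid.\<close>

definition oscillates :: "real \<Rightarrow> real \<Rightarrow> real \<Rightarrow> (real \<Rightarrow> real) \<Rightarrow> bool" where
  "oscillates \<rho> \<theta> u \<omega> \<longleftrightarrow>
     (\<exists>q::rat. (0 < q \<and> of_rat q < \<rho>) \<and> \<theta> < \<omega> (u + of_rat q) - \<omega> u) \<and>
     (\<exists>q::rat. (0 < q \<and> of_rat q < \<rho>) \<and> \<omega> (u + of_rat q) - \<omega> u < - \<theta>)"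

lemma oscillates_levy_shift: "oscillates \<rho> \<theta> 0 (levy_shift u \<omega>) = oscillates \<rho> \<theta> u \<omega>"
  unfolding oscillates_def levy_shift_def by simp

lemma pred_oscillates: "Measurable.pred (increment_field W u \<infinity>) (oscillates \<rho> \<theta> u)"
  unfolding oscillates_def
  by (intro pred_intros_logic pred_intros_countable pred_intros_conj1' borel_measurable_pred_less
      increment_meas_increment_field borel_measurable_const) auto

context wiener_space begin

text \<open>The centred normal law is symmetric and has no atom at 0.\<close>

lemma prob_sign:
  assumes "0 < t" and e: "e = 1 \<or> e = -1"
  shows "measure W {\<omega>\<in>space W. 0 < e * \<omega> t} = 1 / 2"
proof -
  have d: "distributed P lborel (\<lambda>\<omega>. e * \<omega> t) (normal_density 0 (sqrt t))" if "e = 1 \<or> e = -1" for e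
  proof -
    have "distributed P lborel (\<lambda>\<omega>. \<omega> t - \<omega> 0) (normal_density 0 (sqrt t))"
      using increment_distributed[of 0 t] assms by simp
    from P.normal_density_affine[OF this, of e 0]
    have "distributed P lborel (\<lambda>\<omega>. e * (\<omega> t - \<omega> 0)) (normal_density 0 (sqrt t))"
      using assms that by auto
    moreover have "distr P lborel (\<lambda>\<omega>. e * (\<omega> t - \<omega> 0)) = distr P lborel (\<lambda>\<omega>. e * \<omega> t)"
      by (intro distr_cong) (auto simp: space_P Omega0_def)
    ultimately show ?thesis unfolding distributed_def by simp
  qed
  let ?D = "density lborel (normal_density 0 (sqrt t))"
  have m: "measure P {\<omega>\<in>space P. e * \<omega> t \<in> A} = measure ?D A" if "e = 1 \<or> e = -1" "A \<in> sets borel" for e and A :: "real set"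
  proof -
    have "distr P lborel (\<lambda>\<omega>. e * \<omega> t) = ?D" using d[OF that(1)] by (rule distributed_distr_eq_density)
    moreover have "measure (distr P lborel (\<lambda>\<omega>. e * \<omega> t)) A = measure P ((\<lambda>\<omega>. e * \<omega> t) -` A \<inter> space P)"
      using that by (intro measure_distr) auto
    ultimately show ?thesis by (simp add: vimage_def Int_def conj_commute)
  qed
  have z: "measure P {\<omega>\<in>space P. \<omega> t = 0} = 0"
  proof -
    have "emeasure ?D {0} = 0"
      using AE_lborel_singleton[of "0::real"]
      by (intro null_setsD1, subst null_sets_density_iff) (auto simp: frequently_def)
    then show ?thesis using m[of 1 "{0}"] by (simp add: measure_def)
  qed
  have "1 = measure P {\<omega>\<in>space P. 0 < \<omega> t} + measure P {\<omega>\<in>space P. \<omega> t < 0} + measure P {\<omega>\<in>space P. \<omega> t = 0}"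
  proof -
    have "1 = measure P (({\<omega>\<in>space P. 0 < \<omega> t} \<union> {\<omega>\<in>space P. \<omega> t < 0}) \<union> {\<omega>\<in>space P. \<omega> t = 0})"
      unfolding P.prob_space[symmetric] by (intro arg_cong[where f="measure P"]) auto
    also have "\<dots> = measure P ({\<omega>\<in>space P. 0 < \<omega> t} \<union> {\<omega>\<in>space P. \<omega> t < 0}) + measure P {\<omega>\<in>space P. \<omega> t = 0}"
      by (intro P.finite_measure_Union) auto
    also have "measure P ({\<omega>\<in>space P. 0 < \<omega> t} \<union> {\<omega>\<in>space P. \<omega> t < 0}) = measure P {\<omega>\<in>space P. 0 < \<omega> t} + measure P {\<omega>\<in>space P. \<omega> t < 0}"
      by (intro P.finite_measure_Union) auto
    finally show ?thesis .
  qed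
  moreover have "measure P {\<omega>\<in>space P. 0 < \<omega> t} = measure ?D {0<..}" "measure P {\<omega>\<in>space P. \<omega> t < 0} = measure ?D {0<..}"
    using m[of 1 "{0<..}"] m[of "-1" "{0<..}"] by auto
  moreover have "measure W {\<omega>\<in>space W. 0 < e * \<omega> t} = measure P {\<omega>\<in>space P. 0 < e * \<omega> t}"
    by (simp add: measure_completion)
  ultimately show ?thesis using m[OF e, of "{0<..}"] z by auto
qed

text \<open>A zero-one law. The event \<open>H\<close> that \<open>e * \<omega>\<close> is positive
  arbitrarily soon after 0 depends on the increments in each interval from 0 to
  \<open>1 / Suc n\<close>, so it is independent of the increments after any positive time. These
  generate \<open>H\<close> as well, so \<open>H\<close> is independent of itself, and its
  probability is at least 1/2.\<close>

lemma AE_sign_changes: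
  assumes e: "e = 1 \<or> e = -1"
  shows "AE \<omega> in W. \<forall>n. \<exists>q::rat. (0 < q \<and> of_rat q < 1 / real (Suc n)) \<and> 0 < e * \<omega> (of_rat q)"
proof -
  define A where "A = (\<lambda>n::nat. {\<omega>\<in>space W. \<exists>q::rat. (0 < q \<and> of_rat q < 1 / real (Suc n)) \<and> 0 < e * \<omega> (of_rat q)})"
  define H where "H = (\<Inter>n. A n)"
  have Aanti: "A n \<subseteq> A m" if "m \<le> n" for m n
  proof -
    have "1 / real (Suc n) \<le> 1 / real (Suc m)" using that by (intro divide_left_mono) auto
    then show ?thesis unfolding A_def by fastforce
  qed
  have AF: "A m \<in> sets (increment_field W 0 (1 / real (Suc n)))" if "n \<le> m" for m n
  proof -
    have le: "1 / real (Suc m) \<le> 1 / real (Suc n)" using that by (intro divide_left_mono) auto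
    have "{\<omega>\<in>space (increment_field W 0 (1 / real (Suc n))). \<exists>q::rat. (0 < q \<and> of_rat q < 1 / real (Suc m)) \<and> 0 < e * (\<omega> (of_rat q) - \<omega> 0)} \<in> sets (increment_field W 0 (1 / real (Suc n)))"
      unfolding pred_def[symmetric] using le
      by (intro pred_intros_countable pred_intros_conj1' borel_measurable_pred_less borel_measurable_times
         increment_meas_increment_field borel_measurable_const) (auto simp: zero_ereal_def)
    moreover have "A m = {\<omega>\<in>space (increment_field W 0 (1 / real (Suc n))). \<exists>q::rat. (0 < q \<and> of_rat q < 1 / real (Suc m)) \<and> 0 < e * (\<omega> (of_rat q) - \<omega> 0)}"
    proof -
      have z: "\<omega> 0 = 0" if "\<omega> \<in> space W" for \<omega> using that by (simp add: space_P Omega0_def)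
      show ?thesis unfolding A_def space_increment_field
        by (rule Collect_cong, rule conj_cong[OF refl]) (simp only: z diff_0_right)
    qed
    ultimately show ?thesis by (simp only:)
  qed
  have AW: "A n \<in> sets W" for n using AF[of n n] sets_increment_field_subset by auto
  have HF: "H \<in> sets (increment_field W 0 (1 / real (Suc n)))" for n
  proof -
    have "H = (\<Inter>m\<in>{n..}. A m)"
      unfolding H_def using Aanti[OF max.cobounded1] Aanti[OF max.cobounded2]
      by (auto) (metis atLeast_iff max.cobounded1 max.cobounded2 Aanti subsetD)
    also have "\<dots> \<in> sets (increment_field W 0 (1 / real (Suc n)))"
      using AF by (intro sets.countable_INT) auto
    finally show ?thesis .
  qed
  have HW: "H \<in> sets W" using HF sets_increment_field_subset by blast
  have "1 / 2 \<le> measure W (A n)" for n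
  proof -
    obtain q :: rat where q: "0 < real_of_rat q" "real_of_rat q < 1 / real (Suc n)"
      using of_rat_dense[of 0 "1 / real (Suc n)"] by auto
    have "measure W {\<omega>\<in>space W. 0 < e * \<omega> (of_rat q)} \<le> measure W (A n)"
      using q AW unfolding A_def by (intro W.finite_measure_mono) auto
    then show ?thesis using prob_sign[OF q(1) e] by simp
  qed
  moreover have "(\<lambda>n. measure W (A n)) \<longlonglongrightarrow> measure W H"
    unfolding H_def using AW Aanti by (intro W.finite_Lim_measure_decseq) (auto simp: decseq_def)
  ultimately have half: "1 / 2 \<le> measure W H"
    using LIMSEQ_le_const by blast
  \<comment> \<open>An increasing union of fields, hence stable under intersection; its elements
    start strictly after 0.\<close>
  define G where "G = (\<Union>n::nat. sets (increment_field W (1 / real (Suc n)) \<infinity>))"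
  have GW: "G \<subseteq> sets W" unfolding G_def using sets_increment_field_subset by auto
  have Gmono: "sets (increment_field W (1 / real (Suc m)) \<infinity>) \<subseteq> sets (increment_field W (1 / real (Suc n)) \<infinity>)" if "m \<le> n" for m n
  proof -
    have "1 / real (Suc n) \<le> 1 / real (Suc m)" using that by (intro divide_left_mono) auto
    then show ?thesis by (intro increment_field_mono) auto
  qed
  have "W.indep_set {H} G"
  proof (rule W.indep_setI)
    fix a b assume "a \<in> {H}" "b \<in> G"
    then obtain n where n: "a = H" "b \<in> sets (increment_field W (1 / real (Suc n)) \<infinity>)" unfolding G_def by auto
    have "H \<in> sets (increment_field W (-\<infinity>) (1 / real (Suc n)))"
      using HF increment_field_mono[of "-\<infinity>" 0 "1 / real (Suc n)" "1 / real (Suc n)"] by auto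
    from past_future_indep[OF this n(2)] show "W.prob (a \<inter> b) = W.prob a * W.prob b" using n by simp
  qed (use HW GW in auto)
  then have ind: "W.indep_set (sigma_sets (space W) {H}) (sigma_sets (space W) G)"
  proof (rule W.indep_set_sigma_sets)
    show "Int_stable G"
      unfolding Int_stable_def
    proof (intro ballI)
      fix a b assume "a \<in> G" "b \<in> G"
      then obtain m n where "a \<in> sets (increment_field W (1 / real (Suc m)) \<infinity>)" "b \<in> sets (increment_field W (1 / real (Suc n)) \<infinity>)"
        unfolding G_def by blast
      then have "a \<inter> b \<in> sets (increment_field W (1 / real (Suc (max m n))) \<infinity>)"
        using Gmono[OF max.cobounded1, of m n] Gmono[OF max.cobounded2, of n m] by blast
      then show "a \<inter> b \<in> G" unfolding G_def by blast
    qed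
  qed (auto simp: Int_stable_def)
  define M where "M = sigma (space W) G"
  have sM: "space M = space W" "sets M = sigma_sets (space W) G"
  proof -
    have "G \<subseteq> Pow (space W)" using subset_trans[OF GW sets.space_closed] .
    then show "space M = space W" "sets M = sigma_sets (space W) G"
      unfolding M_def by (rule space_measure_of, rule sets_measure_of)
  qed
  \<comment> \<open>The increment from 0 is a limit of increments from \<open>1 / Suc n\<close>, by
    continuity at 0. The default value 0 affects only finitely many \<open>n\<close>.\<close>
  have cM: "(\<lambda>\<omega>. \<omega> (of_rat q)) \<in> borel_measurable M" if "0 < q" for q
  proof (rule borel_measurable_LIMSEQ_real)
    fix \<omega> assume "\<omega> \<in> space M"
    then have w: "continuous_on UNIV \<omega>" "\<omega> 0 = 0" using sM by (auto simp: space_P Omega0_def)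
    have "(\<lambda>n. \<omega> (1 / real (Suc n))) \<longlonglongrightarrow> \<omega> 0"
      using w(1) LIMSEQ_inverse_real_of_nat unfolding continuous_on_eq_continuous_at[OF open_UNIV]
      by (intro isCont_tendsto_compose[of _ \<omega>]) (auto simp: inverse_eq_divide)
    then have 1: "(\<lambda>n. \<omega> (of_rat q) - \<omega> (1 / real (Suc n))) \<longlonglongrightarrow> \<omega> (of_rat q)"
      using w(2) tendsto_diff[OF tendsto_const] by fastforce
    have "\<forall>\<^sub>F n in sequentially. inverse (real (Suc n)) < of_rat q"
      using that by (intro order_tendstoD(2)[OF LIMSEQ_inverse_real_of_nat]) auto
    then show "(\<lambda>n. if 1 / real (Suc n) \<le> of_rat q then \<omega> (of_rat q) - \<omega> (1 / real (Suc n)) else 0) \<longlonglongrightarrow> \<omega> (of_rat q)"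
      by (intro Lim_transform_eventually[OF 1]) (auto elim!: eventually_mono simp: inverse_eq_divide)
  next
    fix n
    have "(\<lambda>\<omega>. \<omega> (of_rat q) - \<omega> (1 / real (Suc n))) \<in> borel_measurable M" if "1 / real (Suc n) \<le> of_rat q"
    proof -
      have "(\<lambda>\<omega>. \<omega> (of_rat q) - \<omega> (1 / real (Suc n))) \<in> borel_measurable (increment_field W (1 / real (Suc n)) \<infinity>)"
        using that by (intro increment_meas_increment_field) auto
      moreover have "sets (increment_field W (1 / real (Suc n)) \<infinity>) \<subseteq> sets M"
        unfolding sM G_def by (auto intro!: sigma_sets.Basic)
      ultimately show ?thesis by (rule measurable_mono_sets) (simp add: sM(1))
    qed
    then show "(\<lambda>\<omega>. if 1 / real (Suc n) \<le> of_rat q then \<omega> (of_rat q) - \<omega> (1 / real (Suc n)) else 0) \<in> borel_measurable M"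
      by (cases "1 / real (Suc n) \<le> of_rat q") (simp_all only: if_True if_False borel_measurable_const)
  qed
  have "A n \<in> sets M" for n
  proof -
    have "{\<omega>\<in>space M. \<exists>q::rat. (0 < q \<and> of_rat q < 1 / real (Suc n)) \<and> 0 < e * \<omega> (of_rat q)} \<in> sets M"
      unfolding pred_def[symmetric]
      by (intro pred_intros_countable pred_intros_conj1' borel_measurable_pred_less borel_measurable_times
         cM borel_measurable_const) auto
    then show ?thesis unfolding A_def sM(1) .
  qed
  then have "H \<in> sigma_sets (space W) G" unfolding H_def sM(2)[symmetric] by auto
  then have "measure W (H \<inter> H) = measure W H * measure W H"
    by (intro W.indep_setD[OF ind]) auto
  then have "measure W H = 1" using half by auto
  then have "AE \<omega> in W. \<omega> \<in> H" using W.AE_in_set_eq_1[OF HW] by blast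
  then show ?thesis by eventually_elim (auto simp: H_def A_def)
qed

lemma AE_oscillates: "AE \<omega> in W. \<forall>n. oscillates (1 / real (Suc n)) 0 u \<omega>"
proof -
  have "AE \<omega> in W. \<forall>n. oscillates (1 / real (Suc n)) 0 0 \<omega>"
    using AE_sign_changes[OF disjI1[OF refl]] AE_sign_changes[OF disjI2[OF refl]] AE_space
    by eventually_elim (auto simp: oscillates_def space_P Omega0_def)
  from AE_levy_shift[OF this] show ?thesis by (simp only: oscillates_levy_shift)
qed

lemma prob_oscillates_shift:
  "measure W {\<omega>\<in>space W. oscillates \<rho> \<theta> u \<omega>} = measure W {\<omega>\<in>space W. oscillates \<rho> \<theta> 0 \<omega>}"
proof -
  have "{\<omega>\<in>space W. oscillates \<rho> \<theta> 0 \<omega>} \<in> sets W"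
    using measurable_increment_field_W[OF pred_oscillates] unfolding pred_def by simp
  from measure_levy_shift[OF this, of u] show ?thesis by (simp add: oscillates_levy_shift)
qed

text \<open>Almost surely the path moves strictly in both directions within time \<rho>, by an
  amount that depends on the path. A deterministic amount is therefore reached with probability
  close to 1.\<close>

lemma prob_oscillates_tendsto:
  assumes "0 < \<rho>"
  shows "(\<lambda>k. measure W {\<omega>\<in>space W. oscillates \<rho> (1 / real (Suc k)) 0 \<omega>}) \<longlonglongrightarrow> 1"
proof -
  let ?A = "\<lambda>k. {\<omega>\<in>space W. oscillates \<rho> (1 / real (Suc k)) 0 \<omega>}"
  have m: "{\<omega>\<in>space W. oscillates \<rho> \<theta> 0 \<omega>} \<in> sets W" for \<theta>
    using measurable_increment_field_W[OF pred_oscillates] unfolding pred_def by simp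
  have mono: "oscillates \<rho> \<theta>' u \<omega>" if "oscillates \<rho> \<theta> u \<omega>" "\<theta>' \<le> \<theta>" for u \<omega> \<theta> \<theta>'
    using that unfolding oscillates_def by fastforce
  have "(\<lambda>k. measure W (?A k)) \<longlonglongrightarrow> measure W (\<Union>k. ?A k)"
  proof (rule W.finite_Lim_measure_incseq)
    show "incseq ?A"
    proof (rule incseq_SucI)
      fix k
      have "1 / real (Suc (Suc k)) \<le> 1 / real (Suc k)" by (intro divide_left_mono) auto
      then show "?A k \<subseteq> ?A (Suc k)" using mono by blast
    qed
  qed (use m in auto)
  moreover have "measure W (\<Union>k. ?A k) = 1"
  proof -
    obtain n where n: "1 / real (Suc n) < \<rho>" using nat_approx_posE[OF assms] by (auto simp: inverse_eq_divide)
    have "AE \<omega> in W. \<omega> \<in> (\<Union>k. ?A k)"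
      using AE_oscillates[of 0] AE_space
    proof eventually_elim
      fix \<omega> assume "\<forall>n. oscillates (1 / real (Suc n)) 0 0 \<omega>" and w: "\<omega> \<in> space W"
      then obtain q q' :: rat where q: "0 < q" "of_rat q < 1 / real (Suc n)" "0 < \<omega> (of_rat q) - \<omega> 0"
         "0 < q'" "of_rat q' < 1 / real (Suc n)" "\<omega> (of_rat q') - \<omega> 0 < 0"
        unfolding oscillates_def by auto metis
      obtain k where "1 / real (Suc k) < min (\<omega> (of_rat q) - \<omega> 0) (- (\<omega> (of_rat q') - \<omega> 0))"
        using q nat_approx_posE[of "min (\<omega> (of_rat q) - \<omega> 0) (- (\<omega> (of_rat q') - \<omega> 0))"] by (auto simp: inverse_eq_divide)
      then have "oscillates \<rho> (1 / real (Suc k)) 0 \<omega>"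
        unfolding oscillates_def using q n
        by (intro conjI exI[of _ q] exI[of _ q']) auto
      then show "\<omega> \<in> (\<Union>k. ?A k)" using w by auto
    qed
    then show ?thesis using m W.AE_in_set_eq_1[of "\<Union>k. ?A k"] by auto
  qed
  ultimately show ?thesis by simp
qed

end

section \<open>Nested selections along a single path\<close>

text \<open>
  \<open>a s t\<close> is the point selected from \<open>(s, t)\<close>. The record at time \<open>y\<close> of the process
  started at \<open>b\<close> is \<open>a b y\<close>, and it is long once \<open>y - a b y\<close> exceeds \<open>\<delta>\<close>; only records
  positioned beyond \<open>t\<close> are considered.
\<close>

definition long_start :: "(rat \<Rightarrow> rat \<Rightarrow> real) \<Rightarrow> real \<Rightarrow> rat \<Rightarrow> real \<Rightarrow> rat \<Rightarrow> bool" where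
  "long_start a \<delta> b t y \<longleftrightarrow> b < y \<and> t < a b y \<and> a b y + \<delta> < of_rat y"

text \<open>A relation rather than a function of the path: it holds for no \<open>x\<close> when
  there is no leftmost long record.\<close>

definition first_long_start :: "(rat \<Rightarrow> rat \<Rightarrow> real) \<Rightarrow> real \<Rightarrow> rat \<Rightarrow> real \<Rightarrow> real \<Rightarrow> bool" where
  "first_long_start a \<delta> b t x \<longleftrightarrow>
     (\<exists>y. long_start a \<delta> b t y \<and> a b y = x) \<and> (\<forall>y. long_start a \<delta> b t y \<longrightarrow> x \<le> a b y)"

text \<open>Records at or before \<open>t\<close> are tested at all indices \<open>y\<close>,
  including those after \<open>t\<close>, so this is not a condition on the path before
  \<open>t\<close> alone.\<close>

definition no_long_start :: "(rat \<Rightarrow> rat \<Rightarrow> real) \<Rightarrow> real \<Rightarrow> real \<Rightarrow> bool" where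
  "no_long_start a \<delta> t \<longleftrightarrow> (\<forall>y. 0 < y \<longrightarrow> a 0 y \<le> t \<longrightarrow> of_rat y \<le> a 0 y + \<delta>)"

text \<open>With T the infimum of the indices beyond \<open>t\<close> whose record lies beyond
  \<open>t\<close>, this says that T is less than \<open>u\<close>. The strict \<open>y < u\<close>
  keeps it a condition on the path before \<open>u\<close>.\<close>

definition restarts :: "(rat \<Rightarrow> rat \<Rightarrow> real) \<Rightarrow> real \<Rightarrow> rat \<Rightarrow> bool" where
  "restarts a t u \<longleftrightarrow> (\<exists>y. (t < of_rat y \<and> y < u) \<and> t < a 0 y)"

lemma restarts_mono: "restarts a t u \<Longrightarrow> u \<le> v \<Longrightarrow> restarts a t v"
  unfolding restarts_def by (meson less_le_trans)

lemma no_long_start_antimono: "no_long_start a \<delta> t \<Longrightarrow> s \<le> t \<Longrightarrow> no_long_start a \<delta> s"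
  unfolding no_long_start_def by (meson order_trans)

locale nested_selection =
  fixes a :: "rat \<Rightarrow> rat \<Rightarrow> real"
  assumes between: "s < t \<Longrightarrow> of_rat s < a s t \<and> a s t < of_rat t"
    and nested: "s \<le> u \<Longrightarrow> u < v \<Longrightarrow> v \<le> t \<Longrightarrow> of_rat u < a s t \<Longrightarrow> a s t < of_rat v \<Longrightarrow> a s t = a u v"
begin

text \<open>Nestedness with common left end 0: a point selected for the longer interval that falls
  before \<open>y\<close> is the one selected for the interval up to \<open>y\<close>.\<close>

lemma record_cases:
  assumes "0 < y" "y \<le> y'"
  shows "a 0 y' = a 0 y \<or> of_rat y \<le> a 0 y'"
  using nested[of 0 0 y y'] between[of 0 y'] assms by (cases "a 0 y' < of_rat y") auto

lemma record_mono:
  assumes "0 < y" "y \<le> y'"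
  shows "a 0 y \<le> a 0 y'"
  using record_cases[OF assms] between[of 0 y] assms by auto

lemma record_earlier:
  assumes "a 0 y < x" "0 < x" "x \<le> of_rat y"
  shows "\<exists>w>0. of_rat w < x \<and> a 0 y < of_rat w \<and> a 0 w = a 0 y"
proof -
  obtain w where w: "max 0 (a 0 y) < of_rat w" "of_rat w < x"
    using of_rat_dense[of "max 0 (a 0 y)" x] assms by auto
  have "0 < w" using w by auto
  have "(of_rat w :: real) < of_rat y" using w assms by linarith
  then have "w \<le> y" by (simp add: of_rat_less)
  from record_cases[OF \<open>0 < w\<close> this] w \<open>0 < w\<close> show ?thesis by auto
qed

lemma restart_time:
  assumes "restarts a t u0" "0 \<le> t"
  obtains T :: real where "t \<le> T" "\<And>u. restarts a t u \<longleftrightarrow> T < of_rat u"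
proof -
  define S where "S = {of_rat y :: real | y. t < of_rat y \<and> t < a 0 y}"
  have S: "S \<noteq> {}" "bdd_below S"
    using assms unfolding S_def restarts_def by (auto intro!: bdd_belowI[of _ t])
  have "restarts a t u \<longleftrightarrow> Inf S < of_rat u" for u
    unfolding cInf_less_iff[OF S] by (auto simp: S_def restarts_def of_rat_less)
  moreover have "t \<le> Inf S" using S by (intro cInf_greatest) (auto simp: S_def)
  ultimately show thesis using that by blast
qed

text \<open>A record strictly between \<open>t\<close> and \<open>T\<close> would already be in
  force at some index before \<open>T\<close>, contrary to the choice of \<open>T\<close> as an
  infimum.\<close>

lemma record_after_restart:
  fixes T :: real
  assumes T: "\<And>u. restarts a t u \<longleftrightarrow> T < of_rat u" and "0 \<le> t" "t \<le> T" "T < of_rat y"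
  shows "t < a 0 y \<and> T \<le> a 0 y"
proof -
  have y: "0 < y" using assms by (metis le_less_trans of_rat_0 of_rat_less order_trans)
  obtain y0 where y0: "t < of_rat y0" "y0 < y" "t < a 0 y0"
    using T[of y] assms unfolding restarts_def by auto
  have "0 < y0" using y0 assms by (metis le_less_trans of_rat_0 of_rat_less)
  then have 1: "t < a 0 y" using record_mono[of y0 y] y0 by auto
  have "T \<le> a 0 y"
  proof (rule ccontr)
    assume "\<not> T \<le> a 0 y"
    then obtain w where w: "0 < w" "of_rat w < T" "a 0 y < of_rat w" "a 0 w = a 0 y"
      using record_earlier[of y T] assms 1 by auto
    obtain u where u: "of_rat w < (of_rat u :: real)" "of_rat u < T" using of_rat_dense[OF w(2)] by auto
    then have "restarts a t u" unfolding restarts_def using w 1 by (intro exI[of _ w]) (auto simp: of_rat_less)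
    then show False using T u by auto
  qed
  with 1 show ?thesis by simp
qed

lemma record_before_restart:
  fixes T :: real
  assumes T: "\<And>u. restarts a t u \<longleftrightarrow> T < of_rat u" and "0 \<le> t" "of_rat y \<le> T" "0 < y"
  shows "a 0 y \<le> t"
proof (rule ccontr)
  assume n: "\<not> a 0 y \<le> t"
  then obtain w where w: "0 < w" "of_rat w < (of_rat y :: real)" "a 0 y < of_rat w" "a 0 w = a 0 y"
    using record_earlier[of y "of_rat y"] between[OF assms(4)] assms(4) by auto
  then have "restarts a t y" unfolding restarts_def using n by (intro exI[of _ w]) (auto simp: of_rat_less)
  then show False using T assms by auto
qed

text \<open>Once the record lies beyond \<open>u\<close>, nestedness identifies the selections
  started at 0 and at \<open>u\<close>. The remaining indices are too close to \<open>T\<close>, or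
  too early, to produce a long record beyond \<open>t\<close>. The assumption \<open>ne\<close>
  keeps \<open>T\<close> from being a record that every start \<open>u\<close> after
  \<open>T\<close> would miss.\<close>

lemma first_long_start_restart:
  fixes T :: real
  assumes T: "\<And>u. restarts a t u \<longleftrightarrow> T < of_rat u" and t: "0 \<le> t" "t \<le> T" and "0 < \<delta>"
    and ne: "\<And>y. 0 < y \<Longrightarrow> a 0 y \<noteq> T"
  obtains \<epsilon> where "0 < \<epsilon>"
    "\<And>u x. T < of_rat u \<Longrightarrow> of_rat u < T + \<epsilon> \<Longrightarrow>
      first_long_start a \<delta> 0 t x \<longleftrightarrow> first_long_start a \<delta> u (of_rat u) x"
proof -
  \<comment> \<open>An index below \<open>T + \<delta>\<close> leaves no time for a record at or
    beyond \<open>T\<close> to become long.\<close>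
  obtain y0 :: rat where y0: "T < of_rat y0" "of_rat y0 < T + \<delta>" using of_rat_dense[of T "T + \<delta>"] \<open>0 < \<delta>\<close> by auto
  have "(0::real) < of_rat y0" using y0 t by linarith
  then have "0 < y0" by simp
  have r0: "T < a 0 y0" using record_after_restart[OF T t y0(1)] ne[OF \<open>0 < y0\<close>] by fastforce
  show thesis
  \<comment> \<open>Any \<open>u\<close> between \<open>T\<close> and the record at
    \<open>y0\<close> lies before all records with index at least \<open>y0\<close>, which are the
    only candidates for being long.\<close>
  proof (rule that[of "a 0 y0 - T"])
    fix u x assume u: "T < of_rat u" "of_rat u < T + (a 0 y0 - T)"
    have uy0: "(of_rat u :: real) < of_rat y0" using u between[OF \<open>0 < y0\<close>] by linarith
    have "(0::real) < of_rat u" using u t by linarith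
    then have u0: "0 < u" by simp
    have eq: "long_start a \<delta> 0 t y \<longleftrightarrow> long_start a \<delta> u (of_rat u) y"
      and eq': "long_start a \<delta> 0 t y \<Longrightarrow> a 0 y = a u y" for y
    proof -
      have st1: "y0 \<le> y" if l: "long_start a \<delta> 0 t y"
      proof (rule ccontr)
        assume "\<not> y0 \<le> y"
        then have "(of_rat y :: real) < of_rat y0" by (simp add: of_rat_less)
        then show False
          using l record_after_restart[OF T t, of y] record_before_restart[OF T t(1), of y] y0
          unfolding long_start_def by (cases "T < of_rat y") auto
      qed
      have st2: "y0 \<le> y" if l: "long_start a \<delta> u (of_rat u) y"
      proof (rule ccontr)
        assume "\<not> y0 \<le> y"
        then have "(of_rat y :: real) < of_rat y0" by (simp add: of_rat_less)
        then show False using l y0 u unfolding long_start_def by linarith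
      qed
      have st3: "a 0 y = a u y" "of_rat u < a 0 y" if "y0 \<le> y"
      proof -
        have "a 0 y0 \<le> a 0 y" using record_mono[OF \<open>0 < y0\<close> that] .
        then show 1: "of_rat u < a 0 y" using u by linarith
        have "u < y0" using uy0 by (simp add: of_rat_less)
        with that have "u < y" by simp
        then show "a 0 y = a u y" using u0 1 between[of 0 y] by (intro nested) auto
      qed
      show "long_start a \<delta> 0 t y \<longleftrightarrow> long_start a \<delta> u (of_rat u) y"
      proof
        assume l: "long_start a \<delta> 0 t y"
        note 1 = st1[OF l] st3[OF st1[OF l]]
        have "u < y0" using uy0 by (simp add: of_rat_less)
        then show "long_start a \<delta> u (of_rat u) y" using l 1 unfolding long_start_def by auto
      next
        assume l: "long_start a \<delta> u (of_rat u) y"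
        note 1 = st2[OF l] st3[OF st2[OF l]]
        then show "long_start a \<delta> 0 t y" using l 1 u0 u t unfolding long_start_def by auto
      qed
      show "long_start a \<delta> 0 t y \<Longrightarrow> a 0 y = a u y" using st1 st3(1) by blast
    qed
    show "first_long_start a \<delta> 0 t x \<longleftrightarrow> first_long_start a \<delta> u (of_rat u) x"
      unfolding first_long_start_def using eq eq' by metis
  qed (use r0 in auto)
qed

text \<open>Otherwise the record at an index beyond \<open>t + \<bar>\<delta>\<bar>\<close> would
  still be at or before \<open>t\<close>, hence long.\<close>

lemma no_long_start_restarts:
  assumes "no_long_start a \<delta> t" "0 \<le> t"
  shows "\<exists>u. restarts a t u"
proof -
  obtain y :: rat where y: "t + \<bar>\<delta>\<bar> < of_rat y" using of_rat_dense[of "t + \<bar>\<delta>\<bar>" "t + \<bar>\<delta>\<bar> + 1"] by auto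
  then have ty: "t < of_rat y" by linarith
  then have "(0::real) < of_rat y" using assms by linarith
  then have "0 < y" by simp
  have "t < a 0 y"
  proof (rule ccontr)
    assume "\<not> t < a 0 y"
    then show False using assms(1) \<open>0 < y\<close> y unfolding no_long_start_def by fastforce
  qed
  with ty have "restarts a t (y + 1)" unfolding restarts_def by (intro exI[of _ y]) auto
  then show ?thesis ..
qed

text \<open>After the restart all records lie beyond \<open>t\<close>, so only indices before
  \<open>u\<close> remain to be tested. This turns the condition into one on the path before
  \<open>u\<close>.\<close>

lemma no_long_start_iff_before_restart:
  assumes "restarts a t u" "0 \<le> t"
  shows "no_long_start a \<delta> t \<longleftrightarrow> (\<forall>y. 0 < y \<and> y < u \<longrightarrow> a 0 y \<le> t \<longrightarrow> of_rat y \<le> a 0 y + \<delta>)"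
proof -
  obtain y0 where y0: "t < of_rat y0" "y0 < u" "t < a 0 y0" using assms unfolding restarts_def by auto
  have "(0::real) < of_rat y0" using y0 assms by linarith
  then have "0 < y0" by simp
  have "t < a 0 y" if "u \<le> y" for y
    using record_mono[OF \<open>0 < y0\<close>, of y] y0 that by auto
  then show ?thesis unfolding no_long_start_def by (metis not_less)
qed

lemma first_long_start_no_long_start:
  assumes "no_long_start a \<delta> t" "0 \<le> t"
  shows "first_long_start a \<delta> 0 t x \<longleftrightarrow> first_long_start a \<delta> 0 0 x"
proof -
  have "long_start a \<delta> 0 t y \<longleftrightarrow> long_start a \<delta> 0 0 y" for y
    using assms unfolding long_start_def no_long_start_def by (meson le_less_trans not_le)
  then show ?thesis unfolding first_long_start_def by simp
qed

text \<open>Lets the first long record be located by scanning a grid for the point where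
  \<open>no_long_start\<close> first fails.\<close>

lemma no_long_start_iff:
  assumes "first_long_start a \<delta> 0 0 x"
  shows "no_long_start a \<delta> t \<longleftrightarrow> t < x"
proof -
  obtain y where y: "long_start a \<delta> 0 0 y" "a 0 y = x" and m: "\<And>y'. long_start a \<delta> 0 0 y' \<Longrightarrow> x \<le> a 0 y'"
    using assms unfolding first_long_start_def by auto
  show ?thesis
  proof
    assume "no_long_start a \<delta> t"
    then show "t < x" using y unfolding no_long_start_def long_start_def by (meson not_le)
  next
    assume t: "t < x"
    show "no_long_start a \<delta> t" unfolding no_long_start_def
    proof (intro allI impI)
      fix y' assume y': "0 < y'" "a 0 y' \<le> t"
      then have "\<not> long_start a \<delta> 0 0 y'" using m[of y'] t by auto
      then show "of_rat y' \<le> a 0 y' + \<delta>" using y' between[of 0 y'] unfolding long_start_def by auto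
    qed
  qed
qed

lemma first_long_start_pos: "first_long_start a \<delta> 0 0 x \<Longrightarrow> 0 < x"
  unfolding first_long_start_def long_start_def by auto

text \<open>If the record at index \<open>y\<close> is long, a different later record lies at or
  beyond \<open>y\<close>, hence more than \<delta> after it. A rational time less than \<delta>
  before a long record thus separates it from all earlier long ones.\<close>

lemma long_record_is_first:
  assumes "0 < h" "a 0 h + \<delta> < of_rat h" "0 < \<delta>"
  shows "\<exists>t\<ge>0. first_long_start a \<delta> 0 (of_rat t) (a 0 h)"
proof -
  obtain t :: rat where t: "max 0 (a 0 h - \<delta>) < of_rat t" "of_rat t < a 0 h"
    using of_rat_dense[of "max 0 (a 0 h - \<delta>)" "a 0 h"] assms between[of 0 h] by auto
  have "first_long_start a \<delta> 0 (of_rat t) (a 0 h)"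
    unfolding first_long_start_def
  proof (intro conjI allI impI)
    show "\<exists>y. long_start a \<delta> 0 (of_rat t) y \<and> a 0 y = a 0 h"
      using assms t by (intro exI[of _ h]) (auto simp: long_start_def)
    fix y assume y: "long_start a \<delta> 0 (of_rat t) y"
    then have y0: "0 < y" unfolding long_start_def by auto
    show "a 0 h \<le> a 0 y"
    proof (cases "h \<le> y")
      case True then show ?thesis using record_mono[OF assms(1)] by simp
    next
      case False
      then have "a 0 h = a 0 y \<or> of_rat y \<le> a 0 h" using record_cases[OF y0, of h] by auto
      then show ?thesis using y t unfolding long_start_def by auto
    qed
  qed
  moreover have "(0::real) < of_rat t" using t by linarith
  ultimately show ?thesis by (intro exI[of _ t]) auto
qed

end

section \<open>Measurability of the type of an extremum\<close>

text \<open>The factor \<open>e\<close> is 1 for maxima and -1 for minima, so both types share their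
  arguments. Radii indexed by naturals keep the existence of a ball a countable condition.\<close>

definition extremum_on_ball :: "real \<Rightarrow> nat \<Rightarrow> (real \<Rightarrow> real) \<Rightarrow> real \<Rightarrow> bool" where
  "extremum_on_ball e n \<omega> x \<longleftrightarrow> (\<forall>y. \<bar>y - x\<bar> < 1 / real (Suc n) \<longrightarrow> e * \<omega> y \<le> e * \<omega> x)"

definition extremum_at :: "real \<Rightarrow> (real \<Rightarrow> real) \<Rightarrow> real \<Rightarrow> bool" where
  "extremum_at e \<omega> x \<longleftrightarrow> (\<exists>n. extremum_on_ball e n \<omega> x)"

lemma inverse_Suc_antimono: "m \<le> n \<Longrightarrow> 1 / real (Suc n) \<le> 1 / real (Suc m)"
  by (intro divide_left_mono) auto

lemma inverse_Suc_less: "0 < r \<Longrightarrow> \<exists>n. 1 / real (Suc n) < r"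
  using nat_approx_posE[of r] by (metis inverse_eq_divide)

lemma extremum_at_iff_eventually: "extremum_at e \<omega> x \<longleftrightarrow> (\<forall>\<^sub>F y in nhds x. e * \<omega> y \<le> e * \<omega> x)"
proof
  assume "extremum_at e \<omega> x"
  then obtain n where "extremum_on_ball e n \<omega> x" unfolding extremum_at_def by auto
  then show "\<forall>\<^sub>F y in nhds x. e * \<omega> y \<le> e * \<omega> x"
    unfolding extremum_on_ball_def eventually_nhds_metric
    by (intro exI[of _ "1 / real (Suc n)"]) (auto simp: dist_real_def)
next
  assume "\<forall>\<^sub>F y in nhds x. e * \<omega> y \<le> e * \<omega> x"
  then obtain d where "0 < d" "\<And>y. \<bar>y - x\<bar> < d \<Longrightarrow> e * \<omega> y \<le> e * \<omega> x"
    unfolding eventually_nhds_metric dist_real_def by auto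
  moreover from inverse_Suc_less[OF \<open>0 < d\<close>] obtain n where "1 / real (Suc n) < d" ..
  ultimately show "extremum_at e \<omega> x" unfolding extremum_at_def extremum_on_ball_def by (intro exI[of _ n]) auto
qed

lemma local_extrema_iff: "x \<in> local_extrema \<omega> \<longleftrightarrow> extremum_at 1 \<omega> x \<or> extremum_at (-1) \<omega> x"
  unfolding local_extrema_def extremum_at_iff_eventually by auto

lemma extremum_at_levy_shift: "extremum_at e (levy_shift u \<omega>) x \<longleftrightarrow> extremum_at e \<omega> (u + x)"
proof -
  have "extremum_on_ball e n (levy_shift u \<omega>) x \<longleftrightarrow> extremum_on_ball e n \<omega> (u + x)" for n
  proof -
    have "(\<forall>y. \<bar>y - x\<bar> < 1 / real (Suc n) \<longrightarrow> e * \<omega> (u + y) \<le> e * \<omega> (u + x)) \<longleftrightarrow>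
      (\<forall>y. \<bar>y - (u + x)\<bar> < 1 / real (Suc n) \<longrightarrow> e * \<omega> y \<le> e * \<omega> (u + x))"
      by (rule iffI; intro allI impI) (auto dest: spec[where x="_ - u"] spec[where x="u + _"] simp: algebra_simps)
    then show ?thesis unfolding extremum_on_ball_def levy_shift_def by (simp add: algebra_simps)
  qed
  then show ?thesis unfolding extremum_at_def by simp
qed

text \<open>Clamping the argument at \<open>u\<close> keeps the rational criterion within the increments after \<open>u\<close>.\<close>

lemma extremum_at_iff_rational:
  assumes cont: "continuous_on UNIV \<omega>" and "u < x"
  shows "extremum_at e \<omega> x \<longleftrightarrow>
    (\<exists>n. \<forall>q::rat. \<bar>of_rat q\<bar> < 1 / real (Suc n) \<longrightarrow> e * (\<omega> (max u (x + of_rat q)) - \<omega> u) \<le> e * (\<omega> (max u x) - \<omega> u))"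
    (is "_ \<longleftrightarrow> (\<exists>n. ?R n)")
proof
  have diff: "e * (a - \<omega> u) \<le> e * (b - \<omega> u) \<longleftrightarrow> e * a \<le> e * b" for a b by (simp add: algebra_simps)
  \<comment> \<open>Below radius \<open>x - u\<close> the ball stays to the right of
    \<open>u\<close>, where clamping changes nothing.\<close>
  obtain n0 where n0: "1 / real (Suc n0) < x - u" using inverse_Suc_less[of "x - u"] assms by auto
  {
    assume "extremum_at e \<omega> x"
    then obtain n where n: "\<And>y. \<bar>y - x\<bar> < 1 / real (Suc n) \<Longrightarrow> e * \<omega> y \<le> e * \<omega> x"
      unfolding extremum_at_def extremum_on_ball_def by auto
    have "?R (max n n0)"
    proof (intro allI impI)
      fix q :: rat assume q: "\<bar>of_rat q :: real\<bar> < 1 / real (Suc (max n n0))"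
      then have "\<bar>of_rat q :: real\<bar> < 1 / real (Suc n)" "\<bar>of_rat q :: real\<bar> < x - u"
        using inverse_Suc_antimono[of n "max n n0"] inverse_Suc_antimono[of n0 "max n n0"] n0 by linarith+
      then have "max u (x + of_rat q) = x + of_rat q" "max u x = x" "\<bar>x + of_rat q - x\<bar> < 1 / real (Suc n)" using \<open>u < x\<close> by linarith+
      then show "e * (\<omega> (max u (x + of_rat q)) - \<omega> u) \<le> e * (\<omega> (max u x) - \<omega> u)"
        unfolding diff using n[of "x + of_rat q"] by (simp only:)
    qed
    then show "\<exists>n. ?R n" ..
  next
    assume "\<exists>n. ?R n"
    then obtain n where n: "?R n" ..
    define m where "m = max n n0"
    have m: "1 / real (Suc m) \<le> 1 / real (Suc n)" "1 / real (Suc m) < x - u"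
      using inverse_Suc_antimono[of n m] inverse_Suc_antimono[of n0 m] n0 unfolding m_def by linarith+
    have "extremum_on_ball e m \<omega> x"
      unfolding extremum_on_ball_def
    proof (intro allI impI, rule ccontr)
      fix y assume y: "\<bar>y - x\<bar> < 1 / real (Suc m)" and "\<not> e * \<omega> y \<le> e * \<omega> x"
      then have gt: "e * \<omega> x < e * \<omega> y" by simp
      have "isCont (\<lambda>y. e * \<omega> y) y"
        using cont by (intro continuous_intros) (simp add: continuous_on_eq_continuous_at)
      then have "\<forall>\<^sub>F z in at y. e * \<omega> x < e * \<omega> z"
        using gt unfolding isCont_def by (intro order_tendstoD(1))
      then obtain d where d: "0 < d" "\<And>z. z \<noteq> y \<Longrightarrow> \<bar>z - y\<bar> < d \<Longrightarrow> e * \<omega> x < e * \<omega> z"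
        unfolding eventually_at dist_real_def by auto
      have "max (y - x - d) (- (1 / real (Suc m))) < min (y - x + d) (1 / real (Suc m))"
        using d y by (auto simp: abs_if split: if_splits)
      \<comment> \<open>A rational offset close to \<open>y - x\<close>; by continuity the strict
        excess of the path at \<open>y\<close> persists there.\<close>
      then obtain q :: rat where q: "max (y - x - d) (- (1 / real (Suc m))) < of_rat q" "of_rat q < min (y - x + d) (1 / real (Suc m))"
        using of_rat_dense by blast
      have qm: "\<bar>of_rat q :: real\<bar> < 1 / real (Suc m)" using q by linarith
      then have "\<bar>of_rat q :: real\<bar> < 1 / real (Suc n)" "u < x + of_rat q" using m by linarith+
      with n have "e * \<omega> (x + of_rat q) \<le> e * \<omega> x" unfolding diff using \<open>u < x\<close> by (auto simp: max_def split: if_splits)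
      moreover have "e * \<omega> x < e * \<omega> (x + of_rat q)"
        using d(2)[of "x + of_rat q"] gt q by (cases "x + of_rat q = y") auto
      ultimately show False by simp
    qed
    then show "extremum_at e \<omega> x" unfolding extremum_at_def ..
  }
qed

section \<open>Limits of events and measurability with respect to completed fields\<close>

lemma (in finite_measure) measure_tendsto_AE:
  assumes B: "\<And>n. B n \<in> sets M" "A \<in> sets M" and ae: "AE x in M. \<forall>\<^sub>F n in sequentially. x \<in> B n \<longleftrightarrow> x \<in> A"
  shows "(\<lambda>n. measure M (B n)) \<longlonglongrightarrow> measure M A"
proof -
  \<comment> \<open>Dominated convergence for indicators: events read off finer and finer grids need
    not be monotone.\<close>
  have "(\<lambda>n. \<integral>x. indicator (B n) x \<partial>M) \<longlonglongrightarrow> (\<integral>x. indicator A x \<partial>M :: real)"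
  proof (rule integral_dominated_convergence[where w="\<lambda>_. 1"])
    show "AE x in M. (\<lambda>n. indicator (B n) x) \<longlonglongrightarrow> (indicator A x :: real)"
      using ae
    proof eventually_elim
      fix x assume "\<forall>\<^sub>F n in sequentially. x \<in> B n \<longleftrightarrow> x \<in> A"
      then have "\<forall>\<^sub>F n in sequentially. indicator (B n) x = (indicator A x :: real)"
        by eventually_elim (auto simp: indicator_def)
      then show "(\<lambda>n. indicator (B n) x) \<longlonglongrightarrow> (indicator A x :: real)" by (rule tendsto_eventually)
    qed
  qed (use B in \<open>auto simp: indicator_def\<close>)
  moreover have "(\<integral>x. indicator S x \<partial>M) = measure M S" if "S \<in> sets M" for S
    using sets.sets_into_space[OF that] by (simp add: Int_absorb2)
  ultimately show ?thesis using B by simp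
qed

lemma (in finite_measure) measure_eventually_subset:
  assumes B: "\<And>n. B n \<in> sets M" "A \<in> sets M" and ae: "AE x in M. x \<in> A \<longrightarrow> (\<forall>\<^sub>F n in sequentially. x \<in> B n)"
  shows "(\<lambda>n. measure M (A \<inter> B n)) \<longlonglongrightarrow> measure M A"
proof (rule measure_tendsto_AE)
  show "AE x in M. \<forall>\<^sub>F n in sequentially. x \<in> A \<inter> B n \<longleftrightarrow> x \<in> A"
    using ae by eventually_elim (auto elim: eventually_mono)
qed (use B in auto)

lemma floor_approx: "(\<lambda>n. of_int \<lfloor>real (Suc n) * x\<rfloor> / real (Suc n)) \<longlonglongrightarrow> x"
proof (rule real_tendsto_sandwich)
  show "\<forall>\<^sub>F n in sequentially. x - inverse (real (Suc n)) \<le> of_int \<lfloor>real (Suc n) * x\<rfloor> / real (Suc n)"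
  proof (intro always_eventually allI)
    fix n
    have "real (Suc n) * x - 1 \<le> of_int \<lfloor>real (Suc n) * x\<rfloor>" by linarith
    then have "(real (Suc n) * x - 1) / real (Suc n) \<le> of_int \<lfloor>real (Suc n) * x\<rfloor> / real (Suc n)" by (rule divide_right_mono) simp
    then show "x - inverse (real (Suc n)) \<le> of_int \<lfloor>real (Suc n) * x\<rfloor> / real (Suc n)"
      by (simp add: diff_divide_distrib inverse_eq_divide)
  qed
  show "\<forall>\<^sub>F n in sequentially. of_int \<lfloor>real (Suc n) * x\<rfloor> / real (Suc n) \<le> x"
  proof (intro always_eventually allI)
    fix n
    have "of_int \<lfloor>real (Suc n) * x\<rfloor> \<le> real (Suc n) * x" by linarith
    then have "of_int \<lfloor>real (Suc n) * x\<rfloor> / real (Suc n) \<le> real (Suc n) * x / real (Suc n)" by (rule divide_right_mono) simp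
    then show "of_int \<lfloor>real (Suc n) * x\<rfloor> / real (Suc n) \<le> x" by simp
  qed
  show "(\<lambda>n. x - inverse (real (Suc n))) \<longlonglongrightarrow> x"
    using tendsto_diff[OF tendsto_const LIMSEQ_inverse_real_of_nat, of x] by simp
qed auto

lemma borel_measurable_pred_le:
  fixes f g :: "'a \<Rightarrow> real"
  shows "f \<in> borel_measurable M \<Longrightarrow> g \<in> borel_measurable M \<Longrightarrow> Measurable.pred M (\<lambda>w. f w \<le> g w)"
  unfolding not_less[symmetric] by (intro pred_intros_logic borel_measurable_pred_less)

lemma the_real_coffin: "the \<in> borel_measurable real_coffin"
proof -
  have sp: "space real_coffin = UNIV" and st: "sets real_coffin = sigma_sets UNIV ({Some ` A | A. A \<in> sets borel} \<union> {{None}})"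
    unfolding real_coffin_def by (auto intro!: space_measure_of sets_measure_of)
  show ?thesis
  proof (rule measurableI)
    fix A :: "real set" assume A: "A \<in> sets borel"
    have 1: "Some ` A \<in> sets real_coffin" unfolding st using A by (intro sigma_sets.Basic) auto
    have 2: "{None} \<in> sets real_coffin" unfolding st by (intro sigma_sets.Basic) auto
    \<comment> \<open>\<open>the None\<close> is an unspecified real, so the coffin state may belong
      to the preimage.\<close>
    have "the -` A \<inter> space real_coffin = Some ` A \<union> (if the None \<in> A then {None} else {})"
      unfolding sp
    proof (intro set_eqI)
      fix z :: "real option"
      show "z \<in> the -` A \<inter> UNIV \<longleftrightarrow> z \<in> Some ` A \<union> (if the None \<in> A then {None} else {})"
        by (cases z) auto
    qed
    then show "the -` A \<inter> space real_coffin \<in> sets real_coffin"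
      using 1 sets.Un[OF 1 2] by (auto split: if_splits)
  qed simp
qed

context wiener_space begin

lemma pred_AE_cong:
  assumes "Measurable.pred W Q'" "AE \<omega> in W. Q \<omega> \<longleftrightarrow> Q' \<omega>"
  shows "Measurable.pred W Q"
proof -
  have "AE \<omega> in P. \<not> (Q \<omega> \<noteq> Q' \<omega>)" using assms(2) unfolding AE_completion_iff by simp
  then have "Measurable.pred W (\<lambda>\<omega>. Q \<omega> \<noteq> Q' \<omega>)" by (rule sets_completion_AE)
  \<comment> \<open>\<open>Q\<close> is the exclusive or of \<open>Q'\<close> with the null event on
    which they differ.\<close>
  then have "Measurable.pred W (\<lambda>\<omega>. (Q \<omega> \<noteq> Q' \<omega>) \<noteq> Q' \<omega>)" using assms(1) by measurable
  moreover have "(\<lambda>\<omega>. (Q \<omega> \<noteq> Q' \<omega>) \<noteq> Q' \<omega>) = Q" by (rule ext) auto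
  ultimately show ?thesis by (simp only:)
qed

lemma pred_increment_field_AE_cong:
  assumes Q': "Measurable.pred (increment_field W s t) Q'" and ae: "AE \<omega> in W. Q \<omega> \<longleftrightarrow> Q' \<omega>"
  shows "Measurable.pred (increment_field W s t) Q"
proof -
  have "Measurable.pred W Q" by (rule pred_AE_cong[OF measurable_increment_field_W[OF Q'] ae])
  then have "{\<omega>\<in>space W. Q \<omega>} \<in> sets W" unfolding pred_def .
  moreover have "{\<omega>\<in>space W. Q' \<omega>} \<in> sets (increment_field W s t)" using Q' unfolding pred_def space_increment_field .
  moreover have "AE \<omega> in W. \<omega> \<in> {\<omega>\<in>space W. Q' \<omega>} \<longleftrightarrow> \<omega> \<in> {\<omega>\<in>space W. Q \<omega>}" using ae by eventually_elim blast
  ultimately have "{\<omega>\<in>space W. Q \<omega>} \<in> sets (increment_field W s t)"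
    using increment_field_AE_cong[OF _ _ sets_increment_field_subset] by blast
  then show ?thesis unfolding pred_def space_increment_field .
qed

lemma continuous_path: "\<omega> \<in> space W \<Longrightarrow> continuous_on UNIV \<omega>"
  by (simp add: space_P Omega0_def)

text \<open>The random time is rounded down to countably many values, and continuity of the path
  gives the limit. Clamping keeps the evaluation time at or after \<open>u\<close> even when
  rounding falls below it.\<close>

lemma eval_meas_increment_field:
  assumes X: "X \<in> borel_measurable (increment_field W u \<infinity>)"
  shows "(\<lambda>\<omega>. \<omega> (max u (X \<omega>)) - \<omega> u) \<in> borel_measurable (increment_field W (ereal u) \<infinity>)"
proof (rule borel_measurable_LIMSEQ_real)
  fix \<omega> assume "\<omega> \<in> space (increment_field W u \<infinity>)"
  then have c: "isCont \<omega> z" for z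
    using continuous_path unfolding space_increment_field by (auto simp: continuous_on_eq_continuous_at)
  have "isCont (\<lambda>z. \<omega> (max u z) - \<omega> u) (X \<omega>)" using c by (intro continuous_intros isCont_o2[OF _ c])
  then show "(\<lambda>n. \<omega> (max u (of_int \<lfloor>real (Suc n) * X \<omega>\<rfloor> / real (Suc n))) - \<omega> u) \<longlonglongrightarrow> \<omega> (max u (X \<omega>)) - \<omega> u"
    using floor_approx by (rule isCont_tendsto_compose)
next
  fix n
  show "(\<lambda>\<omega>. \<omega> (max u (of_int \<lfloor>real (Suc n) * X \<omega>\<rfloor> / real (Suc n))) - \<omega> u) \<in> borel_measurable (increment_field W (ereal u) \<infinity>)"
  proof (rule measurable_compose_countable[where f="\<lambda>i \<omega>. \<omega> (max u (of_int i / real (Suc n))) - \<omega> u" and g="\<lambda>\<omega>. \<lfloor>real (Suc n) * X \<omega>\<rfloor>"])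
    show "(\<lambda>\<omega>. \<omega> (max u (of_int i / real (Suc n))) - \<omega> u) \<in> borel_measurable (increment_field W (ereal u) \<infinity>)" for i
      by (rule increment_meas_increment_field) auto
    show "(\<lambda>\<omega>. \<lfloor>real (Suc n) * X \<omega>\<rfloor>) \<in> measurable (increment_field W u \<infinity>) (count_space UNIV)"
      using X by measurable
  qed
qed

lemma pred_extremum_at:
  assumes X: "X \<in> borel_measurable (increment_field W u \<infinity>)" and ae: "AE \<omega> in W. u < X \<omega>"
  shows "Measurable.pred (increment_field W (ereal u) \<infinity>) (\<lambda>\<omega>. extremum_at e \<omega> (X \<omega>))"
proof (rule pred_increment_field_AE_cong)
  show "AE \<omega> in W. extremum_at e \<omega> (X \<omega>) \<longleftrightarrow> (\<exists>n. \<forall>q::rat. \<bar>of_rat q\<bar> < 1 / real (Suc n) \<longrightarrow> e * (\<omega> (max u (X \<omega> + of_rat q)) - \<omega> u) \<le> e * (\<omega> (max u (X \<omega>)) - \<omega> u))"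
    using ae AE_space by eventually_elim (rule extremum_at_iff_rational[OF continuous_path])
  show "Measurable.pred (increment_field W (ereal u) \<infinity>) (\<lambda>\<omega>. \<exists>n. \<forall>q::rat. \<bar>of_rat q\<bar> < 1 / real (Suc n) \<longrightarrow> e * (\<omega> (max u (X \<omega> + of_rat q)) - \<omega> u) \<le> e * (\<omega> (max u (X \<omega>)) - \<omega> u))"
    using X by (intro pred_intros_countable pred_intros_imp' borel_measurable_pred_le borel_measurable_times borel_measurable_const
        eval_meas_increment_field borel_measurable_add)
qed

end

section \<open>Regeneration at restart times\<close>

locale honest_wiener = wiener_space +
  fixes \<tau> :: "real \<Rightarrow> real \<Rightarrow> (real \<Rightarrow> real) \<Rightarrow> real option"
  assumes honest: "honest_indexation (completion P) local_extrema \<tau>"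
begin

text \<open>Rational end points let the almost sure properties hold simultaneously for all
  intervals. At the coffin state the value is arbitrary; inclusion makes this a null event.\<close>

definition sel :: "(real \<Rightarrow> real) \<Rightarrow> rat \<Rightarrow> rat \<Rightarrow> real" where
  "sel \<omega> s t = the (\<tau> (of_rat s) (of_rat t) \<omega>)"

lemma sel_meas:
  assumes "s < t"
  shows "(\<lambda>\<omega>. sel \<omega> s t) \<in> borel_measurable (increment_field W (real_of_rat s) (real_of_rat t))"
proof -
  have "(of_rat s :: real) < of_rat t" using assms by (simp add: of_rat_less)
  then have "\<tau> (of_rat s) (of_rat t) \<in> measurable (increment_field W (real_of_rat s) (real_of_rat t)) real_coffin"
    using honest unfolding honest_indexation_def by blast
  from measurable_compose[OF this the_real_coffin] show ?thesis unfolding sel_def .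
qed

lemma sel_meas_mono:
  assumes "s < t" "s' \<le> ereal (of_rat s)" "ereal (of_rat t) \<le> t'"
  shows "(\<lambda>\<omega>. sel \<omega> s t) \<in> borel_measurable (increment_field W s' t')"
  by (rule measurable_increment_field_mono[OF sel_meas assms(2,3)]) fact

lemma AE_sel:
  "AE \<omega> in W. \<forall>s t. s < t \<longrightarrow> \<tau> (of_rat s) (of_rat t) \<omega> = Some (sel \<omega> s t) \<and>
     of_rat s < sel \<omega> s t \<and> sel \<omega> s t < of_rat t \<and> sel \<omega> s t \<in> local_extrema \<omega>"
proof -
  have "AE \<omega> in W. s < t \<longrightarrow> \<tau> (of_rat s) (of_rat t) \<omega> = Some (sel \<omega> s t) \<and>
     of_rat s < sel \<omega> s t \<and> sel \<omega> s t < of_rat t \<and> sel \<omega> s t \<in> local_extrema \<omega>" for s t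
  proof (rule AE_impI)
    assume "s < t"
    then have "(of_rat s :: real) < of_rat t" by (simp add: of_rat_less)
    then have "AE \<omega> in W. \<tau> (of_rat s) (of_rat t) \<omega> \<in> Some ` local_extrema \<omega>"
      "AE \<omega> in W. \<tau> (of_rat s) (of_rat t) \<omega> \<in> Some ` {of_rat s<..<of_rat t}"
      using honest unfolding honest_indexation_def by blast+
    then show "AE \<omega> in W. \<tau> (of_rat s) (of_rat t) \<omega> = Some (sel \<omega> s t) \<and>
     of_rat s < sel \<omega> s t \<and> sel \<omega> s t < of_rat t \<and> sel \<omega> s t \<in> local_extrema \<omega>"
      by eventually_elim (auto simp: sel_def)
  qed
  then show ?thesis unfolding AE_all_countable by blast
qed

lemma AE_nested_selection: "AE \<omega> in W. nested_selection (sel \<omega>)"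
proof -
  have "AE \<omega> in W. (s \<le> u \<and> u < v \<and> v \<le> t) \<longrightarrow>
      (\<tau> (of_rat s) (of_rat t) \<omega> \<in> Some ` {of_rat u<..<of_rat v} \<longrightarrow> \<tau> (of_rat s) (of_rat t) \<omega> = \<tau> (of_rat u) (of_rat v) \<omega>)" for s u v t :: rat
  proof (rule AE_impI)
    assume "s \<le> u \<and> u < v \<and> v \<le> t"
    then have "(of_rat s :: real) \<le> of_rat u \<and> (of_rat u :: real) < of_rat v \<and> (of_rat v :: real) \<le> of_rat t"
      by (simp add: of_rat_less of_rat_less_eq)
    then show "AE \<omega> in W. \<tau> (of_rat s) (of_rat t) \<omega> \<in> Some ` {of_rat u<..<of_rat v} \<longrightarrow> \<tau> (of_rat s) (of_rat t) \<omega> = \<tau> (of_rat u) (of_rat v) \<omega>"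
      using honest unfolding honest_indexation_def by blast
  qed
  then have "AE \<omega> in W. \<forall>s u v t :: rat. (s \<le> u \<and> u < v \<and> v \<le> t) \<longrightarrow>
      (\<tau> (of_rat s) (of_rat t) \<omega> \<in> Some ` {of_rat u<..<of_rat v} \<longrightarrow> \<tau> (of_rat s) (of_rat t) \<omega> = \<tau> (of_rat u) (of_rat v) \<omega>)"
    unfolding AE_all_countable by blast
  then show ?thesis using AE_sel
  proof eventually_elim
    fix \<omega>
    assume n: "\<forall>s u v t :: rat. (s \<le> u \<and> u < v \<and> v \<le> t) \<longrightarrow>
      (\<tau> (of_rat s) (of_rat t) \<omega> \<in> Some ` {of_rat u<..<of_rat v} \<longrightarrow> \<tau> (of_rat s) (of_rat t) \<omega> = \<tau> (of_rat u) (of_rat v) \<omega>)"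
    and s: "\<forall>s t. s < t \<longrightarrow> \<tau> (of_rat s) (of_rat t) \<omega> = Some (sel \<omega> s t) \<and>
     of_rat s < sel \<omega> s t \<and> sel \<omega> s t < of_rat t \<and> sel \<omega> s t \<in> local_extrema \<omega>"
    show "nested_selection (sel \<omega>)"
    proof
      show "of_rat s < sel \<omega> s t \<and> sel \<omega> s t < of_rat t" if "s < t" for s t using s that by blast
      fix s u v t
      assume a: "s \<le> u" "u < v" "v \<le> t" "of_rat u < sel \<omega> s t" "sel \<omega> s t < of_rat v"
      then have "s < t" by linarith
      then have "\<tau> (of_rat s) (of_rat t) \<omega> = Some (sel \<omega> s t)" using s by blast
      moreover have "\<tau> (of_rat u) (of_rat v) \<omega> = Some (sel \<omega> u v)" using s a by blast
      moreover have "\<tau> (of_rat s) (of_rat t) \<omega> = \<tau> (of_rat u) (of_rat v) \<omega>"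
        using n a calculation by auto
      ultimately show "sel \<omega> s t = sel \<omega> u v" by simp
    qed
  qed
qed

lemma AE_sel_shift:
  "AE \<omega> in W. \<forall>s t. s < t \<longrightarrow> sel \<omega> (s + h) (t + h) = of_rat h + sel (levy_shift (of_rat h) \<omega>) s t"
proof -
  have "AE \<omega> in W. s < t \<longrightarrow> \<tau> (of_rat s + of_rat h) (of_rat t + of_rat h) \<omega> = map_option ((+) (of_rat h)) (\<tau> (of_rat s) (of_rat t) (levy_shift (of_rat h) \<omega>))" for s t :: rat
  proof (rule AE_impI)
    assume "s < t"
    then have "(of_rat s :: real) < of_rat t" by (simp add: of_rat_less)
    then show "AE \<omega> in W. \<tau> (of_rat s + of_rat h) (of_rat t + of_rat h) \<omega> = map_option ((+) (of_rat h)) (\<tau> (of_rat s) (of_rat t) (levy_shift (of_rat h) \<omega>))"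
      using honest unfolding honest_indexation_def by blast
  qed
  then have "AE \<omega> in W. \<forall>s t :: rat. s < t \<longrightarrow> \<tau> (of_rat s + of_rat h) (of_rat t + of_rat h) \<omega> = map_option ((+) (of_rat h)) (\<tau> (of_rat s) (of_rat t) (levy_shift (of_rat h) \<omega>))"
    unfolding AE_all_countable by blast
  then show ?thesis using AE_levy_shift[OF AE_sel, of "of_rat h"]
  proof eventually_elim
    fix \<omega>
    assume n: "\<forall>s t :: rat. s < t \<longrightarrow> \<tau> (of_rat s + of_rat h) (of_rat t + of_rat h) \<omega> = map_option ((+) (of_rat h)) (\<tau> (of_rat s) (of_rat t) (levy_shift (of_rat h) \<omega>))"
      and s: "\<forall>s t. s < t \<longrightarrow> \<tau> (of_rat s) (of_rat t) (levy_shift (of_rat h) \<omega>) = Some (sel (levy_shift (of_rat h) \<omega>) s t) \<and>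
        of_rat s < sel (levy_shift (of_rat h) \<omega>) s t \<and> sel (levy_shift (of_rat h) \<omega>) s t < of_rat t \<and>
        sel (levy_shift (of_rat h) \<omega>) s t \<in> local_extrema (levy_shift (of_rat h) \<omega>)"
    show "\<forall>s t. s < t \<longrightarrow> sel \<omega> (s + h) (t + h) = of_rat h + sel (levy_shift (of_rat h) \<omega>) s t"
    proof (intro allI impI)
      fix s t :: rat assume st: "s < t"
      have "\<tau> (of_rat s + of_rat h) (of_rat t + of_rat h) \<omega> = map_option ((+) (of_rat h)) (Some (sel (levy_shift (of_rat h) \<omega>) s t))"
        using n[rule_format, OF st] s[rule_format, OF st] by (simp only:)
      then show "sel \<omega> (s + h) (t + h) = of_rat h + sel (levy_shift (of_rat h) \<omega>) s t"
        unfolding sel_def[of \<omega>] of_rat_add by (simp only: option.map option.sel)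
    qed
  qed
qed

text \<open>Gathers the almost sure properties needed by arguments on a single path. Oscillation at
  all rational times forbids intervals on which the path is constant.\<close>

definition regular :: "(real \<Rightarrow> real) \<Rightarrow> bool" where
  "regular \<omega> \<longleftrightarrow> nested_selection (sel \<omega>) \<and> (\<forall>s t. s < t \<longrightarrow> sel \<omega> s t \<in> local_extrema \<omega>) \<and>
     (\<forall>(u::rat) n. oscillates (1 / real (Suc n)) 0 (of_rat u) \<omega>) \<and> continuous_on UNIV \<omega>"

lemma AE_regular: "AE \<omega> in W. regular \<omega>"
proof -
  have "AE \<omega> in W. \<forall>(u::rat) n. oscillates (1 / real (Suc n)) 0 (of_rat u) \<omega>"
    unfolding AE_all_countable[where 'i=rat] using AE_oscillates by blast
  then show ?thesis using AE_sel AE_nested_selection AE_space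
    by eventually_elim (auto simp: regular_def continuous_path)
qed

definition first_long_type :: "real \<Rightarrow> rat \<Rightarrow> real \<Rightarrow> real \<Rightarrow> (real \<Rightarrow> real) \<Rightarrow> bool" where
  "first_long_type \<delta> b t e \<omega> \<longleftrightarrow> (\<exists>x. first_long_start (sel \<omega>) \<delta> b t x \<and> extremum_at e \<omega> x)"

text \<open>The position \<open>x\<close> ranges over the reals, but it is the record at a rational
  index, so the quantifier can be made countable.\<close>

lemma pred_first_long_type: "Measurable.pred (increment_field W (real_of_rat b) \<infinity>) (first_long_type \<delta> b t e)"
proof -
  have eq: "first_long_type \<delta> b t e = (\<lambda>\<omega>. \<exists>y. b < y \<and> (t < sel \<omega> b y \<and> sel \<omega> b y + \<delta> < of_rat y \<and> extremum_at e \<omega> (sel \<omega> b y) \<and>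
     (\<forall>y'. b < y' \<longrightarrow> t < sel \<omega> b y' \<and> sel \<omega> b y' + \<delta> < of_rat y' \<longrightarrow> sel \<omega> b y \<le> sel \<omega> b y')))"
    unfolding first_long_type_def first_long_start_def long_start_def fun_eq_iff by (intro allI iffI) blast+
  have m: "(\<lambda>\<omega>. sel \<omega> b y) \<in> borel_measurable (increment_field W (real_of_rat b) \<infinity>)" if "b < y" for y
    using that by (intro sel_meas_mono) auto
  have ae: "AE \<omega> in W. of_rat b < sel \<omega> b y" if "b < y" for y using AE_sel by eventually_elim (use that in blast)
  show ?thesis unfolding eq
    by (intro pred_intros_countable pred_intros_conj1' pred_intros_imp' pred_intros_logic borel_measurable_pred_less
       borel_measurable_pred_le pred_extremum_at m ae borel_measurable_add borel_measurable_const)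
qed

lemma first_long_type_set: "{\<omega>\<in>space W. first_long_type \<delta> b t e \<omega>} \<in> sets (increment_field W (real_of_rat b) \<infinity>)"
  using pred_first_long_type unfolding pred_def space_increment_field .

text \<open>By stationarity the records started at \<open>u\<close> are those started at 0 for the
  shifted path, moved by \<open>u\<close>; the type of an extremum moves along with it.\<close>

lemma prob_first_long_type_shift:
  "measure W {\<omega>\<in>space W. first_long_type \<delta> u (of_rat u) e \<omega>} = measure W {\<omega>\<in>space W. first_long_type \<delta> 0 0 e \<omega>}"
proof -
  have "AE \<omega> in W. first_long_type \<delta> u (of_rat u) e \<omega> \<longleftrightarrow> first_long_type \<delta> 0 0 e (levy_shift (of_rat u) \<omega>)"
    using AE_sel_shift[of u]
  proof eventually_elim
    fix \<omega>
    assume s: "\<forall>s t. s < t \<longrightarrow> sel \<omega> (s + u) (t + u) = of_rat u + sel (levy_shift (of_rat u) \<omega>) s t"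
    let ?\<omega> = "levy_shift (of_rat u) \<omega>"
    have s0: "sel \<omega> u (y + u) = of_rat u + sel ?\<omega> 0 y" if "0 < y" for y using s[rule_format, OF that] by simp
    have l: "long_start (sel \<omega>) \<delta> u (of_rat u) (y + u) \<longleftrightarrow> long_start (sel ?\<omega>) \<delta> 0 0 y" for y
      using s0[of y] unfolding long_start_def by (cases "0 < y") (auto simp: of_rat_add)
    have l': "long_start (sel \<omega>) \<delta> u (of_rat u) y \<longleftrightarrow> long_start (sel ?\<omega>) \<delta> 0 0 (y - u)" for y
      using l[of "y - u"] by simp
    have s1: "sel \<omega> u y = of_rat u + sel ?\<omega> 0 (y - u)" if "long_start (sel \<omega>) \<delta> u (of_rat u) y" for y
      using s0[of "y - u"] that unfolding long_start_def by simp
    have "first_long_start (sel \<omega>) \<delta> u (of_rat u) (of_rat u + x) \<longleftrightarrow> first_long_start (sel ?\<omega>) \<delta> 0 0 x" for x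
    proof
      assume f: "first_long_start (sel \<omega>) \<delta> u (of_rat u) (of_rat u + x)"
      then obtain y where y: "long_start (sel \<omega>) \<delta> u (of_rat u) y" "sel \<omega> u y = of_rat u + x"
        unfolding first_long_start_def by blast
      show "first_long_start (sel ?\<omega>) \<delta> 0 0 x"
        unfolding first_long_start_def
      proof (intro conjI allI impI)
        show "\<exists>y. long_start (sel ?\<omega>) \<delta> 0 0 y \<and> sel ?\<omega> 0 y = x"
        proof (intro exI[of _ "y - u"] conjI)
          show "long_start (sel ?\<omega>) \<delta> 0 0 (y - u)" using l' y(1) by blast
          show "sel ?\<omega> 0 (y - u) = x" using s1[OF y(1)] y(2) by linarith
        qed
        fix y' assume y': "long_start (sel ?\<omega>) \<delta> 0 0 y'"
        then have "of_rat u + x \<le> sel \<omega> u (y' + u)" using f l unfolding first_long_start_def by blast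
        then show "x \<le> sel ?\<omega> 0 y'" using s0[of y'] y' unfolding long_start_def by simp
      qed
    next
      assume f: "first_long_start (sel ?\<omega>) \<delta> 0 0 x"
      then obtain y where y: "long_start (sel ?\<omega>) \<delta> 0 0 y" "sel ?\<omega> 0 y = x"
        unfolding first_long_start_def by blast
      show "first_long_start (sel \<omega>) \<delta> u (of_rat u) (of_rat u + x)"
        unfolding first_long_start_def
      proof (intro conjI allI impI)
        show "\<exists>y. long_start (sel \<omega>) \<delta> u (of_rat u) y \<and> sel \<omega> u y = of_rat u + x"
        proof (intro exI[of _ "y + u"] conjI)
          show "long_start (sel \<omega>) \<delta> u (of_rat u) (y + u)" using l y(1) by blast
          have "0 < y" using y(1) unfolding long_start_def by blast
          then show "sel \<omega> u (y + u) = of_rat u + x" by (simp only: s0 y(2))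
        qed
        fix y' assume y': "long_start (sel \<omega>) \<delta> u (of_rat u) y'"
        then have "x \<le> sel ?\<omega> 0 (y' - u)" using f l' unfolding first_long_start_def by blast
        then show "of_rat u + x \<le> sel \<omega> u y'" using s1[OF y'] by simp
      qed
    qed
    then have "first_long_start (sel \<omega>) \<delta> u (of_rat u) x \<longleftrightarrow> first_long_start (sel ?\<omega>) \<delta> 0 0 (x - of_rat u)" for x
      by (metis add.commute diff_add_cancel)
    then show "first_long_type \<delta> u (of_rat u) e \<omega> \<longleftrightarrow> first_long_type \<delta> 0 0 e ?\<omega>"
      unfolding first_long_type_def extremum_at_levy_shift
      by (metis add.commute diff_add_cancel add_diff_cancel_left')
  qed
  then have "AE \<omega> in W. \<omega> \<in> {\<omega>\<in>space W. first_long_type \<delta> u (of_rat u) e \<omega>} \<longleftrightarrow> \<omega> \<in> {\<omega>\<in>space W. first_long_type \<delta> 0 0 e (levy_shift (of_rat u) \<omega>)}"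
    by eventually_elim blast
  moreover have S: "{\<omega>\<in>space W. first_long_type \<delta> b t e \<omega>} \<in> sets W" for b t
    using first_long_type_set sets_increment_field_subset by blast
  moreover have "{\<omega>\<in>space W. first_long_type \<delta> 0 0 e (levy_shift (of_rat u) \<omega>)} = levy_shift (of_rat u) -` {\<omega>\<in>space W. first_long_type \<delta> 0 0 e \<omega>} \<inter> space W"
    using levy_shift_Omega0 space_P by auto
  then have "{\<omega>\<in>space W. first_long_type \<delta> 0 0 e (levy_shift (of_rat u) \<omega>)} \<in> sets W"
    using measurable_sets[OF levy_shift_meas_W S] by (simp only:)
  ultimately have "measure W {\<omega>\<in>space W. first_long_type \<delta> u (of_rat u) e \<omega>} = measure W {\<omega>\<in>space W. first_long_type \<delta> 0 0 e (levy_shift (of_rat u) \<omega>)}"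
    by (intro W.finite_measure_eq_AE)
  then show ?thesis using measure_levy_shift[OF S] by (simp only:)
qed

section \<open>Restart times discretised by dyadic grids\<close>

definition grid :: "nat \<Rightarrow> nat \<Rightarrow> rat" where "grid m j = of_nat j / 2 ^ m"

lemma grid_mono: "i \<le> j \<Longrightarrow> grid m i \<le> grid m j"
  unfolding grid_def by (simp add: divide_right_mono)

lemma grid_Suc: "real_of_rat (grid m (Suc j)) = real_of_rat (grid m j) + 1 / 2 ^ m"
  unfolding grid_def by (simp add: of_rat_divide of_rat_add of_rat_power add_divide_distrib)

lemma grid_unbounded: "\<exists>j. u \<le> grid m j"
proof -
  obtain j where j: "u * 2 ^ m < of_nat j" using reals_Archimedean2 by blast
  then show ?thesis unfolding grid_def by (intro exI[of _ j]) (simp add: pos_le_divide_eq)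
qed

definition restarted :: "real \<Rightarrow> rat \<Rightarrow> (real \<Rightarrow> real) set" where
  "restarted t u = {\<omega>\<in>space W. restarts (sel \<omega>) t u}"

definition restarted_ever :: "real \<Rightarrow> (real \<Rightarrow> real) set" where
  "restarted_ever t = (\<Union>u. restarted t u)"

lemma restarted_meas:
  assumes "0 \<le> t"
  shows "restarted t u \<in> sets (increment_field W 0 (real_of_rat u))"
proof -
  \<comment> \<open>Indices beyond \<open>t\<close> are positive, so all selections involved live on
    intervals between 0 and \<open>u\<close>.\<close>
  have pos: "0 < y" if "t < of_rat y" for y
  proof -
    have "(0::real) < of_rat y" using that assms by linarith
    then show ?thesis by simp
  qed
  have "Measurable.pred (increment_field W 0 (real_of_rat u)) (\<lambda>\<omega>. restarts (sel \<omega>) t u)"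
    unfolding restarts_def
    by (intro pred_intros_countable pred_intros_conj1' borel_measurable_pred_less sel_meas_mono borel_measurable_const)
      (use pos in \<open>auto simp: of_rat_less_eq zero_ereal_def\<close>)
  then show ?thesis unfolding restarted_def pred_def space_increment_field .
qed

lemma restarted_mono: "u \<le> v \<Longrightarrow> restarted t u \<subseteq> restarted t v"
  unfolding restarted_def using restarts_mono by blast

lemma restarted_0: "0 \<le> t \<Longrightarrow> restarted t (grid m 0) = {}"
  unfolding restarted_def restarts_def grid_def
  by auto (metis less_imp_le not_le of_rat_0 of_rat_less order_trans less_le_trans)

lemma restarted_sets: "0 \<le> t \<Longrightarrow> restarted t u \<in> sets W" "0 \<le> t \<Longrightarrow> restarted_ever t \<in> sets W"
proof -
  show *: "restarted t u \<in> sets W" if "0 \<le> t" for u using restarted_meas[OF that] sets_increment_field_subset by blast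
  show "restarted_ever t \<in> sets W" if "0 \<le> t" unfolding restarted_ever_def by (intro sets.countable_UN image_subsetI * that)
qed

text \<open>\<open>C\<close> is read at the first grid point after the restart. Which cell contains
  the restart is decided before its right end point, so a condition on the path after that point is
  independent of the cell.\<close>

definition at_restart :: "real \<Rightarrow> nat \<Rightarrow> (rat \<Rightarrow> (real \<Rightarrow> real) set) \<Rightarrow> (real \<Rightarrow> real) set" where
  "at_restart t m C = (\<Union>j. (restarted t (grid m (Suc j)) - restarted t (grid m j)) \<inter> C (grid m (Suc j)))"

lemma at_restart_UNIV:
  assumes "0 \<le> t"
  shows "at_restart t m (\<lambda>_. space W) = restarted_ever t"
proof
  show "at_restart t m (\<lambda>_. space W) \<subseteq> restarted_ever t" unfolding at_restart_def restarted_ever_def by blast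
  show "restarted_ever t \<subseteq> at_restart t m (\<lambda>_. space W)"
  proof
    fix \<omega> assume "\<omega> \<in> restarted_ever t"
    then obtain u where u: "\<omega> \<in> restarted t u" unfolding restarted_ever_def by blast
    obtain j0 where "u \<le> grid m j0" using grid_unbounded by blast
    then have j0: "\<omega> \<in> restarted t (grid m j0)" using u restarted_mono by blast
    define j where "j = (LEAST j. \<omega> \<in> restarted t (grid m j))"
    have j: "\<omega> \<in> restarted t (grid m j)" unfolding j_def using j0 by (rule LeastI)
    \<comment> \<open>The least index is not 0, since a restart after a nonnegative \<open>t\<close>
      cannot precede time 0.\<close>
    then obtain i where i: "j = Suc i" using restarted_0[OF assms, of m] by (cases j) auto
    have "\<omega> \<notin> restarted t (grid m i)" using not_less_Least[of i "\<lambda>j. \<omega> \<in> restarted t (grid m j)"] i unfolding j_def by auto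
    moreover have "\<omega> \<in> space W" using u unfolding restarted_def by blast
    ultimately show "\<omega> \<in> at_restart t m (\<lambda>_. space W)" unfolding at_restart_def using j i by blast
  qed
qed

lemma at_restart_disjoint: "disjoint_family (\<lambda>j. (restarted t (grid m (Suc j)) - restarted t (grid m j)) \<inter> C (grid m (Suc j)))"
proof -
  have *: "restarted t (grid m (Suc i)) \<subseteq> restarted t (grid m j)" if "i < j" for i j
    using that by (intro restarted_mono grid_mono) auto
  show ?thesis unfolding disjoint_family_on_def
  proof (intro ballI impI)
    fix i j :: nat assume "i \<noteq> j"
    then consider "i < j" | "j < i" by linarith
    then show "(restarted t (grid m (Suc i)) - restarted t (grid m i)) \<inter> C (grid m (Suc i)) \<inter> ((restarted t (grid m (Suc j)) - restarted t (grid m j)) \<inter> C (grid m (Suc j))) = {}"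
      using *[of i j] *[of j i] by cases blast+
  qed
qed

text \<open>The strong Markov property at the restart time, discretised to the grid from above.\<close>

lemma regeneration:
  assumes t: "0 \<le> t" and C: "\<And>u. C u \<in> sets (increment_field W (real_of_rat u) \<infinity>)" "\<And>u. measure W (C u) = c"
    and F: "F \<in> sets W" "\<And>u. F \<inter> restarted t u \<in> sets (increment_field W (-\<infinity>) (real_of_rat u))"
  shows "measure W (F \<inter> at_restart t m C) = c * measure W (F \<inter> restarted_ever t)"
proof -
  let ?D = "\<lambda>j. restarted t (grid m (Suc j)) - restarted t (grid m j)"
  have CW: "C u \<in> sets W" for u using C sets_increment_field_subset by blast
  have FD: "F \<inter> ?D j \<in> sets (increment_field W (-\<infinity>) (real_of_rat (grid m (Suc j))))" for j
  proof -
    have "F \<inter> restarted t (grid m j) \<in> sets (increment_field W (-\<infinity>) (real_of_rat (grid m (Suc j))))"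
      using F(2)[of "grid m j"] increment_field_mono[of "-\<infinity>" "-\<infinity>" "real_of_rat (grid m j)" "real_of_rat (grid m (Suc j))"]
        grid_mono[of j "Suc j" m] by (auto simp: of_rat_less_eq)
    with F(2)[of "grid m (Suc j)"] have "F \<inter> restarted t (grid m (Suc j)) - F \<inter> restarted t (grid m j) \<in> sets (increment_field W (-\<infinity>) (real_of_rat (grid m (Suc j))))"
      by (rule sets.Diff)
    moreover have "F \<inter> restarted t (grid m (Suc j)) - F \<inter> restarted t (grid m j) = F \<inter> ?D j" by blast
    ultimately show ?thesis by (simp only:)
  qed
  have FDW: "F \<inter> ?D j \<in> sets W" for j using FD sets_increment_field_subset by blast
  have disj: "disjoint_family (\<lambda>j. F \<inter> (?D j \<inter> B (grid m (Suc j))))" for B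
    using at_restart_disjoint[of t m B] unfolding disjoint_family_on_def by blast
  have U: "(\<Union>j. F \<inter> (?D j \<inter> B (grid m (Suc j)))) = F \<inter> at_restart t m B" for B
    unfolding at_restart_def by blast
  have 1: "(\<lambda>j. measure W (F \<inter> (?D j \<inter> B (grid m (Suc j))))) sums measure W (F \<inter> at_restart t m B)" if "\<And>u. B u \<in> sets W" for B
    unfolding U[symmetric]
  proof (rule W.finite_measure_UNION[OF _ disj])
    have "F \<inter> (?D j \<inter> B (grid m (Suc j))) \<in> sets W" for j
      using sets.Int[OF FDW[of j] that[of "grid m (Suc j)"]] by (simp only: Int_assoc)
    then show "range (\<lambda>j. F \<inter> (?D j \<inter> B (grid m (Suc j)))) \<subseteq> sets W" by blast
  qed
  \<comment> \<open>On one cell past and future of its right end point factor; the factor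
    \<open>c\<close> is the same for all cells.\<close>
  have 2: "measure W (F \<inter> (?D j \<inter> C (grid m (Suc j)))) = c * measure W (F \<inter> (?D j \<inter> space W))" for j
  proof -
    have "measure W ((F \<inter> ?D j) \<inter> C (grid m (Suc j))) = measure W (F \<inter> ?D j) * c"
      using past_future_indep[OF FD C(1)] C(2) by (simp only:)
    moreover have "F \<inter> (?D j \<inter> space W) = F \<inter> ?D j" using sets.sets_into_space[OF FDW[of j]] by blast
    ultimately show ?thesis by (simp only: Int_assoc mult.commute)
  qed
  have "(\<lambda>j. c * measure W (F \<inter> (?D j \<inter> space W))) sums (c * measure W (F \<inter> at_restart t m (\<lambda>_. space W)))"
    by (intro sums_mult 1) auto
  with 1[of C, OF CW] show ?thesis unfolding 2 at_restart_UNIV[OF t] by (rule sums_unique2)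
qed

lemma at_restart_subset: "at_restart t m C \<subseteq> restarted_ever t"
  unfolding at_restart_def restarted_ever_def by blast

lemma at_restart_sets:
  assumes "0 \<le> t" "\<And>u. C u \<in> sets W"
  shows "at_restart t m C \<in> sets W"
  unfolding at_restart_def
  by (intro sets.countable_UN image_subsetI sets.Int sets.Diff restarted_sets assms)

lemma restarted_in_past: "0 \<le> t \<Longrightarrow> space W \<inter> restarted t u \<in> sets (increment_field W (-\<infinity>) (real_of_rat u))"
proof -
  assume "0 \<le> t"
  have "sets (increment_field W 0 (real_of_rat u)) \<subseteq> sets (increment_field W (-\<infinity>) (real_of_rat u))"
    by (rule increment_field_mono) auto
  then have "restarted t u \<in> sets (increment_field W (-\<infinity>) (real_of_rat u))"
    using restarted_meas[OF \<open>0 \<le> t\<close>, of u] by blast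
  moreover have "space W \<inter> restarted t u = restarted t u" unfolding restarted_def by blast
  ultimately show ?thesis by (simp only:)
qed

text \<open>By regeneration, given a restart, the oscillation of height \<open>1 / Suc k\<close> at
  the next grid point has probability \<open>\<pi> k\<close> for every mesh. Failure at all fine
  meshes thus has probability at most \<open>1 - \<pi> k\<close>, which tends to 0 in
  \<open>k\<close>; no monotonicity in the mesh is involved.\<close>

lemma AE_oscillates_at_restart:
  assumes t: "0 \<le> t"
  shows "AE \<omega> in W. \<omega> \<in> restarted_ever t \<longrightarrow> (\<exists>k. \<exists>\<^sub>F m in sequentially.
    \<omega> \<in> at_restart t m (\<lambda>u. {\<omega>\<in>space W. oscillates (1 / real (Suc n)) (1 / real (Suc k)) (of_rat u) \<omega>}))"
proof -
  define K where "K = (\<lambda>k m. at_restart t m (\<lambda>u. {\<omega>\<in>space W. oscillates (1 / real (Suc n)) (1 / real (Suc k)) (of_rat u) \<omega>}))"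
  define \<pi> where "\<pi> = (\<lambda>k. measure W {\<omega>\<in>space W. oscillates (1 / real (Suc n)) (1 / real (Suc k)) 0 \<omega>})"
  define bad where "bad = (\<lambda>k. restarted_ever t \<inter> (\<Union>M. \<Inter>m\<in>{M..}. space W - K k m))"
  have oF: "{\<omega>\<in>space W. oscillates \<rho> \<theta> u \<omega>} \<in> sets (increment_field W (ereal u) \<infinity>)" for \<rho> \<theta> u
    using pred_oscillates unfolding pred_def space_increment_field .
  have oW: "{\<omega>\<in>space W. oscillates \<rho> \<theta> u \<omega>} \<in> sets W" for \<rho> \<theta> u
    using oF sets_increment_field_subset by blast
  have KW: "K k m \<in> sets W" for k m unfolding K_def by (intro at_restart_sets t oW)
  have Km: "measure W (K k m) = \<pi> k * measure W (restarted_ever t)" for k m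
  proof -
    have "measure W (space W \<inter> K k m) = \<pi> k * measure W (space W \<inter> restarted_ever t)"
      unfolding K_def \<pi>_def by (intro regeneration t oF prob_oscillates_shift restarted_in_past sets.top)
    moreover have "space W \<inter> K k m = K k m" "space W \<inter> restarted_ever t = restarted_ever t"
      using sets.sets_into_space[OF KW[of k m]] sets.sets_into_space[OF restarted_sets(2)[OF t]] by blast+
    ultimately show ?thesis by (simp only:)
  qed
  have badW: "bad k \<in> sets W" for k unfolding bad_def
    by (intro sets.Int restarted_sets t sets.countable_UN image_subsetI sets.countable_INT sets.Diff sets.top KW) auto
  have bad: "measure W (bad k) \<le> 1 - \<pi> k" for k
  proof (rule LIMSEQ_le_const2)
    show "(\<lambda>m. measure W (bad k \<inter> (restarted_ever t - K k m))) \<longlonglongrightarrow> measure W (bad k)"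
    proof (rule W.measure_eventually_subset)
      show "AE \<omega> in W. \<omega> \<in> bad k \<longrightarrow> (\<forall>\<^sub>F m in sequentially. \<omega> \<in> restarted_ever t - K k m)"
        unfolding bad_def eventually_sequentially by (rule AE_I2) auto
    qed (intro badW sets.Diff KW restarted_sets t)+
    show "\<exists>N. \<forall>m\<ge>N. measure W (bad k \<inter> (restarted_ever t - K k m)) \<le> 1 - \<pi> k"
    proof (intro exI allI impI)
      fix m
      have "measure W (bad k \<inter> (restarted_ever t - K k m)) \<le> measure W (restarted_ever t - K k m)"
        by (intro W.finite_measure_mono sets.Diff KW restarted_sets t) auto
      also have "\<dots> = measure W (restarted_ever t) - measure W (K k m)"
        by (intro W.finite_measure_Diff KW restarted_sets t) (simp add: K_def at_restart_subset)
      also have "\<dots> = (1 - \<pi> k) * measure W (restarted_ever t)" unfolding Km by (simp add: algebra_simps)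
      also have "\<dots> \<le> (1 - \<pi> k) * 1" using W.prob_le_1 unfolding \<pi>_def by (intro mult_left_mono) auto
      finally show "measure W (bad k \<inter> (restarted_ever t - K k m)) \<le> 1 - \<pi> k" by simp
    qed
  qed
  have "measure W (\<Inter>k. bad k) \<le> 0"
  proof (rule LIMSEQ_le_const)
    have "\<pi> \<longlonglongrightarrow> 1" unfolding \<pi>_def by (intro prob_oscillates_tendsto) simp
    then show "(\<lambda>k. 1 - \<pi> k) \<longlonglongrightarrow> 0" using tendsto_diff[OF tendsto_const, of \<pi> 1 _ 1] by simp
    show "\<exists>N. \<forall>k\<ge>N. measure W (\<Inter>k. bad k) \<le> 1 - \<pi> k"
    proof (intro exI allI impI)
      fix k
      have "measure W (\<Inter>k. bad k) \<le> measure W (bad k)" by (intro W.finite_measure_mono badW) auto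
      then show "measure W (\<Inter>k. bad k) \<le> 1 - \<pi> k" using bad[of k] by linarith
    qed
  qed
  moreover have IW: "(\<Inter>k. bad k) \<in> sets W" by (intro sets.countable_INT image_subsetI badW) auto
  ultimately have "(\<Inter>k. bad k) \<in> null_sets W"
    by (auto simp: null_sets_def W.emeasure_eq_measure measure_le_0_iff)
  then have "AE \<omega> in W. \<omega> \<notin> (\<Inter>k. bad k)" by (rule AE_not_in)
  then show ?thesis using AE_space
  proof eventually_elim
    fix \<omega> assume "\<omega> \<notin> (\<Inter>k. bad k)" and w: "\<omega> \<in> space W"
    then obtain k where k: "\<omega> \<notin> bad k" by blast
    show "\<omega> \<in> restarted_ever t \<longrightarrow> (\<exists>k. \<exists>\<^sub>F m in sequentially.
      \<omega> \<in> at_restart t m (\<lambda>u. {\<omega>\<in>space W. oscillates (1 / real (Suc n)) (1 / real (Suc k)) (of_rat u) \<omega>}))"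
    proof (intro impI exI[of _ k])
      assume "\<omega> \<in> restarted_ever t"
      with k have "\<not> (\<exists>M. \<forall>m\<ge>M. \<omega> \<notin> K k m)" using w unfolding bad_def by auto
      then show "\<exists>\<^sub>F m in sequentially.
        \<omega> \<in> at_restart t m (\<lambda>u. {\<omega>\<in>space W. oscillates (1 / real (Suc n)) (1 / real (Suc k)) (of_rat u) \<omega>})"
        unfolding frequently_def eventually_sequentially K_def by blast
    qed
  qed
qed

section \<open>Pathwise limits at a restart time\<close>

lemma power_half_less: "0 < r \<Longrightarrow> \<exists>M. \<forall>m\<ge>M. 1 / 2 ^ m < (r::real)"
proof -
  assume "0 < r"
  have "(\<lambda>m. (1 / 2) ^ m) \<longlonglongrightarrow> (0::real)" by (rule LIMSEQ_realpow_zero) auto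
  then have "\<forall>\<^sub>F m in sequentially. (1 / 2) ^ m < r" using \<open>0 < r\<close> by (rule order_tendstoD(2))
  then show ?thesis unfolding eventually_sequentially by (simp add: power_divide)
qed

lemma continuous_path_delta:
  fixes \<omega> :: "real \<Rightarrow> real"
  assumes "continuous_on UNIV \<omega>" "0 < \<theta>"
  obtains d where "0 < d" "\<And>x. \<bar>x - T\<bar> < d \<Longrightarrow> \<bar>\<omega> x - \<omega> T\<bar> < (\<theta>::real)"
proof -
  from assms have "isCont \<omega> T" by (simp add: continuous_on_eq_continuous_at)
  then show thesis using that \<open>0 < \<theta>\<close> unfolding continuous_at_eps_delta dist_real_def by blast
qed

lemma in_at_restartD:
  assumes "\<omega> \<in> at_restart t m C" and T: "\<And>u. restarts (sel \<omega>) t u \<longleftrightarrow> T < real_of_rat u"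
  obtains u where "\<omega> \<in> C u" "T < of_rat u" "of_rat u \<le> T + 1 / 2 ^ m"
proof -
  from assms obtain j where j: "\<omega> \<in> restarted t (grid m (Suc j))" "\<omega> \<notin> restarted t (grid m j)" "\<omega> \<in> C (grid m (Suc j))"
    unfolding at_restart_def by blast
  then have "T < of_rat (grid m (Suc j))" "\<not> T < of_rat (grid m j)" using T unfolding restarted_def by blast+
  then show thesis using that j(3) grid_Suc[of m j] by auto
qed

text \<open>Arbitrarily close after \<open>T\<close> there are grid points from which the path moves
  both ways by a fixed height. By continuity the path starts there at nearly its value at
  \<open>T\<close>, so it passes strictly above and below that value near \<open>T\<close>.\<close>

lemma AE_restart_not_extremum:
  assumes t: "0 \<le> t"
  shows "AE \<omega> in W. \<omega> \<in> restarted_ever t \<longrightarrow> (\<forall>T. (\<forall>u. restarts (sel \<omega>) t u \<longleftrightarrow> T < real_of_rat u) \<longrightarrow> T \<notin> local_extrema \<omega>)"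
proof -
  have "AE \<omega> in W. \<forall>n. \<omega> \<in> restarted_ever t \<longrightarrow> (\<exists>k. \<exists>\<^sub>F m in sequentially.
    \<omega> \<in> at_restart t m (\<lambda>u. {\<omega>\<in>space W. oscillates (1 / real (Suc n)) (1 / real (Suc k)) (of_rat u) \<omega>}))"
    unfolding AE_all_countable using AE_oscillates_at_restart[OF t] by blast
  then show ?thesis using AE_regular
  proof eventually_elim
    fix \<omega>
    assume osc: "\<forall>n. \<omega> \<in> restarted_ever t \<longrightarrow> (\<exists>k. \<exists>\<^sub>F m in sequentially.
      \<omega> \<in> at_restart t m (\<lambda>u. {\<omega>\<in>space W. oscillates (1 / real (Suc n)) (1 / real (Suc k)) (of_rat u) \<omega>}))"
      and reg: "regular \<omega>"
    show "\<omega> \<in> restarted_ever t \<longrightarrow> (\<forall>T. (\<forall>u. restarts (sel \<omega>) t u \<longleftrightarrow> T < real_of_rat u) \<longrightarrow> T \<notin> local_extrema \<omega>)"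
    proof (intro impI allI notI)
      fix T assume r: "\<omega> \<in> restarted_ever t" and T: "\<forall>u. restarts (sel \<omega>) t u \<longleftrightarrow> T < real_of_rat u" and "T \<in> local_extrema \<omega>"
      then obtain e n where e: "e = 1 \<or> e = -1" and n: "\<And>y. \<bar>y - T\<bar> < 1 / real (Suc n) \<Longrightarrow> e * \<omega> y \<le> e * \<omega> T"
        unfolding local_extrema_iff extremum_at_def extremum_on_ball_def by blast
      \<comment> \<open>Half the radius: one half bounds the distance from \<open>T\<close> to the
        grid point, the other the offset of the oscillation.\<close>
      define n' where "n' = 2 * n + 1"
      have n': "1 / real (Suc n') + 1 / real (Suc n') = 1 / real (Suc n)" unfolding n'_def by (simp add: field_simps)
      obtain k where k: "\<exists>\<^sub>F m in sequentially.
        \<omega> \<in> at_restart t m (\<lambda>u. {\<omega>\<in>space W. oscillates (1 / real (Suc n')) (1 / real (Suc k)) (of_rat u) \<omega>})"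
        using osc r by blast
      have "continuous_on UNIV \<omega>" using reg unfolding regular_def by blast
      then obtain d where d: "0 < d" "\<And>x. \<bar>x - T\<bar> < d \<Longrightarrow> \<bar>\<omega> x - \<omega> T\<bar> < 1 / real (Suc k)"
        by (rule continuous_path_delta[of \<omega> "1 / real (Suc k)" T]) auto
      obtain M where M: "\<And>m. M \<le> m \<Longrightarrow> 1 / 2 ^ m < min d (1 / real (Suc n'))"
        using power_half_less[of "min d (1 / real (Suc n'))"] d by auto
      obtain m where m: "M \<le> m" "\<omega> \<in> at_restart t m (\<lambda>u. {\<omega>\<in>space W. oscillates (1 / real (Suc n')) (1 / real (Suc k)) (of_rat u) \<omega>})"
        using k unfolding frequently_def eventually_sequentially by blast
      obtain u where u: "oscillates (1 / real (Suc n')) (1 / real (Suc k)) (of_rat u) \<omega>" "T < of_rat u" "of_rat u \<le> T + 1 / 2 ^ m"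
        using in_at_restartD[OF m(2)] T by blast
      have "\<bar>of_rat u - T\<bar> < d" using u M[OF m(1)] by linarith
      from d(2)[OF this] have cl: "\<bar>\<omega> (of_rat u) - \<omega> T\<bar> < 1 / real (Suc k)" .
      have "\<exists>q::rat. 0 < q \<and> of_rat q < 1 / real (Suc n') \<and> 1 / real (Suc k) < e * (\<omega> (of_rat u + of_rat q) - \<omega> (of_rat u))"
        using u(1) e unfolding oscillates_def by auto
      then obtain q :: rat where q: "0 < q" "of_rat q < 1 / real (Suc n')" "1 / real (Suc k) < e * (\<omega> (of_rat u + of_rat q) - \<omega> (of_rat u))"
        by blast
      have "(0::real) < of_rat q" using q by simp
      then have "\<bar>of_rat u + of_rat q - T\<bar> < 1 / real (Suc n)" using u q(2) n' M[OF m(1)] by linarith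
      from n[OF this] show False using q(3) cl e by auto
    qed
  qed
qed

text \<open>For fine meshes the grid point after \<open>T\<close> falls into the interval beyond
  \<open>T\<close> on which \<open>first_long_start_restart\<close> identifies the two
  starts.\<close>

lemma first_long_type_restart:
  assumes reg: "regular \<omega>" and w: "\<omega> \<in> restarted_ever t" "0 \<le> t" "0 < \<delta>" "\<omega> \<in> space W"
    and ne: "\<forall>T. (\<forall>u. restarts (sel \<omega>) t u \<longleftrightarrow> T < real_of_rat u) \<longrightarrow> T \<notin> local_extrema \<omega>"
  shows "\<forall>\<^sub>F m in sequentially. \<omega> \<in> at_restart t m (\<lambda>u. {\<omega>\<in>space W. first_long_type \<delta> u (of_rat u) e \<omega>}) \<longleftrightarrow> first_long_type \<delta> 0 t e \<omega>"
proof -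
  interpret nested_selection "sel \<omega>" using reg unfolding regular_def by blast
  obtain u0 where "restarts (sel \<omega>) t u0" using w unfolding restarted_ever_def restarted_def by blast
  then obtain T where T: "t \<le> T" "\<And>u. restarts (sel \<omega>) t u \<longleftrightarrow> T < real_of_rat u" using restart_time w by blast
  have "sel \<omega> 0 y \<noteq> T" if "0 < y" for y using ne T(2) reg that unfolding regular_def by metis
  then obtain \<epsilon> where \<epsilon>: "0 < \<epsilon>"
    "\<And>u x. T < of_rat u \<Longrightarrow> of_rat u < T + \<epsilon> \<Longrightarrow>
      first_long_start (sel \<omega>) \<delta> 0 t x \<longleftrightarrow> first_long_start (sel \<omega>) \<delta> u (of_rat u) x"
    using first_long_start_restart[OF T(2) w(2) T(1) w(3)] by blast
  obtain M where M: "\<And>m. M \<le> m \<Longrightarrow> 1 / 2 ^ m < \<epsilon>" using power_half_less[OF \<epsilon>(1)] by blast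
  have eq: "first_long_type \<delta> u (of_rat u) e \<omega> \<longleftrightarrow> first_long_type \<delta> 0 t e \<omega>"
    if "T < of_rat u" "of_rat u \<le> T + 1 / 2 ^ m" "M \<le> m" for u m
    unfolding first_long_type_def using \<epsilon>(2)[of u] that M[of m] by auto
  have "\<omega> \<in> at_restart t m (\<lambda>u. {\<omega>\<in>space W. first_long_type \<delta> u (of_rat u) e \<omega>}) \<longleftrightarrow> first_long_type \<delta> 0 t e \<omega>"
    if m: "M \<le> m" for m
  proof
    assume "\<omega> \<in> at_restart t m (\<lambda>u. {\<omega>\<in>space W. first_long_type \<delta> u (of_rat u) e \<omega>})"
    then obtain u where "\<omega> \<in> {\<omega>\<in>space W. first_long_type \<delta> u (of_rat u) e \<omega>}" "T < of_rat u" "of_rat u \<le> T + 1 / 2 ^ m"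
      by (rule in_at_restartD[OF _ T(2)])
    then show "first_long_type \<delta> 0 t e \<omega>" using eq m by blast
  next
    assume f: "first_long_type \<delta> 0 t e \<omega>"
    have "\<omega> \<in> at_restart t m (\<lambda>_. space W)" using w(1) at_restart_UNIV[OF w(2)] by blast
    then obtain j where j: "\<omega> \<in> restarted t (grid m (Suc j))" "\<omega> \<notin> restarted t (grid m j)" unfolding at_restart_def by blast
    then have "T < of_rat (grid m (Suc j))" "\<not> T < of_rat (grid m j)" using T(2) w(4) unfolding restarted_def by blast+
    then have "first_long_type \<delta> (grid m (Suc j)) (of_rat (grid m (Suc j))) e \<omega>"
      using eq[of "grid m (Suc j)" m] f m grid_Suc[of m j] by auto
    then show "\<omega> \<in> at_restart t m (\<lambda>u. {\<omega>\<in>space W. first_long_type \<delta> u (of_rat u) e \<omega>})"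
      unfolding at_restart_def using j w(4) by blast
  qed
  then show ?thesis unfolding eventually_sequentially by blast
qed

lemma first_long_type_sets: "{\<omega>\<in>space W. first_long_type \<delta> (b::rat) t e \<omega>} \<in> sets W"
  using first_long_type_set sets_increment_field_subset by blast

text \<open>The discretised identity has a right side that does not depend on the mesh, and its left
  side converges to the one for the restart itself.\<close>

lemma first_long_type_regeneration:
  assumes t: "0 \<le> t" and \<delta>: "0 < \<delta>"
    and F: "F \<in> sets W" "\<And>u. F \<inter> restarted t u \<in> sets (increment_field W (-\<infinity>) (real_of_rat u))"
  shows "measure W (F \<inter> restarted_ever t \<inter> {\<omega>\<in>space W. first_long_type \<delta> 0 t e \<omega>}) =
    measure W {\<omega>\<in>space W. first_long_type \<delta> 0 0 e \<omega>} * measure W (F \<inter> restarted_ever t)"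
proof (rule LIMSEQ_unique)
  let ?C = "\<lambda>u. {\<omega>\<in>space W. first_long_type \<delta> u (of_rat u) e \<omega>}"
  have "measure W (F \<inter> at_restart t m ?C) = measure W {\<omega>\<in>space W. first_long_type \<delta> 0 0 e \<omega>} * measure W (F \<inter> restarted_ever t)" for m
    by (intro regeneration t F first_long_type_set prob_first_long_type_shift)
  then show "(\<lambda>m. measure W (F \<inter> at_restart t m ?C)) \<longlonglongrightarrow> measure W {\<omega>\<in>space W. first_long_type \<delta> 0 0 e \<omega>} * measure W (F \<inter> restarted_ever t)"
    by simp
  show "(\<lambda>m. measure W (F \<inter> at_restart t m ?C)) \<longlonglongrightarrow> measure W (F \<inter> restarted_ever t \<inter> {\<omega>\<in>space W. first_long_type \<delta> 0 t e \<omega>})"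
  proof (rule W.measure_tendsto_AE)
    show "AE \<omega> in W. \<forall>\<^sub>F m in sequentially. \<omega> \<in> F \<inter> at_restart t m ?C \<longleftrightarrow> \<omega> \<in> F \<inter> restarted_ever t \<inter> {\<omega>\<in>space W. first_long_type \<delta> 0 t e \<omega>}"
      using AE_regular AE_restart_not_extremum[OF t] AE_space
    proof eventually_elim
      fix \<omega> assume a: "regular \<omega>" "\<omega> \<in> space W"
        "\<omega> \<in> restarted_ever t \<longrightarrow> (\<forall>T. (\<forall>u. restarts (sel \<omega>) t u \<longleftrightarrow> T < real_of_rat u) \<longrightarrow> T \<notin> local_extrema \<omega>)"
      show "\<forall>\<^sub>F m in sequentially. \<omega> \<in> F \<inter> at_restart t m ?C \<longleftrightarrow> \<omega> \<in> F \<inter> restarted_ever t \<inter> {\<omega>\<in>space W. first_long_type \<delta> 0 t e \<omega>}"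
      proof (cases "\<omega> \<in> restarted_ever t")
        case True
        then have "\<forall>\<^sub>F m in sequentially. \<omega> \<in> at_restart t m ?C \<longleftrightarrow> first_long_type \<delta> 0 t e \<omega>"
          using a t \<delta> by (intro first_long_type_restart) blast+
        then show ?thesis by eventually_elim (use True a in blast)
      next
        case False
        then show ?thesis using at_restart_subset by (intro always_eventually allI) blast
      qed
    qed
    show "F \<inter> restarted_ever t \<inter> {\<omega>\<in>space W. first_long_type \<delta> 0 t e \<omega>} \<in> sets W"
      by (intro sets.Int F restarted_sets t first_long_type_sets)
    show "F \<inter> at_restart t m ?C \<in> sets W" for m
      by (intro sets.Int F at_restart_sets t first_long_type_sets)
  qed
qed

end

section \<open>The type of the first long record\<close>

text \<open>The test that separates the types, using only the path up to \<open>t\<close>. A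
  positive height \<open>h\<close> makes it stable when \<open>t\<close> merely approximates the
  extremum from the left.\<close>

definition falls_below :: "real \<Rightarrow> real \<Rightarrow> real \<Rightarrow> (real \<Rightarrow> real) \<Rightarrow> bool" where
  "falls_below \<rho> h t \<omega> \<longleftrightarrow> (\<exists>q::rat. (0 < q \<and> of_rat q < \<rho>) \<and> h < \<omega> t - \<omega> (t - of_rat q))"

lemma pred_falls_below:
  assumes "t \<le> t'"
  shows "Measurable.pred (increment_field W (-\<infinity>) (ereal t')) (falls_below \<rho> h t)"
  unfolding falls_below_def using assms
  by (intro pred_intros_countable pred_intros_conj1' borel_measurable_pred_less
      increment_meas_increment_field borel_measurable_const) auto

context honest_wiener begin

definition calm :: "real \<Rightarrow> real \<Rightarrow> (real \<Rightarrow> real) set" where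
  "calm \<delta> t = {\<omega>\<in>space W. no_long_start (sel \<omega>) \<delta> t}"

definition long_type :: "real \<Rightarrow> real \<Rightarrow> (real \<Rightarrow> real) set" where
  "long_type \<delta> e = {\<omega>\<in>space W. first_long_type \<delta> 0 0 e \<omega>}"

lemma long_type_sets: "long_type \<delta> e \<in> sets W"
  unfolding long_type_def by (rule first_long_type_sets)

lemma calm_sets: "calm \<delta> t \<in> sets W"
proof -
  have "(\<lambda>\<omega>. sel \<omega> 0 y) \<in> borel_measurable W" if "0 < y" for y
    using measurable_increment_field_W[OF sel_meas[OF that]] .
  then have "Measurable.pred W (\<lambda>\<omega>. no_long_start (sel \<omega>) \<delta> t)"
    unfolding no_long_start_def
    by (intro pred_intros_countable pred_intros_imp' pred_intros_logic borel_measurable_pred_le borel_measurable_add borel_measurable_const)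
  then show ?thesis unfolding calm_def pred_def .
qed

lemma calm_antimono: "s \<le> t \<Longrightarrow> calm \<delta> t \<subseteq> calm \<delta> s"
  unfolding calm_def using no_long_start_antimono by blast

text \<open>Calmness at \<open>t\<close> may depend on the path after \<open>t\<close> through a
  record that still persists. Together with a restart before \<open>u\<close> it is decided by
  indices before \<open>u\<close>, which is the measurability that regeneration requires.\<close>

lemma calm_before_restart:
  assumes t: "0 \<le> t" and F: "F \<in> sets (increment_field W (-\<infinity>) (ereal t))"
  shows "F \<inter> calm \<delta> t \<inter> restarted t u \<in> sets (increment_field W (-\<infinity>) (real_of_rat u))"
proof (cases "t < of_rat u")
  \<comment> \<open>Restart indices exceed \<open>t\<close>, so none precedes a \<open>u\<close> at
    or before \<open>t\<close>.\<close>
  case False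
  have "restarted t u = {}"
  proof -
    have "\<not> (t < of_rat y \<and> y < u)" for y
    proof
      assume a: "t < of_rat y \<and> y < u"
      then have "real_of_rat y < of_rat u" by (simp add: of_rat_less)
      then show False using a False by linarith
    qed
    then show ?thesis unfolding restarted_def restarts_def by blast
  qed
  then show ?thesis by simp
next
  case True
  have FF: "F \<in> sets (increment_field W (-\<infinity>) (real_of_rat u))"
    using F increment_field_mono[of "-\<infinity>" "-\<infinity>" "ereal t" "ereal (of_rat u)"] True by auto
  have R: "restarted t u \<in> sets (increment_field W (-\<infinity>) (real_of_rat u))"
    using restarted_meas[OF t, of u] increment_field_mono[of "-\<infinity>" 0 "real_of_rat u" "real_of_rat u"] by auto
  define Q where "Q = (\<lambda>\<omega>. \<forall>y. (0 < y \<and> y < u) \<longrightarrow> (sel \<omega> 0 y \<le> t \<longrightarrow> of_rat y \<le> sel \<omega> 0 y + \<delta>))"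
  have m: "(\<lambda>\<omega>. sel \<omega> 0 y) \<in> borel_measurable (increment_field W (-\<infinity>) (real_of_rat u))" if "0 < y \<and> y < u" for y
    using that by (intro sel_meas_mono) (auto simp: of_rat_less_eq)
  have "Measurable.pred (increment_field W (-\<infinity>) (real_of_rat u)) Q"
    unfolding Q_def
    by (intro pred_intros_countable pred_intros_imp' pred_intros_logic borel_measurable_pred_le borel_measurable_add borel_measurable_const m)
  then have Qs: "{\<omega>\<in>space W. Q \<omega>} \<in> sets (increment_field W (-\<infinity>) (real_of_rat u))"
    unfolding pred_def space_increment_field .
  have E: "F \<inter> restarted t u \<inter> {\<omega>\<in>space W. Q \<omega>} \<in> sets (increment_field W (-\<infinity>) (real_of_rat u))"
    by (intro sets.Int FF R Qs)
  have "F \<in> sets W" using F sets_increment_field_subset by blast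
  then have S: "F \<inter> calm \<delta> t \<inter> restarted t u \<in> sets W"
    by (intro sets.Int calm_sets restarted_sets t)
  have "AE \<omega> in W. \<omega> \<in> F \<inter> restarted t u \<inter> {\<omega>\<in>space W. Q \<omega>} \<longleftrightarrow> \<omega> \<in> F \<inter> calm \<delta> t \<inter> restarted t u"
    using AE_regular AE_space
  proof eventually_elim
    fix \<omega> assume reg: "regular \<omega>" and w: "\<omega> \<in> space W"
    interpret nested_selection "sel \<omega>" using reg unfolding regular_def by blast
    have "Q \<omega> \<longleftrightarrow> no_long_start (sel \<omega>) \<delta> t" if "restarts (sel \<omega>) t u"
      unfolding Q_def no_long_start_iff_before_restart[OF that t] ..
    then show "\<omega> \<in> F \<inter> restarted t u \<inter> {\<omega>\<in>space W. Q \<omega>} \<longleftrightarrow> \<omega> \<in> F \<inter> calm \<delta> t \<inter> restarted t u"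
      using w unfolding restarted_def calm_def by blast
  qed
  from increment_field_AE_cong[OF E S sets_increment_field_subset this] show ?thesis .
qed

text \<open>On calm paths a restart occurs almost surely, and the first long record beyond
  \<open>t\<close> is the first one overall. Regeneration applied to
  \<open>F \<inter> calm \<delta> t\<close> then gives the product.\<close>

lemma long_type_indep:
  assumes t: "0 \<le> t" and \<delta>: "0 < \<delta>" and F: "F \<in> sets (increment_field W (-\<infinity>) (ereal t))"
  shows "measure W (F \<inter> calm \<delta> t \<inter> long_type \<delta> e) = measure W (long_type \<delta> e) * measure W (F \<inter> calm \<delta> t)"
proof -
  have FW: "F \<in> sets W" using F sets_increment_field_subset by blast
  have FC: "F \<inter> calm \<delta> t \<in> sets W" by (intro sets.Int FW calm_sets)
  let ?L = "{\<omega>\<in>space W. first_long_type \<delta> 0 t e \<omega>}"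
  have eq: "measure W (F \<inter> calm \<delta> t \<inter> restarted_ever t \<inter> ?L) = measure W (long_type \<delta> e) * measure W (F \<inter> calm \<delta> t \<inter> restarted_ever t)"
    unfolding long_type_def by (intro first_long_type_regeneration t \<delta> FC calm_before_restart F)
  have ae: "AE \<omega> in W. \<omega> \<in> calm \<delta> t \<longrightarrow> \<omega> \<in> restarted_ever t \<and> (\<omega> \<in> ?L \<longleftrightarrow> \<omega> \<in> long_type \<delta> e)"
    using AE_regular AE_space
  proof eventually_elim
    fix \<omega> assume reg: "regular \<omega>" and w: "\<omega> \<in> space W"
    interpret nested_selection "sel \<omega>" using reg unfolding regular_def by blast
    show "\<omega> \<in> calm \<delta> t \<longrightarrow> \<omega> \<in> restarted_ever t \<and> (\<omega> \<in> ?L \<longleftrightarrow> \<omega> \<in> long_type \<delta> e)"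
    proof
      assume "\<omega> \<in> calm \<delta> t"
      then have n: "no_long_start (sel \<omega>) \<delta> t" unfolding calm_def by blast
      show "\<omega> \<in> restarted_ever t \<and> (\<omega> \<in> ?L \<longleftrightarrow> \<omega> \<in> long_type \<delta> e)"
        using no_long_start_restarts[OF n t] first_long_start_no_long_start[OF n t] w
        unfolding restarted_ever_def restarted_def long_type_def first_long_type_def by blast
    qed
  qed
  have "measure W (F \<inter> calm \<delta> t \<inter> restarted_ever t) = measure W (F \<inter> calm \<delta> t)"
    by (rule W.finite_measure_eq_AE) (use ae in eventually_elim, blast, intro sets.Int FC restarted_sets t, rule FC)
  moreover have "measure W (F \<inter> calm \<delta> t \<inter> restarted_ever t \<inter> ?L) = measure W (F \<inter> calm \<delta> t \<inter> long_type \<delta> e)"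
    by (rule W.finite_measure_eq_AE) (use ae in eventually_elim, blast, intro sets.Int FC restarted_sets t first_long_type_sets, intro sets.Int FC long_type_sets)
  ultimately show ?thesis using eq by (simp only:)
qed

text \<open>
  The test \<open>V\<close> is evaluated at the last grid point before the first long record, which is the
  grid point at which the path ceases to be calm.
\<close>

definition before_first :: "real \<Rightarrow> nat \<Rightarrow> (real \<Rightarrow> (real \<Rightarrow> real) \<Rightarrow> bool) \<Rightarrow> (real \<Rightarrow> real) set" where
  "before_first \<delta> n V = (\<Union>k. {\<omega>\<in>space W. V (of_rat (grid n k)) \<omega>} \<inter> (calm \<delta> (of_rat (grid n k)) - calm \<delta> (of_rat (grid n (Suc k)))))"

lemma grid_nonneg: "0 \<le> real_of_rat (grid n k)"
  unfolding grid_def by simp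

lemma grid_le_Suc: "real_of_rat (grid n k) \<le> of_rat (grid n (Suc k))"
  by (simp add: grid_Suc)

text \<open>Each piece is a difference of two events that factor, one calm at the left and one at
  the right end of the cell. \<open>V\<close> must therefore also be measurable at the later time,
  whence the \<open>t'\<close> in its assumption.\<close>

lemma before_first_indep:
  assumes \<delta>: "0 < \<delta>"
    and V: "\<And>t t'. t \<le> t' \<Longrightarrow> Measurable.pred (increment_field W (-\<infinity>) (ereal t')) (V t)"
  shows "before_first \<delta> n V \<in> sets W"
    and "measure W (before_first \<delta> n V \<inter> long_type \<delta> e) = measure W (long_type \<delta> e) * measure W (before_first \<delta> n V)"
proof -
  let ?t = "\<lambda>k. real_of_rat (grid n k)"
  let ?V = "\<lambda>k. {\<omega>\<in>space W. V (?t k) \<omega>}"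
  let ?D = "\<lambda>k. ?V k \<inter> (calm \<delta> (?t k) - calm \<delta> (?t (Suc k)))"
  have VF: "?V k \<in> sets (increment_field W (-\<infinity>) (ereal t'))" if "?t k \<le> t'" for k t'
    using V[OF that] unfolding pred_def space_increment_field .
  have VW: "?V k \<in> sets W" for k using VF[OF order_refl] sets_increment_field_subset by blast
  have DW: "?D k \<in> sets W" for k by (intro sets.Int sets.Diff VW calm_sets)
  then show "before_first \<delta> n V \<in> sets W" unfolding before_first_def by (intro sets.countable_UN image_subsetI)
  have D: "measure W (?D k \<inter> long_type \<delta> e) = measure W (long_type \<delta> e) * measure W (?D k)" for k
  proof -
    have sub: "calm \<delta> (?t (Suc k)) \<subseteq> calm \<delta> (?t k)" by (intro calm_antimono grid_le_Suc)
    have 1: "measure W (?V k \<inter> calm \<delta> (?t k) \<inter> long_type \<delta> e) = measure W (long_type \<delta> e) * measure W (?V k \<inter> calm \<delta> (?t k))"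
      by (intro long_type_indep grid_nonneg \<delta> VF order_refl)
    have 2: "measure W (?V k \<inter> calm \<delta> (?t (Suc k)) \<inter> long_type \<delta> e) = measure W (long_type \<delta> e) * measure W (?V k \<inter> calm \<delta> (?t (Suc k)))"
      by (intro long_type_indep grid_nonneg \<delta> VF grid_le_Suc)
    have "measure W (?D k) = measure W (?V k \<inter> calm \<delta> (?t k) - ?V k \<inter> calm \<delta> (?t (Suc k)))"
      by (rule arg_cong[where f="measure W"]) blast
    also have "\<dots> = measure W (?V k \<inter> calm \<delta> (?t k)) - measure W (?V k \<inter> calm \<delta> (?t (Suc k)))"
      using sub by (intro W.finite_measure_Diff sets.Int VW calm_sets) blast
    finally have 3: "measure W (?D k) = measure W (?V k \<inter> calm \<delta> (?t k)) - measure W (?V k \<inter> calm \<delta> (?t (Suc k)))" .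
    have "measure W (?D k \<inter> long_type \<delta> e) = measure W (?V k \<inter> calm \<delta> (?t k) \<inter> long_type \<delta> e - ?V k \<inter> calm \<delta> (?t (Suc k)) \<inter> long_type \<delta> e)"
      by (rule arg_cong[where f="measure W"]) blast
    also have "\<dots> = measure W (?V k \<inter> calm \<delta> (?t k) \<inter> long_type \<delta> e) - measure W (?V k \<inter> calm \<delta> (?t (Suc k)) \<inter> long_type \<delta> e)"
      using sub by (intro W.finite_measure_Diff sets.Int VW calm_sets long_type_sets) blast
    finally show ?thesis unfolding 1 2 3 by (simp only: right_diff_distrib)
  qed
  have disj: "disjoint_family (\<lambda>k. ?D k \<inter> B)" for B
    unfolding disjoint_family_on_def
  proof (intro ballI impI)
    fix i j :: nat assume "i \<noteq> j"
    have *: "calm \<delta> (?t j) \<subseteq> calm \<delta> (?t (Suc i))" if "i < j" for i j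
      using that grid_mono[of "Suc i" j n] by (intro calm_antimono) (simp add: of_rat_less_eq)
    from \<open>i \<noteq> j\<close> consider "i < j" | "j < i" by linarith
    then show "?D i \<inter> B \<inter> (?D j \<inter> B) = {}"
      using *[of i j] *[of j i] by cases blast+
  qed
  have s: "(\<lambda>k. measure W (?D k \<inter> B)) sums measure W (before_first \<delta> n V \<inter> B)" if "B \<in> sets W" for B
  proof -
    have "(\<lambda>k. measure W (?D k \<inter> B)) sums measure W (\<Union>k. ?D k \<inter> B)"
      by (intro W.finite_measure_UNION disj image_subsetI sets.Int[OF DW that])
    moreover have "(\<Union>k. ?D k \<inter> B) = before_first \<delta> n V \<inter> B" unfolding before_first_def by blast
    ultimately show ?thesis by (simp only:)
  qed
  have sp: "?D k \<inter> space W = ?D k" "before_first \<delta> n V \<inter> space W = before_first \<delta> n V" for k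
    unfolding before_first_def by blast+
  have "(\<lambda>k. measure W (long_type \<delta> e) * measure W (?D k)) sums (measure W (long_type \<delta> e) * measure W (before_first \<delta> n V))"
    using sums_mult[OF s[OF sets.top], of "measure W (long_type \<delta> e)"] unfolding sp .
  then show "measure W (before_first \<delta> n V \<inter> long_type \<delta> e) = measure W (long_type \<delta> e) * measure W (before_first \<delta> n V)"
    by (rule sums_unique2[OF s[OF long_type_sets[of \<delta> e], unfolded D]])
qed

section \<open>Pathwise behaviour of the tests at maxima and at minima\<close>

lemma mem_before_first_iff:
  assumes reg: "regular \<omega>" and w: "\<omega> \<in> space W" and g: "first_long_start (sel \<omega>) \<delta> 0 0 g"
  shows "\<omega> \<in> before_first \<delta> n V \<longleftrightarrow>
    (\<exists>k. V (of_rat (grid n k)) \<omega> \<and> of_rat (grid n k) < g \<and> g \<le> of_rat (grid n (Suc k)))"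
proof -
  interpret nested_selection "sel \<omega>" using reg unfolding regular_def by blast
  show ?thesis unfolding before_first_def calm_def using no_long_start_iff[OF g] w by (auto simp: not_less)
qed

lemma grid_cell:
  fixes g :: real
  assumes "0 < g"
  obtains k where "of_rat (grid n k) < g" "g \<le> of_rat (grid n (Suc k))"
proof -
  obtain u :: rat where u: "g < of_rat u" using of_rat_dense[of g "g + 1"] by auto
  obtain j0 where "u \<le> grid n j0" using grid_unbounded by blast
  then have "real_of_rat u \<le> of_rat (grid n j0)" by (simp add: of_rat_less_eq)
  then have j0: "g \<le> of_rat (grid n j0)" using u by linarith
  define j where "j = (LEAST j. g \<le> of_rat (grid n j))"
  have j: "g \<le> of_rat (grid n j)" unfolding j_def using j0 by (rule LeastI)
  moreover have "real_of_rat (grid n 0) = 0" unfolding grid_def by simp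
  ultimately obtain k where k: "j = Suc k" using assms by (cases j) auto
  have "\<not> g \<le> of_rat (grid n k)" using not_less_Least[of k "\<lambda>j. g \<le> of_rat (grid n j)"] k unfolding j_def by auto
  then have "of_rat (grid n k) < g" by linarith
  then show thesis using that[of k] j k by blast
qed

text \<open>Near a minimum no value lies below that at \<open>g\<close>, and values at grid points
  approach it, so a drop of fixed height is impossible on fine grids.\<close>

lemma eventually_not_before_first:
  assumes reg: "regular \<omega>" and w: "\<omega> \<in> space W" and g: "first_long_start (sel \<omega>) \<delta> 0 0 g"
    and m: "extremum_on_ball (-1) n0 \<omega> g" and l: "2 * n0 + 1 \<le> l"
  shows "\<forall>\<^sub>F n in sequentially. \<omega> \<notin> before_first \<delta> n (falls_below (1 / real (Suc l)) (1 / real (Suc i)))"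
proof -
  have c: "continuous_on UNIV \<omega>" using w by (rule continuous_path)
  \<comment> \<open>The ball must hold both the gap between grid point and \<open>g\<close> and the
    offset of the test, each below half its radius.\<close>
  have "1 / real (Suc (2 * n0 + 1)) + 1 / real (Suc (2 * n0 + 1)) = 1 / real (Suc n0)" by (simp add: field_simps)
  then have l2: "1 / real (Suc l) + 1 / real (Suc l) \<le> 1 / real (Suc n0)" using inverse_Suc_antimono[OF l] by linarith
  obtain d where d: "0 < d" "\<And>x. \<bar>x - g\<bar> < d \<Longrightarrow> \<bar>\<omega> x - \<omega> g\<bar> < 1 / real (Suc i)"
    by (rule continuous_path_delta[OF c, of "1 / real (Suc i)" g]) auto
  obtain M where M: "\<And>n. M \<le> n \<Longrightarrow> 1 / 2 ^ n < min d (1 / real (Suc l))"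
    using power_half_less[of "min d (1 / real (Suc l))"] d by auto
  have "\<omega> \<notin> before_first \<delta> n (falls_below (1 / real (Suc l)) (1 / real (Suc i)))" if n: "M \<le> n" for n
  proof
    assume "\<omega> \<in> before_first \<delta> n (falls_below (1 / real (Suc l)) (1 / real (Suc i)))"
    then obtain k where k: "falls_below (1 / real (Suc l)) (1 / real (Suc i)) (of_rat (grid n k)) \<omega>"
      "of_rat (grid n k) < g" "g \<le> of_rat (grid n (Suc k))"
      unfolding mem_before_first_iff[OF reg w g] by blast
    define t where "t = real_of_rat (grid n k)"
    have t: "t < g" "g \<le> t + 1 / 2 ^ n" using k grid_Suc[of n k] unfolding t_def by auto
    obtain q :: rat where q: "0 < q" "of_rat q < 1 / real (Suc l)" "1 / real (Suc i) < \<omega> t - \<omega> (t - of_rat q)"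
      using k(1) unfolding falls_below_def t_def by blast
    have "(0::real) < of_rat q" using q by simp
    then have "\<bar>t - of_rat q - g\<bar> < 1 / real (Suc n0)" using t q(2) M[OF n] l2 by linarith
    then have "\<omega> g \<le> \<omega> (t - of_rat q)" using m unfolding extremum_on_ball_def by auto
    moreover have "\<bar>t - g\<bar> < d" using t M[OF n] by linarith
    then have "\<bar>\<omega> t - \<omega> g\<bar> < 1 / real (Suc i)" by (rule d(2))
    ultimately show False using q(3) by linarith
  qed
  then show ?thesis unfolding eventually_sequentially by blast
qed

lemma maximum_falls_below:
  fixes \<rho> :: real
  assumes reg: "regular \<omega>" and e: "extremum_at 1 \<omega> g" and "0 < \<rho>"
  shows "\<exists>q::rat. 0 < q \<and> of_rat q < \<rho> \<and> \<omega> (g - of_rat q) < \<omega> g"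
proof (rule ccontr)
  assume neg: "\<not> ?thesis"
  obtain n where n: "\<And>y. \<bar>y - g\<bar> < 1 / real (Suc n) \<Longrightarrow> \<omega> y \<le> \<omega> g"
    using e unfolding extremum_at_def extremum_on_ball_def by auto
  define r where "r = min \<rho> (1 / real (Suc n))"
  have r: "0 < r" "r \<le> \<rho>" "r \<le> 1 / real (Suc n)" unfolding r_def using assms by auto
  have eq: "\<omega> (g - of_rat q) = \<omega> g" if "0 < q" "of_rat q < r" for q :: rat
  proof (rule antisym)
    have "(0::real) < of_rat q" using that by simp
    then have "\<bar>g - of_rat q - g\<bar> < 1 / real (Suc n)" using that(2) r by linarith
    then show "\<omega> (g - of_rat q) \<le> \<omega> g" by (rule n)
    have "of_rat q < \<rho>" using that r by linarith
    then show "\<omega> g \<le> \<omega> (g - of_rat q)" using neg that(1) by (meson not_le)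
  qed
  obtain u :: rat where u: "g - r < of_rat u" "of_rat u < g" using of_rat_dense[of "g - r" g] r by auto
  have le: "\<omega> y \<le> \<omega> g" if "g - r < y" "y < g" for y using n[of y] that r by auto
  obtain m where m: "1 / real (Suc m) < g - of_rat u" using inverse_Suc_less[of "g - of_rat u"] u by auto
  have "oscillates (1 / real (Suc m)) 0 (of_rat u) \<omega>" using reg unfolding regular_def by blast
  then obtain q q' :: rat where q: "0 < q" "of_rat q < 1 / real (Suc m)" "0 < \<omega> (of_rat u + of_rat q) - \<omega> (of_rat u)"
    unfolding oscillates_def by blast
  have pos: "(0::real) < of_rat q" using q by simp
  have cont: "continuous_on UNIV \<omega>" using reg unfolding regular_def by blast
  have up: "\<omega> (of_rat u + of_rat q) \<le> \<omega> g" using le[of "of_rat u + of_rat q"] u q(2) pos m by linarith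
  then have gt: "\<omega> (of_rat u) < \<omega> g" using q by linarith
  obtain d where d: "0 < d" "\<And>x. \<bar>x - of_rat u\<bar> < d \<Longrightarrow> \<bar>\<omega> x - \<omega> (of_rat u)\<bar> < \<omega> g - \<omega> (of_rat u)"
    by (rule continuous_path_delta[OF cont, of "\<omega> g - \<omega> (of_rat u)" "of_rat u"]) (use gt in auto)
  have "max 0 (g - of_rat u - d) < min r (g - of_rat u)" using u r d by auto
  \<comment> \<open>\<open>u\<close> is a rational time, \<open>p\<close> a rational distance from
    \<open>g\<close>. As \<open>g\<close> may be irrational, continuity leads from one to the
    other.\<close>
  then obtain p :: rat where p: "max 0 (g - of_rat u - d) < of_rat p" "of_rat p < min r (g - of_rat u)"
    using of_rat_dense by blast
  have "(0::real) < of_rat p" using p by linarith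
  then have p0: "0 < p" by simp
  have "\<bar>g - of_rat p - of_rat u\<bar> < d" using p by linarith
  from d(2)[OF this] have "\<omega> (g - of_rat p) < \<omega> g" by linarith
  moreover have "\<omega> (g - of_rat p) = \<omega> g" using p p0 by (intro eq) auto
  ultimately show False by simp
qed

text \<open>The path lies strictly lower somewhere within the window to the left of a maximum. A
  small height leaves room, and by continuity the same offset works for grid points close to
  \<open>g\<close>.\<close>

lemma eventually_before_first:
  assumes reg: "regular \<omega>" and w: "\<omega> \<in> space W" and g: "first_long_start (sel \<omega>) \<delta> 0 0 g"
    and m: "extremum_at 1 \<omega> g"
  shows "\<forall>\<^sub>F i in sequentially. \<forall>\<^sub>F n in sequentially. \<omega> \<in> before_first \<delta> n (falls_below (1 / real (Suc l)) (1 / real (Suc i)))"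
proof -
  interpret nested_selection "sel \<omega>" using reg unfolding regular_def by blast
  have g0: "0 < g" using first_long_start_pos[OF g] .
  have c: "isCont \<omega> z" for z using continuous_path[OF w] by (simp add: continuous_on_eq_continuous_at)
  obtain q :: rat where q: "0 < q" "of_rat q < 1 / real (Suc l)" "\<omega> (g - of_rat q) < \<omega> g"
    using maximum_falls_below[OF reg m, of "1 / real (Suc l)"] by auto
  obtain i0 where i0: "1 / real (Suc i0) < \<omega> g - \<omega> (g - of_rat q)" using inverse_Suc_less[of "\<omega> g - \<omega> (g - of_rat q)"] q by auto
  have "\<forall>\<^sub>F n in sequentially. \<omega> \<in> before_first \<delta> n (falls_below (1 / real (Suc l)) (1 / real (Suc i)))" if "i0 \<le> i" for i
  proof -
    have i: "1 / real (Suc i) < \<omega> g - \<omega> (g - of_rat q)" using i0 inverse_Suc_antimono[OF that] by linarith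
    have "isCont (\<lambda>t. \<omega> t - \<omega> (t - of_rat q)) g" by (intro continuous_intros c isCont_o2[OF _ c])
    then have "\<forall>\<^sub>F t in at g. 1 / real (Suc i) < \<omega> t - \<omega> (t - of_rat q)"
      using i unfolding isCont_def by (intro order_tendstoD(1))
    then obtain d where d: "0 < d" "\<And>t. t \<noteq> g \<Longrightarrow> \<bar>t - g\<bar> < d \<Longrightarrow> 1 / real (Suc i) < \<omega> t - \<omega> (t - of_rat q)"
      unfolding eventually_at dist_real_def by auto
    obtain M where M: "\<And>n. M \<le> n \<Longrightarrow> 1 / 2 ^ n < d" using power_half_less[OF d(1)] by blast
    have "\<omega> \<in> before_first \<delta> n (falls_below (1 / real (Suc l)) (1 / real (Suc i)))" if n: "M \<le> n" for n
    proof -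
      obtain k where k: "of_rat (grid n k) < g" "g \<le> of_rat (grid n (Suc k))" using grid_cell[OF g0] by blast
      have "\<bar>real_of_rat (grid n k) - g\<bar> < d" using k grid_Suc[of n k] M[OF n] by linarith
      then have "1 / real (Suc i) < \<omega> (of_rat (grid n k)) - \<omega> (of_rat (grid n k) - of_rat q)" using k by (intro d(2)) auto
      then have "falls_below (1 / real (Suc l)) (1 / real (Suc i)) (of_rat (grid n k)) \<omega>"
        unfolding falls_below_def using q by blast
      then show ?thesis unfolding mem_before_first_iff[OF reg w g] using k by blast
    qed
    then show ?thesis unfolding eventually_sequentially by blast
  qed
  then show ?thesis by (rule eventually_sequentiallyI)
qed

text \<open>The tests are independent of the type, yet in the limit they succeed on maxima and fail
  on minima. Hence one of the two types is null.\<close>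

lemma long_types_exclusive:
  assumes \<delta>: "0 < \<delta>"
  shows "measure W (long_type \<delta> (-1)) * measure W (long_type \<delta> 1) \<le> 0"
proof -
  define B where "B = (\<lambda>l i n. before_first \<delta> n (falls_below (1 / real (Suc l)) (1 / real (Suc i))))"
  have BW: "B l i n \<in> sets W" for l i n unfolding B_def by (intro before_first_indep(1) \<delta> pred_falls_below)
  have Bi: "measure W (B l i n \<inter> long_type \<delta> e) = measure W (long_type \<delta> e) * measure W (B l i n)" for l i n e
    unfolding B_def by (intro before_first_indep(2) \<delta> pred_falls_below)
  \<comment> \<open>\<open>U l\<close> collects minima on which the window \<open>1 / Suc l\<close>
    is small enough for every height to fail on fine grids; \<open>X l i\<close> collects maxima on
    which the height \<open>1 / Suc i\<close> succeeds on fine grids.\<close>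
  define U where "U = (\<lambda>l. long_type \<delta> (-1) \<inter> (\<Inter>i. \<Union>N. \<Inter>n\<in>{N..}. space W - B l i n))"
  define X where "X = (\<lambda>l i. long_type \<delta> 1 \<inter> (\<Union>N. \<Inter>n\<in>{N..}. B l i n))"
  have UW: "U l \<in> sets W" for l unfolding U_def
    by (intro sets.Int long_type_sets sets.countable_UN image_subsetI sets.countable_INT sets.Diff sets.top BW) auto
  have XW: "X l i \<in> sets W" for l i unfolding X_def
    by (intro sets.Int long_type_sets sets.countable_UN image_subsetI sets.countable_INT BW) auto
  let ?c = "\<lambda>e. measure W (long_type \<delta> e)"
  have U: "(\<lambda>l. measure W (long_type \<delta> (-1) \<inter> U l)) \<longlonglongrightarrow> ?c (-1)"
  proof (rule W.measure_eventually_subset[OF UW long_type_sets])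
    show "AE \<omega> in W. \<omega> \<in> long_type \<delta> (-1) \<longrightarrow> (\<forall>\<^sub>F l in sequentially. \<omega> \<in> U l)"
      using AE_regular AE_space
    proof eventually_elim
      fix \<omega> assume reg: "regular \<omega>" and w: "\<omega> \<in> space W"
      show "\<omega> \<in> long_type \<delta> (-1) \<longrightarrow> (\<forall>\<^sub>F l in sequentially. \<omega> \<in> U l)"
      proof
        assume a: "\<omega> \<in> long_type \<delta> (-1)"
        then obtain g n0 where g: "first_long_start (sel \<omega>) \<delta> 0 0 g" "extremum_on_ball (-1) n0 \<omega> g"
          unfolding long_type_def first_long_type_def extremum_at_def by blast
        have "\<omega> \<in> U l" if "2 * n0 + 1 \<le> l" for l
        proof -
          have "\<exists>N. \<forall>n\<in>{N..}. \<omega> \<notin> B l i n" for i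
            using eventually_not_before_first[OF reg w g that] unfolding B_def eventually_sequentially by (simp add: Ball_def)
          then show ?thesis unfolding U_def using a w by auto
        qed
        then show "\<forall>\<^sub>F l in sequentially. \<omega> \<in> U l" unfolding eventually_sequentially by blast
      qed
    qed
  qed
  have X: "(\<lambda>i. measure W (long_type \<delta> 1 \<inter> X l i)) \<longlonglongrightarrow> ?c 1" for l
  proof (rule W.measure_eventually_subset[OF XW long_type_sets])
    show "AE \<omega> in W. \<omega> \<in> long_type \<delta> 1 \<longrightarrow> (\<forall>\<^sub>F i in sequentially. \<omega> \<in> X l i)"
      using AE_regular AE_space
    proof eventually_elim
      fix \<omega> assume reg: "regular \<omega>" and w: "\<omega> \<in> space W"
      show "\<omega> \<in> long_type \<delta> 1 \<longrightarrow> (\<forall>\<^sub>F i in sequentially. \<omega> \<in> X l i)"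
      proof
        assume a: "\<omega> \<in> long_type \<delta> 1"
        then obtain g where g: "first_long_start (sel \<omega>) \<delta> 0 0 g" "extremum_at 1 \<omega> g"
          unfolding long_type_def first_long_type_def by blast
        from eventually_before_first[OF reg w g, of l] show "\<forall>\<^sub>F i in sequentially. \<omega> \<in> X l i"
          unfolding X_def B_def
          by eventually_elim (use a in \<open>auto simp: eventually_sequentially\<close>)
      qed
    qed
  qed
  \<comment> \<open>Independence carries success on maxima over to minima: \<open>?c (-1)\<close>
    times the probability of \<open>B\<close> is that of \<open>B\<close> within the minima, which
    is bounded by the part outside \<open>U l\<close> or where the test does not fail.\<close>
  have main: "?c (-1) * measure W (long_type \<delta> 1 \<inter> X l i) \<le> ?c (-1) - measure W (long_type \<delta> (-1) \<inter> U l)" for l i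
  proof (rule LIMSEQ_le)
    have "AE \<omega> in W. \<omega> \<in> long_type \<delta> 1 \<inter> X l i \<longrightarrow> (\<forall>\<^sub>F n in sequentially. \<omega> \<in> B l i n)"
      unfolding X_def eventually_sequentially by (rule AE_I2) auto
    then have "(\<lambda>n. measure W (long_type \<delta> 1 \<inter> X l i \<inter> B l i n)) \<longlonglongrightarrow> measure W (long_type \<delta> 1 \<inter> X l i)"
      by (intro W.measure_eventually_subset BW sets.Int long_type_sets XW)
    then show "(\<lambda>n. ?c (-1) * measure W (long_type \<delta> 1 \<inter> X l i \<inter> B l i n)) \<longlonglongrightarrow> ?c (-1) * measure W (long_type \<delta> 1 \<inter> X l i)"
      by (rule tendsto_mult_left)
    have "AE \<omega> in W. \<omega> \<in> long_type \<delta> (-1) \<inter> U l \<longrightarrow> (\<forall>\<^sub>F n in sequentially. \<omega> \<in> space W - B l i n)"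
      unfolding U_def eventually_sequentially by (rule AE_I2) (auto simp: Ball_def)
    then have "(\<lambda>n. measure W (long_type \<delta> (-1) \<inter> U l \<inter> (space W - B l i n))) \<longlonglongrightarrow> measure W (long_type \<delta> (-1) \<inter> U l)"
      by (intro W.measure_eventually_subset BW sets.Int sets.Diff sets.top long_type_sets UW)
    then show "(\<lambda>n. ?c (-1) - measure W (long_type \<delta> (-1) \<inter> U l \<inter> (space W - B l i n))) \<longlonglongrightarrow> ?c (-1) - measure W (long_type \<delta> (-1) \<inter> U l)"
      by (intro tendsto_diff tendsto_const)
    have "?c (-1) * measure W (long_type \<delta> 1 \<inter> X l i \<inter> B l i n) \<le> ?c (-1) - measure W (long_type \<delta> (-1) \<inter> U l \<inter> (space W - B l i n))" for n
    proof -
      have "?c (-1) * measure W (long_type \<delta> 1 \<inter> X l i \<inter> B l i n) \<le> ?c (-1) * measure W (B l i n)"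
        by (intro mult_left_mono W.finite_measure_mono BW measure_nonneg) blast
      also have "\<dots> = measure W (B l i n \<inter> long_type \<delta> (-1))" using Bi by (simp only:)
      also have "\<dots> \<le> measure W (long_type \<delta> (-1) - (long_type \<delta> (-1) \<inter> U l \<inter> (space W - B l i n)))"
        by (intro W.finite_measure_mono sets.Diff sets.Int sets.top long_type_sets UW BW) blast
      also have "\<dots> = ?c (-1) - measure W (long_type \<delta> (-1) \<inter> U l \<inter> (space W - B l i n))"
        by (intro W.finite_measure_Diff sets.Diff sets.Int sets.top long_type_sets UW BW) blast
      finally show ?thesis .
    qed
    then show "\<exists>N. \<forall>n\<ge>N. ?c (-1) * measure W (long_type \<delta> 1 \<inter> X l i \<inter> B l i n) \<le> ?c (-1) - measure W (long_type \<delta> (-1) \<inter> U l \<inter> (space W - B l i n))"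
      by blast
  qed
  \<comment> \<open>The height tends to 0 with the window fixed, and only then the window shrinks:
    the height needed at a maximum depends on the window.\<close>
  have "?c (-1) * ?c 1 \<le> ?c (-1) - measure W (long_type \<delta> (-1) \<inter> U l)" for l
    by (rule LIMSEQ_le_const2[OF tendsto_mult_left[OF X]]) (use main in blast)
  moreover have "(\<lambda>l. ?c (-1) - measure W (long_type \<delta> (-1) \<inter> U l)) \<longlonglongrightarrow> 0"
    using tendsto_diff[OF tendsto_const U, of "?c (-1)"] by simp
  ultimately show ?thesis by (intro LIMSEQ_le_const) auto
qed

section \<open>Both types occur with positive probability\<close>

lemma AE_extremum_exists:
  assumes e: "e = 1 \<or> e = -1"
  shows "AE \<omega> in W. \<exists>x. extremum_at e \<omega> x"
  using AE_regular AE_space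
proof eventually_elim
  fix \<omega> assume reg: "regular \<omega>" and w: "\<omega> \<in> space W"
  have osc: "oscillates (1 / real (Suc n)) 0 0 \<omega>" for n
    using reg unfolding regular_def by (metis of_rat_0)
  have w0: "\<omega> 0 = 0" using w by (simp add: space_P Omega0_def)
  have up: "\<exists>q::rat. 0 < q \<and> of_rat q < 1 / real (Suc n) \<and> 0 < e * \<omega> (of_rat q)"
    and down: "\<exists>q::rat. 0 < q \<and> of_rat q < 1 / real (Suc n) \<and> e * \<omega> (of_rat q) < 0" for n
    using osc[of n] e unfolding oscillates_def w0 by auto
  obtain q :: rat where q: "0 < q" "e * \<omega> (of_rat q) < 0" using down by blast
  have q0: "(0::real) < of_rat q" using q by simp
  obtain n where n: "1 / real (Suc n) < of_rat q" using inverse_Suc_less[OF q0] by blast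
  obtain q' :: rat where q': "0 < q'" "of_rat q' < 1 / real (Suc n)" "0 < e * \<omega> (of_rat q')" using up by blast
  have "continuous_on {0..of_rat q} (\<lambda>x. e * \<omega> x)"
    using continuous_on_subset[OF continuous_path[OF w]] by (intro continuous_intros) auto
  \<comment> \<open>The function is 0 at the left end, negative at the right end and positive
    somewhere between, so its maximum on the interval is interior.\<close>
  then obtain x where x: "x \<in> {0..of_rat q}" "\<And>y. y \<in> {0..of_rat q} \<Longrightarrow> e * \<omega> y \<le> e * \<omega> x"
    using continuous_attains_sup[of "{0..of_rat q}" "\<lambda>x. e * \<omega> x"] q0 by auto
  have "(0::real) < of_rat q'" using q' by simp
  then have "0 < e * \<omega> x" using x(2)[of "of_rat q'"] q' n by auto
  then have "x \<noteq> 0" "x \<noteq> of_rat q" using q w0 by auto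
  then have "0 < min x (of_rat q - x)" using x by auto
  then obtain m where m: "1 / real (Suc m) < min x (of_rat q - x)" using inverse_Suc_less by blast
  have "extremum_on_ball e m \<omega> x"
    unfolding extremum_on_ball_def using x m by (auto simp: abs_less_iff)
  then show "\<exists>x. extremum_at e \<omega> x" unfolding extremum_at_def by blast
qed

text \<open>By exhaustion every extremum is a selected point, and stationarity moves the interval
  that selects it to one starting at 0.\<close>

lemma record_extremum_exists:
  assumes e: "e = 1 \<or> e = -1"
  obtains h where "0 < h" "\<not> (AE \<omega> in W. \<not> extremum_at e \<omega> (sel \<omega> 0 h))"
proof (rule ccontr)
  assume neg: "\<not> thesis"
  have all: "AE \<omega> in W. s < t \<longrightarrow> \<not> extremum_at e \<omega> (sel \<omega> s t)" for s t
  proof (rule AE_impI)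
    assume st: "s < t"
    then have "AE \<omega> in W. \<not> extremum_at e \<omega> (sel \<omega> 0 (t - s))" using neg that[of "t - s"] by auto
    from AE_levy_shift[OF this, of "of_rat s"] AE_sel_shift[of s]
    show "AE \<omega> in W. \<not> extremum_at e \<omega> (sel \<omega> s t)"
    proof eventually_elim
      fix \<omega> assume a: "\<not> extremum_at e (levy_shift (of_rat s) \<omega>) (sel (levy_shift (of_rat s) \<omega>) 0 (t - s))"
        and b: "\<forall>s' t. s' < t \<longrightarrow> sel \<omega> (s' + s) (t + s) = of_rat s + sel (levy_shift (of_rat s) \<omega>) s' t"
      have "0 < t - s" using st by simp
      from b[rule_format, OF this] show "\<not> extremum_at e \<omega> (sel \<omega> s t)"
        using a unfolding extremum_at_levy_shift by simp
    qed
  qed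
  have "AE \<omega> in W. Some ` local_extrema \<omega> = {\<tau> s t \<omega> | s t. s \<in> \<rat> \<and> t \<in> \<rat> \<and> s < t}"
    using honest unfolding honest_indexation_def by blast
  moreover have "AE \<omega> in W. \<forall>s t. s < t \<longrightarrow> \<not> extremum_at e \<omega> (sel \<omega> s t)"
    unfolding AE_all_countable using all by blast
  ultimately have "AE \<omega> in W. False" using AE_extremum_exists[OF e]
  proof eventually_elim
    fix \<omega> assume ex: "Some ` local_extrema \<omega> = {\<tau> s t \<omega> | s t. s \<in> \<rat> \<and> t \<in> \<rat> \<and> s < t}"
      and no: "\<forall>s t. s < t \<longrightarrow> \<not> extremum_at e \<omega> (sel \<omega> s t)" and "\<exists>x. extremum_at e \<omega> x"
    then obtain x where x: "extremum_at e \<omega> x" by blast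
    then have "x \<in> local_extrema \<omega>" using e unfolding local_extrema_iff by blast
    then have "Some x \<in> {\<tau> s t \<omega> | s t. s \<in> \<rat> \<and> t \<in> \<rat> \<and> s < t}" using ex by blast
    then obtain s t where st: "Some x = \<tau> s t \<omega>" "s \<in> \<rat>" "t \<in> \<rat>" "s < t" by blast
    obtain s' t' where st': "s = of_rat s'" "t = of_rat t'" using st(2,3) by (auto elim!: Rats_cases)
    have "sel \<omega> s' t' = x" unfolding sel_def st'[symmetric] st(1)[symmetric] by simp
    moreover have "s' < t'" using st(4) unfolding st' by (simp add: of_rat_less)
    ultimately show False using no x by blast
  qed
  then show False by simp
qed

text \<open>A selected point of type \<open>e\<close> that is long is the first long one beyond some
  rational \<open>t\<close>. By regeneration this has probability at most that of
  \<open>long_type \<delta> e\<close>, so a vanishing value would exclude all such points.\<close>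

lemma long_type_positive:
  assumes e: "e = 1 \<or> e = -1"
  obtains \<delta>0 where "0 < \<delta>0" "\<And>\<delta>. 0 < \<delta> \<Longrightarrow> \<delta> \<le> \<delta>0 \<Longrightarrow> 0 < measure W (long_type \<delta> e)"
proof -
  obtain h where h: "0 < h" "\<not> (AE \<omega> in W. \<not> extremum_at e \<omega> (sel \<omega> 0 h))"
    using record_extremum_exists[OF e] by blast
  have "\<exists>n. \<not> (AE \<omega> in W. \<not> (extremum_at e \<omega> (sel \<omega> 0 h) \<and> sel \<omega> 0 h + 1 / real (Suc n) < of_rat h))"
  proof (rule ccontr)
    assume "\<not> ?thesis"
    then have "AE \<omega> in W. \<forall>n. \<not> (extremum_at e \<omega> (sel \<omega> 0 h) \<and> sel \<omega> 0 h + 1 / real (Suc n) < of_rat h)"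
      unfolding AE_all_countable by blast
    then have "AE \<omega> in W. \<not> extremum_at e \<omega> (sel \<omega> 0 h)"
      using AE_sel
    proof eventually_elim
      fix \<omega> assume a: "\<forall>n. \<not> (extremum_at e \<omega> (sel \<omega> 0 h) \<and> sel \<omega> 0 h + 1 / real (Suc n) < of_rat h)"
        and b: "\<forall>s t. s < t \<longrightarrow> \<tau> (of_rat s) (of_rat t) \<omega> = Some (sel \<omega> s t) \<and>
           of_rat s < sel \<omega> s t \<and> sel \<omega> s t < of_rat t \<and> sel \<omega> s t \<in> local_extrema \<omega>"
      have "0 < of_rat h - sel \<omega> 0 h" using b h(1) by auto
      then obtain n where "1 / real (Suc n) < of_rat h - sel \<omega> 0 h" using inverse_Suc_less by blast
      then have "sel \<omega> 0 h + 1 / real (Suc n) < of_rat h" by linarith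
      then show "\<not> extremum_at e \<omega> (sel \<omega> 0 h)" using a by blast
    qed
    then show False using h(2) by blast
  qed
  then obtain n where n: "\<not> (AE \<omega> in W. \<not> (extremum_at e \<omega> (sel \<omega> 0 h) \<and> sel \<omega> 0 h + 1 / real (Suc n) < of_rat h))" ..
  \<comment> \<open>A record longer than \<open>1 / Suc n\<close> is long for every smaller
    threshold too; this allows a common \<delta> for both types.\<close>
  have "0 < measure W (long_type \<delta> e)" if \<delta>: "0 < \<delta>" "\<delta> \<le> 1 / real (Suc n)" for \<delta>
  proof (rule ccontr)
    assume "\<not> 0 < measure W (long_type \<delta> e)"
    then have z: "measure W {\<omega>\<in>space W. first_long_type \<delta> 0 0 e \<omega>} = 0"
      unfolding long_type_def by (simp add: zero_less_measure_iff measure_le_0_iff)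
    have "AE \<omega> in W. 0 \<le> t \<longrightarrow> \<not> (\<omega> \<in> restarted_ever (of_rat t) \<and> first_long_type \<delta> 0 (of_rat t) e \<omega>)" for t :: rat
    proof (rule AE_impI)
      assume "0 \<le> t"
      then have t: "(0::real) \<le> of_rat t" by simp
      let ?S = "space W \<inter> restarted_ever (of_rat t) \<inter> {\<omega>\<in>space W. first_long_type \<delta> 0 (of_rat t) e \<omega>}"
      have "measure W ?S = 0"
        using first_long_type_regeneration[OF t \<delta>(1) sets.top restarted_in_past[OF t], of e] unfolding z by simp
      moreover have "?S \<in> sets W" by (intro sets.Int sets.top restarted_sets t first_long_type_sets)
      ultimately have "?S \<in> null_sets W" by (simp add: null_sets_def W.emeasure_eq_measure)
      then have "AE \<omega> in W. \<omega> \<notin> ?S" by (rule AE_not_in)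
      then show "AE \<omega> in W. \<not> (\<omega> \<in> restarted_ever (of_rat t) \<and> first_long_type \<delta> 0 (of_rat t) e \<omega>)"
        using AE_space by eventually_elim blast
    qed
    then have "AE \<omega> in W. \<forall>t::rat. 0 \<le> t \<longrightarrow> \<not> (\<omega> \<in> restarted_ever (of_rat t) \<and> first_long_type \<delta> 0 (of_rat t) e \<omega>)"
      unfolding AE_all_countable by blast
    then have "AE \<omega> in W. \<not> (extremum_at e \<omega> (sel \<omega> 0 h) \<and> sel \<omega> 0 h + 1 / real (Suc n) < of_rat h)"
      using AE_regular AE_space
    proof eventually_elim
      fix \<omega> assume a: "\<forall>t::rat. 0 \<le> t \<longrightarrow> \<not> (\<omega> \<in> restarted_ever (of_rat t) \<and> first_long_type \<delta> 0 (of_rat t) e \<omega>)"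
        and reg: "regular \<omega>" and w: "\<omega> \<in> space W"
      interpret nested_selection "sel \<omega>" using reg unfolding regular_def by blast
      show "\<not> (extremum_at e \<omega> (sel \<omega> 0 h) \<and> sel \<omega> 0 h + 1 / real (Suc n) < of_rat h)"
      proof
        assume b: "extremum_at e \<omega> (sel \<omega> 0 h) \<and> sel \<omega> 0 h + 1 / real (Suc n) < of_rat h"
        then have "sel \<omega> 0 h + \<delta> < of_rat h" using \<delta> by linarith
        from long_record_is_first[OF h(1) this \<delta>(1)] obtain t where t: "0 \<le> t" "first_long_start (sel \<omega>) \<delta> 0 (of_rat t) (sel \<omega> 0 h)"
          by blast
        then obtain y where y: "0 < y" "of_rat t < sel \<omega> 0 y" unfolding first_long_start_def long_start_def by blast
        have "real_of_rat t < of_rat y" using between[OF y(1)] y(2) by linarith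
        then have "restarts (sel \<omega>) (of_rat t) (y + 1)" unfolding restarts_def using y by (intro exI[of _ y]) auto
        then have "\<omega> \<in> restarted_ever (of_rat t)" unfolding restarted_ever_def restarted_def using w by blast
        moreover have "first_long_type \<delta> 0 (of_rat t) e \<omega>" unfolding first_long_type_def using t b by blast
        ultimately show False using a t(1) by blast
      qed
    qed
    then show False using n by blast
  qed
  then show thesis by (intro that[of "1 / real (Suc n)"]) auto
qed

lemma no_honest_wiener: False
proof -
  obtain d1 where d1: "0 < d1" "\<And>\<delta>. 0 < \<delta> \<Longrightarrow> \<delta> \<le> d1 \<Longrightarrow> 0 < measure W (long_type \<delta> 1)"
    using long_type_positive[of 1] by auto
  obtain d2 where d2: "0 < d2" "\<And>\<delta>. 0 < \<delta> \<Longrightarrow> \<delta> \<le> d2 \<Longrightarrow> 0 < measure W (long_type \<delta> (-1))"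
    using long_type_positive[of "-1"] by auto
  have "0 < min d1 d2" using d1 d2 by simp
  moreover have "0 < measure W (long_type (min d1 d2) (-1)) * measure W (long_type (min d1 d2) 1)"
    using d1 d2 by (intro mult_pos_pos) auto
  ultimately show False using long_types_exclusive[of "min d1 d2"] by linarith
qed

end

theorem corollary6p7:
  fixes W :: "(real \<Rightarrow> real) measure"
  assumes "two_sided_wiener_measure W"
  shows "\<not> (\<exists>\<tau>. honest_indexation W local_extrema \<tau>)"
proof
  assume "\<exists>\<tau>. honest_indexation W local_extrema \<tau>"
  then obtain \<tau> where \<tau>: "honest_indexation W local_extrema \<tau>" ..
  obtain P where P: "W = completion P" "wiener_space P"
    using assms unfolding two_sided_wiener_measure_def wiener_space_def wiener_space_axioms_def by blast
  have "honest_wiener P \<tau>"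
    using \<tau> P unfolding honest_wiener_def honest_wiener_axioms_def by blast
  then show False by (rule honest_wiener.no_honest_wiener)
qed

end
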